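(* If $\mathbf T\in\mathbf B_{\mathbf n}(\mathcal H)$ has trace class defect, then $$0\le\mathrm{curv}(\mathbf T)\le\mathrm{trace}\left[\mathbf\Delta_{\mathbf T}(I)\right]\le\mathrm{rank}\left[\mathbf\Delta_{\mathbf T}(I)\right].$$
   Context: All Hilbert spaces are complex; $\mathbb N=\{1,2,\ldots\}$. Fix $k\in\mathbb N$ and $\mathbf n=(n_1,\ldots,n_k)\in\mathbb N^k$. For $X_i=(X_{i,1},\ldots,X_{i,n_i})\in B(\mathcal H)^{n_i}$ let $\Phi_{X_i}(Y)=\sum_{j=1}^{n_i}X_{i,j}YX_{i,j}^*$ for $Y\in B(\mathcal H)$. The regular polyball $\mathbf B_{\mathbf n}(\mathcal H)$ is the set of all $\mathbf X=(X_1,\ldots,X_k)$ with $X_i\in B(\mathcal H)^{n_i}$ such that every entry of $X_s$ commutes with every entry of $X_t$ whenever $s\ne t$ (entries of the same $X_s$ need not commute) and $(id-\Phi_{X_1})^{p_1}\circ\cdots\circ(id-\Phi_{X_k})^{p_k}(I)\ge0$ for all $(p_1,\ldots,p_k)\in\{0,1\}^k$. Put $\mathbf\Delta_{\mathbf X}=(id-\Phi_{X_1})\circ\cdots\circ(id-\Phi_{X_k})$. $\mathbf T\in\mathbf B_{\mathbf n}(\mathcal H)$ has trace class defect if $\mathbf\Delta_{\mathbf T}(I)$ is a trace class operator. Put $\mathcal D_{\mathbf T}=\overline{\mathbf\Delta_{\mathbf T}(I)\mathcal H}$. The rank of an operator may be $\infty$. $F^2(H_{n_i})=\mathbb C1\oplus\bigoplus_{p\ge1}H_{n_i}^{\otimes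 p}$ is the full Fock space of an $n_i$-dimensional Hilbert space $H_{n_i}$ with orthonormal basis $e^i_1,\ldots,e^i_{n_i}$. $\mathbb F_{n_i}^+$ is the free unital semigroup on $n_i$ generators $g_1^i,\ldots,g_{n_i}^i$ with length $|\cdot|$; for $\alpha=g^i_{j_1}\cdots g^i_{j_p}$ put $e^i_\alpha=e^i_{j_1}\otimes\cdots\otimes e^i_{j_p}$ and $T_{i,\alpha}=T_{i,j_1}\cdots T_{i,j_p}$, while for the neutral element $e^i_\alpha=1$ and $T_{i,\alpha}=I$. The Berezin kernel of $\mathbf T$ is $\mathbf K_{\mathbf T}:\mathcal H\to F^2(H_{n_1})\otimes\cdots\otimes F^2(H_{n_k})\otimes\mathcal D_{\mathbf T}$, $$\mathbf K_{\mathbf T}h=\sum_{\beta_i\in\mathbb F_{n_i}^+,\,i=1,\ldots,k}e^1_{\beta_1}\otimes\cdots\otimes e^k_{\beta_k}\otimes\mathbf\Delta_{\mathbf T}(I)^{1/2}T_{1,\beta_1}^*\cdots T_{k,\beta_k}^*h.$$ $P^{(i)}_q$ is the orthogonal projection of $F^2(H_{n_i})$ onto the span of all $e^i_\alpha$ with $|\alpha|=q$. The curvature of $\mathbf T$ with trace class defect is $$\mathrm{curv}(\mathbf T):=\lim_{m\to\infty}\frac1{\binom{m+k}{k}}\sum_{\substack{q_1\ge0,\ldots,q_k\ge0\\ q_1+\cdots+q_k\le m}}\frac{\mathrm{trace}\left[\mathbf K_{\mathbf T}^*(P^{(1)}_{q_1}\otimes\cdots\otimes P^{(k)}_{q_k}\otimes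 I_{\mathcal D_{\mathbf T}})\mathbf K_{\mathbf T}\right]}{\mathrm{trace}\left[P^{(1)}_{q_1}\otimes\cdots\otimes P^{(k)}_{q_k}\right]}$$ (this limit exists). *)

theory Defs
  imports "HOL-Analysis.Analysis" "HOL-Library.Complex_Order"
begin

section \<open>Complex Hilbert spaces\<close>

class chilbert_space = banach +
  fixes scaleC :: "complex \<Rightarrow> 'a \<Rightarrow> 'a" (infixr "*\<^sub>C" 75)
    and cinner :: "'a \<Rightarrow> 'a \<Rightarrow> complex"
  assumes scaleC_add_right: "c *\<^sub>C (x + y) = c *\<^sub>C x + c *\<^sub>C y"
    and scaleC_add_left: "(c + d) *\<^sub>C x = c *\<^sub>C x + d *\<^sub>C x"
    and scaleC_scaleC: "c *\<^sub>C d *\<^sub>C x = (c * d) *\<^sub>C x"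
    and scaleC_of_real: "complex_of_real r *\<^sub>C x = r *\<^sub>R x"
    and cinner_commute: "cinner x y = cnj (cinner y x)"
    and cinner_add_left: "cinner (x + y) z = cinner x z + cinner y z"
    and cinner_scaleC_left: "cinner (c *\<^sub>C x) y = c * cinner x y"
    and cinner_self: "cinner x x = complex_of_real ((norm x)\<^sup>2)"

lemma scaleC_one: "1 *\<^sub>C x = (x::'a::chilbert_space)"
  using scaleC_of_real[of 1 x] by simp

global_interpretation cvec: vector_space "scaleC :: complex \<Rightarrow> 'a \<Rightarrow> 'a::chilbert_space"
  by unfold_locales (auto simp: scaleC_add_right scaleC_add_left scaleC_scaleC scaleC_one)

instantiation complex :: chilbert_space
begin

definition scaleC_complex :: "complex \<Rightarrow> complex \<Rightarrow> complex"
  where "scaleC_complex c x = c * x"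

definition cinner_complex :: "complex \<Rightarrow> complex \<Rightarrow> complex"
  where "cinner_complex x y = x * cnj y"

instance
proof
  show "cinner x x = complex_of_real ((norm x)\<^sup>2)" for x :: complex
    unfolding cinner_complex_def by (rule complex_norm_square[symmetric])
qed (auto simp: scaleC_complex_def cinner_complex_def algebra_simps scaleR_conv_of_real)

end

lemma cinner_add_right:
  "cinner x (y + z) = cinner x y + cinner x (z::'a::chilbert_space)"
  by (metis cinner_add_left cinner_commute complex_cnj_add)

lemma cinner_scaleC_right:
  "cinner x (c *\<^sub>C y) = cnj c * cinner x (y::'a::chilbert_space)"
  by (metis cinner_scaleC_left cinner_commute complex_cnj_mult)

lemma norm_scaleC: "norm (c *\<^sub>C x) = cmod c * norm (x::'a::chilbert_space)"
proof -
  have "complex_of_real ((norm (c *\<^sub>C x))\<^sup>2) = c * cnj c * of_real ((norm x)\<^sup>2)"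
    unfolding cinner_self[symmetric]
    by (simp add: cinner_scaleC_left cinner_scaleC_right mult.assoc)
  also have "\<dots> = of_real ((cmod c * norm x)\<^sup>2)"
    by (simp add: complex_norm_square[symmetric] power_mult_distrib)
  finally have "(norm (c *\<^sub>C x))\<^sup>2 = (cmod c * norm x)\<^sup>2"
    using of_real_eq_iff by blast
  then show ?thesis
    by (rule power2_eq_imp_eq) auto
qed

lemma cmod_cinner_le: "cmod (cinner x y) \<le> norm x * norm (y::'a::chilbert_space)"
proof (cases "y = 0")
  case True
  have "cinner x 0 = 0"
    using cinner_add_right[of x 0 0] by simp
  then show ?thesis using True by simp
next
  case False
  define b where "b = cinner x y"
  define s where "s = (norm y)\<^sup>2"
  have s: "s > 0" using False by (simp add: s_def)
  have yx: "cinner y x = cnj b" unfolding b_def by (rule cinner_commute)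
  have yy: "cinner y y = of_real s" unfolding s_def by (rule cinner_self)
  let ?z = "of_real s *\<^sub>C x + (- b) *\<^sub>C y"
  have "complex_of_real ((norm ?z)\<^sup>2) = cinner ?z ?z"
    by (rule cinner_self[symmetric])
  also have "\<dots> = of_real s * (of_real s * of_real ((norm x)\<^sup>2)) - of_real s * (cnj b * b)"
    by (simp only: cinner_add_left cinner_add_right cinner_scaleC_left cinner_scaleC_right yx yy
        b_def[symmetric] cinner_self[of x] complex_cnj_complex_of_real complex_cnj_minus)
      (simp add: algebra_simps)
  also have "\<dots> = of_real (s * (s * (norm x)\<^sup>2 - (cmod b)\<^sup>2))"
    using complex_norm_square[of b] by (simp add: algebra_simps)
  finally have "(norm ?z)\<^sup>2 = s * (s * (norm x)\<^sup>2 - (cmod b)\<^sup>2)"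
    using of_real_eq_iff by blast
  then have "0 \<le> s * (s * (norm x)\<^sup>2 - (cmod b)\<^sup>2)"
    by (metis zero_le_power2)
  then have "(cmod b)\<^sup>2 \<le> (norm x * norm y)\<^sup>2"
    using s by (simp add: zero_le_mult_iff power_mult_distrib s_def mult.commute)
  then show ?thesis
    unfolding b_def by (rule power2_le_imp_le) simp
qed


section \<open>Bounded operators\<close>

text \<open>A bounded operator is an element of the library type of bounded \<^emph>\<open>real\<close>-linear maps that is
  moreover complex-linear.\<close>

definition clinear_op :: "('a::chilbert_space \<Rightarrow>\<^sub>L 'b::chilbert_space) \<Rightarrow> bool"
  where "clinear_op A \<longleftrightarrow> (\<forall>c x. A (c *\<^sub>C x) = c *\<^sub>C A x)"

definition adj :: "('a::chilbert_space \<Rightarrow>\<^sub>L 'b::chilbert_space) \<Rightarrow> ('b \<Rightarrow>\<^sub>L 'a)"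
  where "adj A = (THE B :: 'b \<Rightarrow>\<^sub>L 'a. \<forall>x y. cinner (A x) y = cinner x (B y))"

text \<open>The order on \<^typ>\<open>complex\<close> is \<^prop>\<open>z \<le> w \<longleftrightarrow> Re z \<le> Re w \<and> Im z = Im w\<close>, so
  \<^prop>\<open>(0::complex) \<le> z\<close> includes that \<^term>\<open>z\<close> is real.\<close>

definition positive_op :: "('a::chilbert_space \<Rightarrow>\<^sub>L 'a) \<Rightarrow> bool"
  where "positive_op A \<longleftrightarrow> clinear_op A \<and> (\<forall>x. 0 \<le> cinner (A x) x)"

definition sqrt_op :: "('a::chilbert_space \<Rightarrow>\<^sub>L 'a) \<Rightarrow> ('a \<Rightarrow>\<^sub>L 'a)"
  where "sqrt_op A = (THE B. positive_op B \<and> B o\<^sub>L B = A)"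

definition abs_op :: "('a::chilbert_space \<Rightarrow>\<^sub>L 'a) \<Rightarrow> ('a \<Rightarrow>\<^sub>L 'a)"
  where "abs_op A = sqrt_op (adj A o\<^sub>L A)"

definition is_onb :: "'a::chilbert_space set \<Rightarrow> bool"
  where "is_onb E \<longleftrightarrow>
    (\<forall>x\<in>E. \<forall>y\<in>E. cinner x y = (if x = y then 1 else 0)) \<and> closure (cvec.span E) = UNIV"

definition trace_class :: "('a::chilbert_space \<Rightarrow>\<^sub>L 'a) \<Rightarrow> bool"
  where "trace_class A \<longleftrightarrow>
    clinear_op A \<and> (\<exists>E. is_onb E \<and> (\<lambda>e. cinner (abs_op A e) e) summable_on E)"

text \<open>Only meaningful for trace class operators, where the choice of the basis is immaterial.\<close>

definition op_trace :: "('a::chilbert_space \<Rightarrow>\<^sub>L 'a) \<Rightarrow> complex"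
  where "op_trace A = (\<Sum>\<^sub>\<infinity>e\<in>(SOME E. is_onb E). cinner (A e) e)"

definition op_rank :: "('a::chilbert_space \<Rightarrow>\<^sub>L 'b::chilbert_space) \<Rightarrow> enat"
  where "op_rank A =
    (if \<exists>F. finite F \<and> range A \<subseteq> cvec.span F then enat (cvec.dim (range A)) else \<infinity>)"

definition proj_onto :: "'a::chilbert_space set \<Rightarrow> ('a \<Rightarrow>\<^sub>L 'a)"
  where "proj_onto M = (THE P :: 'a \<Rightarrow>\<^sub>L 'a. \<forall>x. P x \<in> M \<and> (\<forall>y\<in>M. cinner (x - P x) y = 0))"


section \<open>Square-summable families\<close>

typedef (overloaded) ('i, 'a) ell2 =
  "{f :: 'i \<Rightarrow> 'a::chilbert_space. (\<lambda>i. (norm (f i))\<^sup>2) summable_on UNIV}"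
  morphisms coord Abs_ell2
  by (rule exI[of _ "\<lambda>_. 0"]) simp

lemma coord_summable: "(\<lambda>i. (norm (coord f i))\<^sup>2) summable_on UNIV"
  using coord[of f] by simp

lemma ell2_summableI:
  fixes f :: "'i \<Rightarrow> 'a::chilbert_space"
  assumes "\<And>F. finite F \<Longrightarrow> (\<Sum>i\<in>F. (norm (f i))\<^sup>2) \<le> C"
  shows "(\<lambda>i. (norm (f i))\<^sup>2) summable_on UNIV"
  by (rule nonneg_bdd_above_summable_on) (auto intro!: bdd_aboveI assms)

lemma ell2_summable_add:
  fixes f g :: "'i \<Rightarrow> 'a::chilbert_space"
  assumes "(\<lambda>i. (norm (f i))\<^sup>2) summable_on UNIV" "(\<lambda>i. (norm (g i))\<^sup>2) summable_on UNIV"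
  shows "(\<lambda>i. (norm (f i + g i))\<^sup>2) summable_on UNIV"
proof (rule ell2_summableI)
  fix F :: "'i set" assume F: "finite F"
  have le: "(norm (f i + g i))\<^sup>2 \<le> 2 * (norm (f i))\<^sup>2 + 2 * (norm (g i))\<^sup>2" for i
  proof -
    have "(norm (f i + g i))\<^sup>2 \<le> (norm (f i) + norm (g i))\<^sup>2"
      by (intro power_mono norm_triangle_ineq) auto
    also have "\<dots> \<le> 2 * (norm (f i))\<^sup>2 + 2 * (norm (g i))\<^sup>2"
      using zero_le_power2[of "norm (f i) - norm (g i)"]
      by (simp add: power2_sum power2_diff)
    finally show ?thesis .
  qed
  have "(\<Sum>i\<in>F. (norm (f i + g i))\<^sup>2) \<le> 2 * (\<Sum>i\<in>F. (norm (f i))\<^sup>2) + 2 * (\<Sum>i\<in>F. (norm (g i))\<^sup>2)"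
    unfolding sum_distrib_left sum.distrib[symmetric] by (intro sum_mono le)
  also have "\<dots> \<le> 2 * (\<Sum>\<^sub>\<infinity>i. (norm (f i))\<^sup>2) + 2 * (\<Sum>\<^sub>\<infinity>i. (norm (g i))\<^sup>2)"
    by (intro add_mono mult_left_mono finite_sum_le_infsum assms F) auto
  finally show "(\<Sum>i\<in>F. (norm (f i + g i))\<^sup>2) \<le>
      2 * (\<Sum>\<^sub>\<infinity>i. (norm (f i))\<^sup>2) + 2 * (\<Sum>\<^sub>\<infinity>i. (norm (g i))\<^sup>2)" .
qed

lemma ell2_summable_scaleC:
  fixes f :: "'i \<Rightarrow> 'a::chilbert_space"
  assumes "(\<lambda>i. (norm (f i))\<^sup>2) summable_on UNIV"
  shows "(\<lambda>i. (norm (c *\<^sub>C f i))\<^sup>2) summable_on UNIV"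
  unfolding norm_scaleC power_mult_distrib
  by (rule summable_on_cmult_right) (rule assms)

lemma ell2_summable_cinner:
  fixes f g :: "'i \<Rightarrow> 'a::chilbert_space"
  assumes "(\<lambda>i. (norm (f i))\<^sup>2) summable_on UNIV" "(\<lambda>i. (norm (g i))\<^sup>2) summable_on UNIV"
  shows "(\<lambda>i. cinner (f i) (g i)) summable_on UNIV"
proof (rule Infinite_Sum.abs_summable_summable, rule Infinite_Sum.abs_summable_on_comparison_test)
  show "(\<lambda>i. norm ((norm (f i))\<^sup>2 + (norm (g i))\<^sup>2)) summable_on UNIV"
    using summable_on_add[OF assms] by simp
  fix i
  have "cmod (cinner (f i) (g i)) \<le> norm (f i) * norm (g i)"
    by (rule cmod_cinner_le)
  also have "\<dots> \<le> (norm (f i))\<^sup>2 + (norm (g i))\<^sup>2"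
  proof -
    have "0 \<le> norm (f i) * norm (g i)" by simp
    then show ?thesis
      using sum_squares_bound[of "norm (f i)" "norm (g i)"] by linarith
  qed
  finally show "norm (cinner (f i) (g i)) \<le> norm ((norm (f i))\<^sup>2 + (norm (g i))\<^sup>2)"
    by simp
qed

instantiation ell2 :: (type, chilbert_space) real_vector
begin

definition zero_ell2 :: "('a, 'b) ell2" where "zero_ell2 = Abs_ell2 (\<lambda>_. 0)"
definition plus_ell2 :: "('a, 'b) ell2 \<Rightarrow> ('a, 'b) ell2 \<Rightarrow> ('a, 'b) ell2"
  where "plus_ell2 f g = Abs_ell2 (\<lambda>i. coord f i + coord g i)"
definition uminus_ell2 :: "('a, 'b) ell2 \<Rightarrow> ('a, 'b) ell2"
  where "uminus_ell2 f = Abs_ell2 (\<lambda>i. - coord f i)"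
definition minus_ell2 :: "('a, 'b) ell2 \<Rightarrow> ('a, 'b) ell2 \<Rightarrow> ('a, 'b) ell2"
  where "minus_ell2 f g = Abs_ell2 (\<lambda>i. coord f i - coord g i)"
definition scaleR_ell2 :: "real \<Rightarrow> ('a, 'b) ell2 \<Rightarrow> ('a, 'b) ell2"
  where "scaleR_ell2 r f = Abs_ell2 (\<lambda>i. r *\<^sub>R coord f i)"

lemma coord_0 [simp]: "coord 0 i = 0"
  unfolding zero_ell2_def by (subst Abs_ell2_inverse) auto

lemma coord_add [simp]: "coord (f + g) i = coord f i + coord g i"
  unfolding plus_ell2_def
  by (subst Abs_ell2_inverse) (auto intro!: ell2_summable_add coord_summable)

lemma coord_uminus [simp]: "coord (- f) i = - coord f i"
  unfolding uminus_ell2_def by (subst Abs_ell2_inverse) (auto intro!: coord_summable)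

lemma coord_diff [simp]: "coord (f - g) i = coord f i - coord g i"
proof -
  have "(\<lambda>i. (norm (coord f i + (- coord g i)))\<^sup>2) summable_on UNIV"
    by (rule ell2_summable_add) (auto intro!: coord_summable)
  then show ?thesis
    unfolding minus_ell2_def by (subst Abs_ell2_inverse) auto
qed

lemma coord_scaleR [simp]: "coord (r *\<^sub>R f) i = r *\<^sub>R coord f i"
  unfolding scaleR_ell2_def scaleC_of_real[symmetric]
  by (subst Abs_ell2_inverse) (auto intro!: ell2_summable_scaleC coord_summable)

instance
  by standard
    (auto simp: coord_inject[symmetric] fun_eq_iff scaleR_add_right scaleR_add_left)

end

instantiation ell2 :: (type, chilbert_space) real_normed_vector
begin

definition norm_ell2 :: "('a, 'b) ell2 \<Rightarrow> real"
  where "norm_ell2 f = sqrt (\<Sum>\<^sub>\<infinity>i. (norm (coord f i))\<^sup>2)"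
definition sgn_ell2 :: "('a, 'b) ell2 \<Rightarrow> ('a, 'b) ell2"
  where "sgn_ell2 f = inverse (norm f) *\<^sub>R f"
definition dist_ell2 :: "('a, 'b) ell2 \<Rightarrow> ('a, 'b) ell2 \<Rightarrow> real"
  where "dist_ell2 f g = norm (f - g)"
definition uniformity_ell2 :: "(('a, 'b) ell2 \<times> ('a, 'b) ell2) filter"
  where "uniformity_ell2 = (INF e\<in>{0<..}. principal {(x, y). dist x y < e})"
definition open_ell2 :: "('a, 'b) ell2 set \<Rightarrow> bool"
  where "open_ell2 U \<longleftrightarrow> (\<forall>x\<in>U. eventually (\<lambda>(x', y). x' = x \<longrightarrow> y \<in> U) uniformity)"

lemma norm_ell2_square: "(norm f)\<^sup>2 = (\<Sum>\<^sub>\<infinity>i. (norm (coord f i))\<^sup>2)" for f :: "('a, 'b) ell2"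
  unfolding norm_ell2_def by (rule real_sqrt_pow2) (auto intro!: infsum_nonneg)

lemma norm_ell2_ge0: "0 \<le> norm f" for f :: "('a, 'b) ell2"
  unfolding norm_ell2_def by (auto intro!: infsum_nonneg)

lemma L2_set_coord_le: "finite F \<Longrightarrow> L2_set (\<lambda>i. norm (coord f i)) F \<le> norm f"
  for f :: "('a, 'b) ell2"
  unfolding norm_ell2_def L2_set_def
  by (intro real_sqrt_le_mono finite_sum_le_infsum coord_summable) auto

lemma norm_ell2_le:
  fixes f :: "('a, 'b) ell2"
  assumes "\<And>F. finite F \<Longrightarrow> (\<Sum>i\<in>F. (norm (coord f i))\<^sup>2) \<le> C\<^sup>2" and "0 \<le> C"
  shows "norm f \<le> C"
  unfolding norm_ell2_def
  by (rule real_le_lsqrt) (auto intro!: infsum_nonneg infsum_le_finite_sums coord_summable assms)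

lemma norm_coord_le: "norm (coord f i) \<le> norm f" for f :: "('a, 'b) ell2"
  using L2_set_coord_le[of "{i}" f] by simp

instance
proof
  fix f g :: "('a, 'b) ell2" and r :: real
  show "norm f = 0 \<longleftrightarrow> f = 0"
  proof
    assume "norm f = 0"
    then have "coord f i = 0" for i
      using norm_coord_le[of f i] by simp
    then show "f = 0" by (simp add: coord_inject[symmetric] fun_eq_iff)
  qed (simp add: norm_ell2_def)
  show "norm (f + g) \<le> norm f + norm g"
  proof (rule norm_ell2_le)
    fix F :: "'a set" assume F: "finite F"
    have "L2_set (\<lambda>i. norm (coord (f + g) i)) F
        \<le> L2_set (\<lambda>i. norm (coord f i) + norm (coord g i)) F"
      by (rule L2_set_mono) (auto intro: norm_triangle_ineq)
    also have "\<dots> \<le> L2_set (\<lambda>i. norm (coord f i)) F + L2_set (\<lambda>i. norm (coord g i)) F"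
      by (rule L2_set_triangle_ineq)
    also have "\<dots> \<le> norm f + norm g"
      by (intro add_mono L2_set_coord_le F)
    finally have "(L2_set (\<lambda>i. norm (coord (f + g) i)) F)\<^sup>2 \<le> (norm f + norm g)\<^sup>2"
      by (rule power_mono) (rule L2_set_nonneg)
    then show "(\<Sum>i\<in>F. (norm (coord (f + g) i))\<^sup>2) \<le> (norm f + norm g)\<^sup>2"
      unfolding L2_set_def by (simp add: real_sqrt_pow2 sum_nonneg)
  qed (auto intro!: add_nonneg_nonneg norm_ell2_ge0)
  show "norm (r *\<^sub>R f) = \<bar>r\<bar> * norm f"
    unfolding norm_ell2_def
    by (simp add: power_mult_distrib infsum_cmult_right' real_sqrt_mult)
qed (fact sgn_ell2_def dist_ell2_def uniformity_ell2_def open_ell2_def)+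

end

instantiation ell2 :: (type, chilbert_space) chilbert_space
begin

definition scaleC_ell2 :: "complex \<Rightarrow> ('a, 'b) ell2 \<Rightarrow> ('a, 'b) ell2"
  where "scaleC_ell2 c f = Abs_ell2 (\<lambda>i. c *\<^sub>C coord f i)"
definition cinner_ell2 :: "('a, 'b) ell2 \<Rightarrow> ('a, 'b) ell2 \<Rightarrow> complex"
  where "cinner_ell2 f g = (\<Sum>\<^sub>\<infinity>i. cinner (coord f i) (coord g i))"

lemma coord_scaleC [simp]: "coord (c *\<^sub>C f) i = c *\<^sub>C coord f i" for f :: "('a, 'b) ell2"
  unfolding scaleC_ell2_def
  by (subst Abs_ell2_inverse) (auto intro!: ell2_summable_scaleC coord_summable)

lemma Cauchy_ell2_convergent:
  fixes X :: "nat \<Rightarrow> ('a, 'b) ell2"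
  assumes X: "Cauchy X"
  shows "convergent X"
proof -
  have "Cauchy (\<lambda>n. coord (X n) i)" for i
  proof (rule CauchyI)
    fix e :: real assume "0 < e"
    then obtain M where M: "\<And>m n. m \<ge> M \<Longrightarrow> n \<ge> M \<Longrightarrow> norm (X m - X n) < e"
      using CauchyD[OF X] by blast
    have "norm (coord (X m) i - coord (X n) i) < e" if "m \<ge> M" "n \<ge> M" for m n
      using norm_coord_le[of "X m - X n" i] M[OF that] by simp
    then show "\<exists>M. \<forall>m\<ge>M. \<forall>n\<ge>M. norm (coord (X m) i - coord (X n) i) < e" by blast
  qed
  then have "(\<lambda>n. coord (X n) i) \<longlonglongrightarrow> lim (\<lambda>n. coord (X n) i)" for i
    by (simp add: Cauchy_convergent convergent_LIMSEQ_iff[symmetric])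
  then obtain L where L: "\<And>i. (\<lambda>n. coord (X n) i) \<longlonglongrightarrow> L i"
    by (rule that)
  have bound: "(\<Sum>i\<in>F. (norm (coord (X m) i - L i))\<^sup>2) \<le> e\<^sup>2"
    if M: "\<And>m n. m \<ge> M \<Longrightarrow> n \<ge> M \<Longrightarrow> norm (X m - X n) < e" and m: "m \<ge> M" and F: "finite F"
    for e M m F
  proof (rule LIMSEQ_le_const2)
    show "(\<lambda>n. \<Sum>i\<in>F. (norm (coord (X m) i - coord (X n) i))\<^sup>2)
        \<longlonglongrightarrow> (\<Sum>i\<in>F. (norm (coord (X m) i - L i))\<^sup>2)"
      by (intro tendsto_intros L)
    have "(\<Sum>i\<in>F. (norm (coord (X m) i - coord (X n) i))\<^sup>2) \<le> e\<^sup>2" if n: "n \<ge> M" for n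
    proof -
      have "(L2_set (\<lambda>i. norm (coord (X m - X n) i)) F)\<^sup>2 \<le> e\<^sup>2"
        using L2_set_coord_le[OF F, of "X m - X n"] M[OF m n]
        by (intro power_mono L2_set_nonneg) simp
      then show ?thesis
        unfolding L2_set_def by (simp add: real_sqrt_pow2 sum_nonneg)
    qed
    then show "\<exists>N. \<forall>n\<ge>N. (\<Sum>i\<in>F. (norm (coord (X m) i - coord (X n) i))\<^sup>2) \<le> e\<^sup>2" by blast
  qed
  obtain M1 where M1: "\<And>m n. m \<ge> M1 \<Longrightarrow> n \<ge> M1 \<Longrightarrow> norm (X m - X n) < 1"
    using CauchyD[OF X, of 1] by auto
  have "(\<lambda>i. (norm (coord (X M1) i - L i))\<^sup>2) summable_on UNIV"
    by (rule ell2_summableI, rule bound[where M = M1 and e = 1]) (auto intro: M1)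
  then have "(\<lambda>i. (norm (coord (X M1) i + (- 1) *\<^sub>C (coord (X M1) i - L i)))\<^sup>2) summable_on UNIV"
    by (intro ell2_summable_add ell2_summable_scaleC coord_summable)
  moreover have "coord (X M1) i + (- 1) *\<^sub>C (coord (X M1) i - L i) = L i" for i
    using scaleC_of_real[of "- 1" "coord (X M1) i - L i"] by simp
  ultimately have "(\<lambda>i. (norm (L i))\<^sup>2) summable_on UNIV" by simp
  then have coordL: "coord (Abs_ell2 L) = L" by (simp add: Abs_ell2_inverse)
  have "X \<longlonglongrightarrow> Abs_ell2 L"
  proof (rule LIMSEQ_I)
    fix r :: real assume r: "0 < r"
    then obtain M where M: "\<And>m n. m \<ge> M \<Longrightarrow> n \<ge> M \<Longrightarrow> norm (X m - X n) < r / 2"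
      using CauchyD[OF X, of "r / 2"] by auto
    have "norm (X m - Abs_ell2 L) < r" if m: "m \<ge> M" for m
    proof -
      have "norm (X m - Abs_ell2 L) \<le> r / 2"
      proof (rule norm_ell2_le)
        fix F :: "'a set" assume F: "finite F"
        show "(\<Sum>i\<in>F. (norm (coord (X m - Abs_ell2 L) i))\<^sup>2) \<le> (r / 2)\<^sup>2"
          unfolding coord_diff coordL by (rule bound[where M = M]) (fact M m F)+
      qed (use r in simp)
      then show ?thesis using r by simp
    qed
    then show "\<exists>no. \<forall>n\<ge>no. norm (X n - Abs_ell2 L) < r" by blast
  qed
  then show ?thesis by (rule convergentI)
qed

instance
proof
  fix f g h :: "('a, 'b) ell2" and c d :: complex and r :: real
  show "c *\<^sub>C (f + g) = c *\<^sub>C f + c *\<^sub>C g"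
    by (simp add: coord_inject[symmetric] fun_eq_iff scaleC_add_right)
  show "(c + d) *\<^sub>C f = c *\<^sub>C f + d *\<^sub>C f"
    by (simp add: coord_inject[symmetric] fun_eq_iff scaleC_add_left)
  show "c *\<^sub>C d *\<^sub>C f = (c * d) *\<^sub>C f"
    by (simp add: coord_inject[symmetric] fun_eq_iff scaleC_scaleC)
  show "complex_of_real r *\<^sub>C f = r *\<^sub>R f"
    by (simp add: coord_inject[symmetric] fun_eq_iff scaleC_of_real)
  show "cinner f g = cnj (cinner g f)"
    unfolding cinner_ell2_def infsum_cnj[symmetric] by (rule infsum_cong) (rule cinner_commute)
  show "cinner (f + g) h = cinner f h + cinner g h"
    unfolding cinner_ell2_def
    by (simp add: cinner_add_left infsum_add ell2_summable_cinner coord_summable)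
  show "cinner (c *\<^sub>C f) g = c * cinner f g"
    unfolding cinner_ell2_def by (simp add: cinner_scaleC_left infsum_cmult_right')
  have "((\<lambda>i. (norm (coord f i))\<^sup>2) has_sum (norm f)\<^sup>2) UNIV"
    unfolding norm_ell2_square by (rule has_sum_infsum) (rule coord_summable)
  then have "((\<lambda>i. complex_of_real ((norm (coord f i))\<^sup>2)) has_sum of_real ((norm f)\<^sup>2)) UNIV"
    by (rule has_sum_bounded_linear[OF bounded_linear_of_real])
  then show "cinner f f = complex_of_real ((norm f)\<^sup>2)"
    unfolding cinner_ell2_def cinner_self by (rule infsumI)
qed (rule Cauchy_ell2_convergent)

end


section \<open>Full Fock spaces and their tensor products\<close>

text \<open>A word \<open>g\<^bsub>j1\<^esub> \<dots> g\<^bsub>jp\<^esub>\<close> of the free semigroup on \<open>n\<close> generators is the list \<open>[j1, \<dots>, jp]\<close>.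
  The full Fock space on \<open>n\<close> generators is the closed subspace of \<^typ>\<open>(nat list, complex) ell2\<close>
  with orthonormal basis \<open>e_word \<alpha>\<close>, \<open>\<alpha> \<in> words n\<close>; all Fock spaces (and, below, all tensor products)
  thus live in one ambient Hilbert space, and operators on them are extended by zero, which
  affects neither adjoints nor traces.\<close>

definition words :: "nat \<Rightarrow> nat list set"
  where "words n = {\<alpha>. set \<alpha> \<subseteq> {1..n}}"

definition e_word :: "nat list \<Rightarrow> (nat list, complex) ell2"
  where "e_word \<alpha> = Abs_ell2 (\<lambda>\<beta>. if \<beta> = \<alpha> then 1 else 0)"

definition fock :: "nat \<Rightarrow> (nat list, complex) ell2 set"
  where "fock n = closure (cvec.span (e_word ` words n))"

definition fock_proj :: "nat \<Rightarrow> nat \<Rightarrow> (nat list, complex) ell2 \<Rightarrow>\<^sub>L (nat list, complex) ell2"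
  where "fock_proj n q = proj_onto (cvec.span (e_word ` {\<alpha> \<in> words n. length \<alpha> = q}))"

text \<open>The Hilbert space tensor product of \<open>k\<close> copies of \<open>\<ell>\<^sup>2(words)\<close> with a Hilbert space \<open>H\<close> is realized
  as the square-summable \<open>H\<close>-valued families indexed by \<open>k\<close>-tuples of words (extensional functions on
  \<open>{1..k}\<close>); the elementary tensor \<open>x\<^sub>1 \<otimes> \<dots> \<otimes> x\<^sub>k \<otimes> v\<close> is the family of products of coordinates.\<close>

definition elem_tensor ::
    "nat \<Rightarrow> (nat \<Rightarrow> (nat list, complex) ell2) \<Rightarrow> 'a::chilbert_space \<Rightarrow> (nat \<Rightarrow> nat list, 'a) ell2"
  where "elem_tensor k x v =
    Abs_ell2 (\<lambda>\<beta>. if \<beta> \<in> extensional {1..k} then (\<Prod>i=1..k. coord (x i) (\<beta> i)) *\<^sub>C v else 0)"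

text \<open>\<open>F\<^sup>2(H\<^bsub>n 1\<^esub>) \<otimes> \<dots> \<otimes> F\<^sup>2(H\<^bsub>n k\<^esub>) \<otimes> D\<close> for a closed subspace \<open>D\<close>\<close>

definition tensor_space :: "nat \<Rightarrow> (nat \<Rightarrow> nat) \<Rightarrow> 'a::chilbert_space set \<Rightarrow> (nat \<Rightarrow> nat list, 'a) ell2 set"
  where "tensor_space k n D =
    closure (cvec.span {elem_tensor k x v | x v. (\<forall>i\<in>{1..k}. x i \<in> fock (n i)) \<and> v \<in> D})"

text \<open>\<open>A\<^sub>1 \<otimes> \<dots> \<otimes> A\<^sub>k \<otimes> B\<close> on this space, extended by zero to the orthogonal complement\<close>

definition tensor_op ::
    "nat \<Rightarrow> (nat \<Rightarrow> nat) \<Rightarrow> 'a::chilbert_space set \<Rightarrow>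
     (nat \<Rightarrow> (nat list, complex) ell2 \<Rightarrow>\<^sub>L (nat list, complex) ell2) \<Rightarrow> ('a \<Rightarrow>\<^sub>L 'a) \<Rightarrow>
     ((nat \<Rightarrow> nat list, 'a) ell2 \<Rightarrow>\<^sub>L (nat \<Rightarrow> nat list, 'a) ell2)"
  where "tensor_op k n D A B = (THE C. clinear_op C \<and>
    (\<forall>x v. (\<forall>i\<in>{1..k}. x i \<in> fock (n i)) \<and> v \<in> D \<longrightarrow>
       C (elem_tensor k x v) = elem_tensor k (\<lambda>i. A i (x i)) (B v)) \<and>
    (\<forall>y. (\<forall>z\<in>tensor_space k n D. cinner y z = 0) \<longrightarrow> C y = 0))"


section \<open>Regular polyballs\<close>

text \<open>A tuple \<open>X = (X\<^sub>1, \<dots>, X\<^sub>k)\<close> with \<open>X\<^sub>i = (X\<^bsub>i,1\<^esub>, \<dots>, X\<^bsub>i,n i\<^esub>)\<close> is a function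
  \<^typ>\<open>nat \<Rightarrow> nat \<Rightarrow> 'a \<Rightarrow>\<^sub>L 'a::chilbert_space\<close>, of which only the values at \<open>i \<in> {1..k}\<close>, \<open>j \<in> {1..n i}\<close> matter.\<close>

definition Phi :: "nat \<Rightarrow> (nat \<Rightarrow> 'a::chilbert_space \<Rightarrow>\<^sub>L 'a) \<Rightarrow> ('a \<Rightarrow>\<^sub>L 'a) \<Rightarrow> ('a \<Rightarrow>\<^sub>L 'a)"
  where "Phi m X Y = (\<Sum>j=1..m. X j o\<^sub>L Y o\<^sub>L adj (X j))"

text \<open>\<open>(id - \<Phi>\<^bsub>X\<^sub>1\<^esub>)\<^bsup>p 1\<^esup> \<circ> \<dots> \<circ> (id - \<Phi>\<^bsub>X\<^sub>k\<^esub>)\<^bsup>p k\<^esup>\<close>\<close>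

definition defect_map ::
    "nat \<Rightarrow> (nat \<Rightarrow> nat) \<Rightarrow> (nat \<Rightarrow> nat) \<Rightarrow> (nat \<Rightarrow> nat \<Rightarrow> 'a::chilbert_space \<Rightarrow>\<^sub>L 'a) \<Rightarrow>
     ('a \<Rightarrow>\<^sub>L 'a) \<Rightarrow> ('a \<Rightarrow>\<^sub>L 'a)"
  where "defect_map k n p X =
    foldr (\<lambda>i F. ((\<lambda>Y. Y - Phi (n i) (X i) Y) ^^ p i) \<circ> F) [1..<Suc k] id"

definition polyball :: "nat \<Rightarrow> (nat \<Rightarrow> nat) \<Rightarrow> (nat \<Rightarrow> nat \<Rightarrow> 'a::chilbert_space \<Rightarrow>\<^sub>L 'a) set"
  where "polyball k n = {X.
    (\<forall>i\<in>{1..k}. \<forall>j\<in>{1..n i}. clinear_op (X i j)) \<and>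
    (\<forall>s\<in>{1..k}. \<forall>t\<in>{1..k}. s \<noteq> t \<longrightarrow>
       (\<forall>i\<in>{1..n s}. \<forall>j\<in>{1..n t}. X s i o\<^sub>L X t j = X t j o\<^sub>L X s i)) \<and>
    (\<forall>p. (\<forall>i\<in>{1..k}. p i \<in> {0, 1}) \<longrightarrow> positive_op (defect_map k n p X id_blinfun))}"

definition defect_op ::
    "nat \<Rightarrow> (nat \<Rightarrow> nat) \<Rightarrow> (nat \<Rightarrow> nat \<Rightarrow> 'a::chilbert_space \<Rightarrow>\<^sub>L 'a) \<Rightarrow> ('a \<Rightarrow>\<^sub>L 'a)"
  where "defect_op k n T = defect_map k n (\<lambda>_. 1) T id_blinfun"

definition trace_class_defect ::
    "nat \<Rightarrow> (nat \<Rightarrow> nat) \<Rightarrow> (nat \<Rightarrow> nat \<Rightarrow> 'a::chilbert_space \<Rightarrow>\<^sub>L 'a) \<Rightarrow> bool"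
  where "trace_class_defect k n T \<longleftrightarrow> trace_class (defect_op k n T)"

definition defect_space ::
    "nat \<Rightarrow> (nat \<Rightarrow> nat) \<Rightarrow> (nat \<Rightarrow> nat \<Rightarrow> 'a::chilbert_space \<Rightarrow>\<^sub>L 'a) \<Rightarrow> 'a set"
  where "defect_space k n T = closure (range (defect_op k n T))"


section \<open>Berezin kernel and curvature\<close>

definition word_op :: "(nat \<Rightarrow> 'a::chilbert_space \<Rightarrow>\<^sub>L 'a) \<Rightarrow> nat list \<Rightarrow> ('a \<Rightarrow>\<^sub>L 'a)"
  where "word_op X \<alpha> = foldr (\<lambda>j B. X j o\<^sub>L B) \<alpha> id_blinfun"

text \<open>\<open>T\<^bsub>1,\<beta> 1\<^esub>\<^sup>* \<dots> T\<^bsub>k,\<beta> k\<^esub>\<^sup>*\<close>\<close>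

definition word_op_adj ::
    "nat \<Rightarrow> (nat \<Rightarrow> nat \<Rightarrow> 'a::chilbert_space \<Rightarrow>\<^sub>L 'a) \<Rightarrow> (nat \<Rightarrow> nat list) \<Rightarrow> ('a \<Rightarrow>\<^sub>L 'a)"
  where "word_op_adj k T \<beta> = foldr (\<lambda>i B. adj (word_op (T i) (\<beta> i)) o\<^sub>L B) [1..<Suc k] id_blinfun"

definition berezin_kernel ::
    "nat \<Rightarrow> (nat \<Rightarrow> nat) \<Rightarrow> (nat \<Rightarrow> nat \<Rightarrow> 'a::chilbert_space \<Rightarrow>\<^sub>L 'a) \<Rightarrow>
     ('a \<Rightarrow>\<^sub>L (nat \<Rightarrow> nat list, 'a) ell2)"
  where "berezin_kernel k n T = Blinfun (\<lambda>h. \<Sum>\<^sub>\<infinity>\<beta>\<in>(\<Pi>\<^sub>E i\<in>{1..k}. words (n i)).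
    elem_tensor k (\<lambda>i. e_word (\<beta> i)) (sqrt_op (defect_op k n T) (word_op_adj k T \<beta> h)))"

text \<open>In the denominator of \<open>curv_mean\<close>, the tensor product of the Fock spaces alone is the case
  \<open>D = \<complex>\<close> of the above.\<close>

definition curv_mean ::
    "nat \<Rightarrow> (nat \<Rightarrow> nat) \<Rightarrow> (nat \<Rightarrow> nat \<Rightarrow> 'a::chilbert_space \<Rightarrow>\<^sub>L 'a) \<Rightarrow> nat \<Rightarrow> complex"
  where "curv_mean k n T m = 1 / of_nat ((m + k) choose k) *
    (\<Sum>q\<in>{q \<in> {1..k} \<rightarrow>\<^sub>E UNIV. (\<Sum>i=1..k. q i) \<le> m}.
       op_trace (adj (berezin_kernel k n T)
              o\<^sub>L tensor_op k n (defect_space k n T) (\<lambda>i. fock_proj (n i) (q i)) id_blinfun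
              o\<^sub>L berezin_kernel k n T)
       / op_trace (tensor_op k n (UNIV :: complex set) (\<lambda>i. fock_proj (n i) (q i)) id_blinfun))"

text \<open>The limit exists for every element of the polyball with trace class defect.\<close>

definition curv :: "nat \<Rightarrow> (nat \<Rightarrow> nat) \<Rightarrow> (nat \<Rightarrow> nat \<Rightarrow> 'a::chilbert_space \<Rightarrow>\<^sub>L 'a) \<Rightarrow> complex"
  where "curv k n T = lim (curv_mean k n T)"

end

theory Submission
  imports Defs
begin

text \<open>Write \<open>D\<close> for the defect and \<open>a(q)\<close> for the quotient of traces in the definition of the curvature.
  In terms of the words, \<open>a(q)\<close> is the sum of the squared Hilbert-Schmidt norms of
  \<open>D\<^sup>1\<^sup>/\<^sup>2 T\<^bsub>1,\<beta> 1\<^esub>\<^sup>* \<dots> T\<^bsub>k,\<beta> k\<^esub>\<^sup>*\<close> over all \<open>\<beta>\<close> with \<open>|\<beta> i| = q i\<close>, divided by the number of such \<open>\<beta>\<close>.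
  Since all \<open>T\<^bsub>i,j\<^esub>\<close> are contractions and entries of different tuples commute, lengthening \<open>\<beta> i\<close> by
  one letter does not increase the Hilbert-Schmidt norm; hence \<open>a\<close> is decreasing in each coordinate,
  with \<open>a(0) = trace D\<close>. The averages of such a function over growing simplices converge to its
  infimum, because the translate \<open>q \<ge> q\<^sub>0\<close> of a simplex asymptotically exhausts it. The last
  inequality holds because \<open>0 \<le> D \<le> I\<close>.\<close>

text \<open>The decrease of the quotient rests on a count: every admissible tuple has exactly
  \<open>n i\<close> extensions by one letter in position \<open>i\<close>, and the denominator
  grows by the same factor \<open>n i\<close>. The letter is put at the front of the word, so that
  its adjoint appears at the right end of block \<open>i\<close>; commuting it past the later blocks
  makes it the rightmost factor of the whole product. Right composition with a contraction allows no
  comparison basis vector by basis vector, and this is why Hilbert-Schmidt sums are compared with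
  those of the adjoint. The bound D <= I comes from adding the factors of the defect one at a time:
  each subtracts the image under \<open>Phi\<close> of an operator already known to be positive.
  Most objects in the statement are definite descriptions (\<open>adj\<close>,
  \<open>sqrt_op\<close>, \<open>proj_onto\<close>, \<open>tensor_op\<close>), choices
  (\<open>op_trace\<close>), a \<open>Blinfun\<close> of a series or a \<open>lim\<close>. They can
  be computed with only once existence, uniqueness or convergence has been established, which
  accounts for the Hilbert space theory developed along the way.\<close>

subsection \<open>Inner products\<close>

lemma bounded_bilinear_cinner:
  "bounded_bilinear (cinner :: 'a::chilbert_space \<Rightarrow> 'a \<Rightarrow> complex)"
proof
  show "\<exists>K. \<forall>a b::'a. norm (cinner a b) \<le> norm a * norm b * K"
    using cmod_cinner_le by (intro exI[of _ 1]) auto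
  show "cinner (r *\<^sub>R x) y = r *\<^sub>R cinner x y" for r and x y :: 'a
    unfolding scaleC_of_real[symmetric, of r x] by (simp add: cinner_scaleC_left scaleR_conv_of_real)
  show "cinner x (r *\<^sub>R y) = r *\<^sub>R cinner x y" for r and x y :: 'a
    unfolding scaleC_of_real[symmetric, of r y] by (simp add: cinner_scaleC_right scaleR_conv_of_real)
qed (simp_all add: cinner_add_left cinner_add_right)

interpretation cinner: bounded_bilinear "cinner :: 'a::chilbert_space \<Rightarrow> 'a \<Rightarrow> complex"
  by (rule bounded_bilinear_cinner)

lemma norm_sq_eq_cinner: "(norm x)\<^sup>2 = Re (cinner x x)"
  by (simp add: cinner_self)

lemma Re_cinner_commute: "Re (cinner x y) = Re (cinner y x)"
  by (subst cinner_commute) simp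

lemma Re_cinner_le: "Re (cinner x y) \<le> norm x * norm y"
  using complex_Re_le_cmod cmod_cinner_le by (rule order_trans)

lemma norm_add_sq: "(norm (x + y))\<^sup>2 = (norm x)\<^sup>2 + (norm y)\<^sup>2 + 2 * Re (cinner x y)"
  using Re_cinner_commute[of x y]
  by (simp add: norm_sq_eq_cinner cinner_add_left cinner_add_right)

lemma norm_diff_sq: "(norm (x - y))\<^sup>2 = (norm x)\<^sup>2 + (norm y)\<^sup>2 - 2 * Re (cinner x y)"
  using Re_cinner_commute[of x y]
  by (simp add: norm_sq_eq_cinner cinner.diff_left cinner.diff_right)

lemma cinner_right_ext: "(\<And>x. cinner x y = cinner x z) \<Longrightarrow> y = z"
  using cinner_self[of "y - z"] by (auto simp: cinner.diff_right)

lemma subspace_scaleR: "cvec.subspace M \<Longrightarrow> x \<in> M \<Longrightarrow> r *\<^sub>R x \<in> M"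
  by (metis scaleC_of_real cvec.subspace_scale)

text \<open>A minimizing sequence for the distance from \<open>x\<close> to \<open>M\<close> is
  Cauchy by the parallelogram law, and completeness gives a nearest point. Orthogonality follows
  since no displacement inside \<open>M\<close> brings it closer to \<open>x\<close>.\<close>

theorem orthogonal_projection_exists:
  fixes x :: "'a::chilbert_space"
  assumes M: "cvec.subspace M" and cl: "closed M"
  obtains p where "p \<in> M" "\<And>y. y \<in> M \<Longrightarrow> cinner (x - p) y = 0"
proof -
  define \<delta> where "\<delta> = (INF y\<in>M. (norm (x - y))\<^sup>2)"
  have bdd: "bdd_below ((\<lambda>y. (norm (x - y))\<^sup>2) ` M)"
    by (rule bdd_belowI[of _ 0]) auto
  have ne: "M \<noteq> {}" using cvec.subspace_0[OF M] by auto
  have \<delta>: "\<delta> \<le> (norm (x - y))\<^sup>2" if "y \<in> M" for y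
    unfolding \<delta>_def using bdd that by (rule cINF_lower)
  have "\<exists>y\<in>M. (norm (x - y))\<^sup>2 < \<delta> + 1 / Suc n" for n
    using cINF_less_iff[OF ne bdd, of "\<delta> + 1 / Suc n"] unfolding \<delta>_def by simp
  then obtain y where y: "\<And>n. y n \<in> M" "\<And>n. (norm (x - y n))\<^sup>2 < \<delta> + 1 / Suc n"
    by metis
  \<comment> \<open>The midpoint of \<open>y m\<close> and \<open>y n\<close> lies in
    \<open>M\<close>, so its squared distance to \<open>x\<close> is at least the infimum; in the
    parallelogram identity only the two errors 1 / Suc m and 1 / Suc n survive, each
    doubled.\<close>
  have close: "(norm (y m - y n))\<^sup>2 \<le> 2 / Suc m + 2 / Suc n" for m n
  proof -
    let ?z = "(1 / 2) *\<^sub>R (y m + y n)"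
    have "?z \<in> M" using y(1) by (intro subspace_scaleR M cvec.subspace_add)
    then have "\<delta> \<le> (norm (x - ?z))\<^sup>2" by (rule \<delta>)
    moreover have "(norm ((x - y m) + (x - y n)))\<^sup>2 = 4 * (norm (x - ?z))\<^sup>2"
    proof -
      have "(x - y m) + (x - y n) = 2 *\<^sub>R (x - ?z)"
        by (simp add: algebra_simps scaleR_2)
      then show ?thesis by (simp add: power_mult_distrib)
    qed
    moreover have "(norm ((x - y m) + (x - y n)))\<^sup>2 + (norm (y m - y n))\<^sup>2
        = 2 * (norm (x - y m))\<^sup>2 + 2 * (norm (x - y n))\<^sup>2"
      using norm_add_sq[of "x - y m" "x - y n"] norm_diff_sq[of "x - y n" "x - y m"]
      Re_cinner_commute[of "x - y m" "x - y n"]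
      by simp
    ultimately show ?thesis using y(2)[of m] y(2)[of n] by simp
  qed
  have "Cauchy y"
  proof (rule CauchyI)
    fix e :: real assume e: "0 < e"
    then obtain N where N: "1 / Suc N < e\<^sup>2 / 4"
      using reals_Archimedean[of "e\<^sup>2 / 4"] by (auto simp: inverse_eq_divide)
    have "norm (y m - y n) < e" if "m \<ge> N" "n \<ge> N" for m n
    proof -
      have "1 / Suc m \<le> 1 / Suc N" "1 / Suc n \<le> 1 / Suc N"
        using that by (auto intro!: divide_left_mono)
      then have "(norm (y m - y n))\<^sup>2 < e\<^sup>2" using close[of m n] N by simp
      then show ?thesis by (rule power2_less_imp_less) (use e in simp)
    qed
    then show "\<exists>M. \<forall>m\<ge>M. \<forall>n\<ge>M. norm (y m - y n) < e" by blast
  qed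
  then obtain p where p: "y \<longlonglongrightarrow> p" using Cauchy_convergent convergentD by blast
  have pM: "p \<in> M" by (rule closed_sequentially[OF cl y(1) p])
  have "(\<lambda>n. \<delta> + 1 / Suc n) \<longlonglongrightarrow> \<delta> + 0"
    by (intro tendsto_intros LIMSEQ_Suc[OF lim_1_over_n])
  moreover have "(\<lambda>n. (norm (x - y n))\<^sup>2) \<longlonglongrightarrow> (norm (x - p))\<^sup>2"
    by (intro tendsto_intros p)
  ultimately have p\<delta>: "(norm (x - p))\<^sup>2 \<le> \<delta>"
    using LIMSEQ_le[of "\<lambda>n. (norm (x - y n))\<^sup>2" _ "\<lambda>n. \<delta> + 1 / Suc n" "\<delta> + 0"]
      less_imp_le[OF y(2)] by auto
  have "cinner (x - p) z = 0" if z: "z \<in> M" for z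
  proof -
    define c where "c = cinner (x - p) z"
    \<comment> \<open>Displacing \<open>p\<close> by t c z changes the squared distance by |c|^2
      (t^2 |z|^2 - 2 t). With t |z|^2 <= 1 this is at most -t |c|^2, which contradicts minimality
      unless c = 0. The summand 1 keeps \<open>t\<close> defined when z = 0.\<close>
    define t where "t = 1 / ((norm z)\<^sup>2 + 1)"
    have "0 < (norm z)\<^sup>2 + 1" by (simp add: add_nonneg_pos)
    then have t: "0 < t" "t * (norm z)\<^sup>2 \<le> 1" by (auto simp: t_def divide_simps)
    let ?w = "(of_real t * c) *\<^sub>C z"
    have "p + ?w \<in> M" by (intro cvec.subspace_add cvec.subspace_scale M pM z)
    then have "(norm (x - p))\<^sup>2 \<le> (norm (x - p - ?w))\<^sup>2"
      using \<delta>[of "p + ?w"] p\<delta> unfolding diff_diff_eq by linarith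
    also have "\<dots> = (norm (x - p))\<^sup>2 + t\<^sup>2 * (cmod c)\<^sup>2 * (norm z)\<^sup>2 - 2 * t * (cmod c)\<^sup>2"
    proof -
      have "cinner (x - p) ?w = of_real t * (c * cnj c)"
        by (simp add: cinner_scaleC_right c_def[symmetric])
      then have "cinner (x - p) ?w = of_real (t * (cmod c)\<^sup>2)"
        by (simp add: complex_norm_square[symmetric])
      then have "Re (cinner (x - p) ?w) = t * (cmod c)\<^sup>2" by simp
      then show ?thesis
        using t by (simp add: norm_diff_sq[of "x - p" ?w] norm_scaleC norm_mult power_mult_distrib)
    qed
    finally have "t * (cmod c)\<^sup>2 * 2 \<le> t * (cmod c)\<^sup>2 * (t * (norm z)\<^sup>2)"
      by (simp add: power2_eq_square algebra_simps)
    also have "\<dots> \<le> t * (cmod c)\<^sup>2 * 1" using t by (intro mult_left_mono) auto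
    finally have "(cmod c)\<^sup>2 \<le> 0" using t by (simp add: mult_le_0_iff)
    then show ?thesis by (simp add: c_def)
  qed
  then show ?thesis using that pM by blast
qed

text \<open>The kernel of \<open>f\<close> is a closed subspace. The component \<open>z\<close>
  orthogonal to it of any vector outside the kernel determines \<open>f\<close> up to a
  scalar.\<close>

theorem riesz_representation:
  fixes f :: "'a::chilbert_space \<Rightarrow> complex"
  assumes f: "bounded_linear f" and fc: "\<And>c x. f (c *\<^sub>C x) = c * f x"
  obtains y where "\<And>x. f x = cinner x y"
proof (cases "\<forall>x. f x = 0")
  case True
  then show ?thesis using that[of 0] by (simp add: cinner.zero_right)
next
  case False
  then obtain x where x: "f x \<noteq> 0" by blast
  interpret f: bounded_linear f by fact
  let ?M = "{x. f x = 0}"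
  have "cvec.subspace ?M" by (rule cvec.subspaceI) (auto simp: f.zero f.add fc)
  moreover have "closed ?M"
    by (intro closed_Collect_eq continuous_intros f.continuous_on)
  ultimately obtain p where p: "p \<in> ?M" "\<And>y. y \<in> ?M \<Longrightarrow> cinner (x - p) y = 0"
    using orthogonal_projection_exists by metis
  define z where "z = x - p"
  have fz: "f z \<noteq> 0" using x p by (simp add: z_def f.diff)
  then have zz: "cinner z z \<noteq> 0" using f.zero by (auto simp: cinner_self)
  \<comment> \<open>Subtracting (f u / f z) z moves \<open>u\<close> into the kernel, hence makes it
    orthogonal to \<open>z\<close>. This fixes the scalar, which is conjugated because
    \<open>cinner\<close> is antilinear in its second argument.\<close>
  show ?thesis
  proof (rule that[of "(cnj (f z / cinner z z)) *\<^sub>C z"])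
    fix u
    have "f (u - (f u / f z) *\<^sub>C z) = 0" using fz by (simp add: f.diff fc)
    then have "cinner z (u - (f u / f z) *\<^sub>C z) = 0" using p(2) by (simp add: z_def)
    then have "cinner (u - (f u / f z) *\<^sub>C z) z = 0"
      by (subst cinner_commute) simp
    then have "cinner u z = f u / f z * cinner z z"
      by (simp add: cinner.diff_left cinner_scaleC_left)
    then show "f u = cinner u (cnj (f z / cinner z z) *\<^sub>C z)"
      using fz zz by (simp add: cinner_scaleC_right)
  qed
qed

subsection \<open>Adjoints\<close>

lemma clinear_opD: "clinear_op A \<Longrightarrow> blinfun_apply A (c *\<^sub>C x) = c *\<^sub>C blinfun_apply A x"
  by (simp add: clinear_op_def)

text \<open>Discharges the definite description in \<open>adj\<close>: two operators satisfying the
  adjoint identity agree because inner products separate points.\<close>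

lemma adj_eqI:
  assumes "\<And>x y. cinner (blinfun_apply A x) y = cinner x (blinfun_apply B y)"
  shows "adj A = B"
  unfolding adj_def
proof (rule the_equality)
  fix B' assume B': "\<forall>x y. cinner (A x) y = cinner x (blinfun_apply B' y)"
  show "B' = B"
  proof (rule blinfun_eqI, rule cinner_right_ext)
    show "cinner x (B' y) = cinner x (B y)" for x y
      using assms[of x y] B' by simp
  qed
qed (use assms in blast)

text \<open>The Riesz theorem is applied for each \<open>y\<close> to the functional sending x to
  cinner (A x) y. Cancelling one factor |g y| in |g y|^2 = Re (cinner (A (g y)) y) gives
  boundedness.\<close>

lemma adj_exists:
  fixes A :: "'a::chilbert_space \<Rightarrow>\<^sub>L 'b::chilbert_space"
  assumes A: "clinear_op A"
  obtains B where "\<And>x y. cinner (blinfun_apply A x) y = cinner x (blinfun_apply B y)"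
proof -
  have "\<exists>z. \<forall>x. cinner (A x) y = cinner x z" for y
  proof -
    have "bounded_linear (\<lambda>x. cinner (A x) y)"
      by (intro bounded_linear_compose[OF cinner.bounded_linear_left] blinfun.bounded_linear_right)
    then show ?thesis
      using riesz_representation[of "\<lambda>x. cinner (A x) y"] clinear_opD[OF A]
      by (metis cinner_scaleC_left)
  qed
  then obtain g where g: "\<And>x y. cinner (A x) y = cinner x (g y)" by metis
  have "bounded_linear g"
  proof (rule bounded_linear_intro)
    show "g (x + y) = g x + g y" for x y
      by (rule cinner_right_ext) (simp add: g[symmetric] cinner_add_right)
    show "g (r *\<^sub>R x) = r *\<^sub>R g x" for r x
      by (rule cinner_right_ext) (simp add: g[symmetric] cinner.scaleR_right)
    fix y
    have "(norm (g y))\<^sup>2 = Re (cinner (A (g y)) y)" by (simp add: norm_sq_eq_cinner g)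
    also have "\<dots> \<le> norm (A (g y)) * norm y"
      by (rule Re_cinner_le)
    also have "\<dots> \<le> norm A * norm (g y) * norm y"
      by (intro mult_right_mono norm_blinfun) auto
    finally have "norm (g y) * norm (g y) \<le> norm (g y) * (norm y * norm A)"
      by (simp add: power2_eq_square algebra_simps)
    then show "norm (g y) \<le> norm y * norm A"
      by (cases "g y = 0") auto
  qed
  then show ?thesis using that[of "Blinfun g"] g by (simp add: bounded_linear_Blinfun_apply)
qed

lemma cinner_adj_right:
  assumes "clinear_op A"
  shows "cinner x (blinfun_apply (adj A) y) = cinner (blinfun_apply A x) y"
proof -
  obtain B where B: "\<And>x y. cinner (blinfun_apply A x) y = cinner x (blinfun_apply B y)"
    using adj_exists[OF assms] by blast
  then have "adj A = B" by (rule adj_eqI)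
  then show ?thesis using B by simp
qed

lemma cinner_adj_left:
  "clinear_op A \<Longrightarrow> cinner (blinfun_apply (adj A) y) x = cinner y (blinfun_apply A x)"
  by (subst (1 2) cinner_commute) (simp add: cinner_adj_right)

lemma clinear_adj [intro]:
  assumes "clinear_op A"
  shows "clinear_op (adj A)"
  unfolding clinear_op_def[of "adj A"]
proof (intro allI)
  fix c y
  show "adj A (c *\<^sub>C y) = c *\<^sub>C adj A y"
    by (rule cinner_right_ext) (simp add: assms cinner_adj_right cinner_scaleC_right)
qed

lemma adj_adj: "clinear_op A \<Longrightarrow> adj (adj A) = A"
  by (rule adj_eqI) (rule cinner_adj_left)

lemma clinear_compose [intro]: "clinear_op A \<Longrightarrow> clinear_op B \<Longrightarrow> clinear_op (A o\<^sub>L B)"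
  by (simp add: clinear_op_def)

lemma clinear_id [intro]: "clinear_op id_blinfun"
  by (simp add: clinear_op_def)

lemma adj_compose:
  assumes "clinear_op A" "clinear_op B"
  shows "adj (A o\<^sub>L B) = adj B o\<^sub>L adj A"
  using assms by (intro adj_eqI) (simp add: cinner_adj_right)

lemma adj_id: "adj id_blinfun = id_blinfun"
  by (rule adj_eqI) simp

lemma norm_adj_le:
  assumes "clinear_op A"
  shows "norm (adj A) \<le> norm A"
proof (rule norm_blinfun_bound)
  fix y
  have "(norm (adj A y))\<^sup>2 = Re (cinner (A (adj A y)) y)"
    using assms by (simp add: norm_sq_eq_cinner cinner_adj_right)
  also have "\<dots> \<le> norm (A (adj A y)) * norm y"
    by (rule Re_cinner_le)
  also have "\<dots> \<le> norm A * norm (adj A y) * norm y"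
    by (intro mult_right_mono norm_blinfun) auto
  finally have "norm (adj A y) * norm (adj A y) \<le> norm (adj A y) * (norm A * norm y)"
    by (simp add: power2_eq_square algebra_simps)
  then show "norm (adj A y) \<le> norm A * norm y"
    by (cases "adj A y = 0") auto
qed simp

subsection \<open>Positive operators and their square roots\<close>

lemma positive_clinear: "positive_op A \<Longrightarrow> clinear_op A"
  by (simp add: positive_op_def)

lemma positive_Re: "positive_op A \<Longrightarrow> 0 \<le> Re (cinner (blinfun_apply A x) x)"
  by (auto simp: positive_op_def less_eq_complex_def)

lemma positive_Im: "positive_op A \<Longrightarrow> Im (cinner (blinfun_apply A x) x) = 0"
  by (auto simp: positive_op_def less_eq_complex_def)

text \<open>Polarization: reality of the quadratic form at x + y settles the imaginary part of the
  symmetry, and reality at x + i y the real part.\<close>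

lemma positive_selfadjoint:
  assumes A: "positive_op A"
  shows "cinner (blinfun_apply A x) y = cinner x (blinfun_apply A y)"
proof -
  have "Im (cinner (A x) y + cinner (A y) x) = 0"
    using positive_Im[OF A, of "x + y"] positive_Im[OF A, of x] positive_Im[OF A, of y]
    by (simp add: blinfun.add_right cinner_add_left cinner_add_right)
  moreover have "Re (cinner (A x) y - cinner (A y) x) = 0"
    using positive_Im[OF A, of "x + \<i> *\<^sub>C y"] positive_Im[OF A, of x] positive_Im[OF A, of y]
    by (simp add: blinfun.add_right clinear_opD[OF positive_clinear[OF A]]
        cinner_add_left cinner_add_right cinner_scaleC_left cinner_scaleC_right)
  ultimately have "cinner (A x) y = cnj (cinner (A y) x)"
    by (simp add: complex_eq_iff)
  then show ?thesis using cinner_commute[of x "A y"] by simp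
qed

lemma adj_positive: "positive_op A \<Longrightarrow> adj A = A"
  by (rule adj_eqI) (rule positive_selfadjoint)

lemma positiveI:
  assumes "clinear_op A" "\<And>x y. cinner (blinfun_apply A x) y = cinner x (blinfun_apply A y)"
    "\<And>x. 0 \<le> Re (cinner (blinfun_apply A x) x)"
  shows "positive_op A"
proof -
  have "Im (cinner (A x) x) = 0" for x
    using assms(2)[of x x] cinner_commute[of x "A x"] by (simp add: complex_eq_iff)
  then show ?thesis using assms by (simp add: positive_op_def less_eq_complex_def)
qed

text \<open>The positive form is evaluated at x - t A x with t = 1 / |A|. This avoids square roots
  of operators, whose construction relies on this estimate.\<close>

lemma positive_norm_sq_le:
  assumes A: "positive_op A"
  shows "(norm (blinfun_apply A x))\<^sup>2 \<le> norm A * Re (cinner (A x) x)"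
proof (cases "norm A = 0")
  case False
  then have nA: "0 < norm A" by simp
  define s where "s = (norm (A x))\<^sup>2"
  let ?t = "1 / norm A"
  have "Re (cinner (A (A x)) (A x)) \<le> norm (A (A x)) * norm (A x)"
    by (rule Re_cinner_le)
  also have "\<dots> \<le> norm A * norm (A x) * norm (A x)"
    by (intro mult_right_mono norm_blinfun) auto
  finally have 1: "Re (cinner (A (A x)) (A x)) \<le> norm A * s"
    by (simp add: s_def power2_eq_square)
  have "cinner (A (A x)) x = cinner (A x) (A x)"
    by (rule positive_selfadjoint[OF A])
  then have "0 \<le> Re (cinner (A x) x) - 2 * ?t * s + ?t * (?t * Re (cinner (A (A x)) (A x)))"
    using positive_Re[OF A, of "x - ?t *\<^sub>R A x"]
    by (simp add: blinfun.diff_right blinfun.scaleR_right cinner.diff_left cinner.diff_right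
        cinner.scaleR_left cinner.scaleR_right s_def norm_sq_eq_cinner algebra_simps)
  also have "?t * (?t * Re (cinner (A (A x)) (A x))) \<le> ?t * (?t * (norm A * s))"
    using 1 nA by (intro mult_left_mono) auto
  also have "\<dots> = ?t * s" using nA by simp
  finally have "?t * s \<le> Re (cinner (A x) x)" by simp
  then show ?thesis using nA by (simp add: s_def field_simps)
qed simp

lemma positive_form_zero:
  "positive_op A \<Longrightarrow> Re (cinner (blinfun_apply A x) x) = 0 \<Longrightarrow> A x = 0"
  using positive_norm_sq_le[of A x] by simp

section \<open>Composition algebra and existence of square roots\<close>

interpretation blinfun_compose: bounded_bilinear
  "blinfun_compose :: ('b::real_normed_vector \<Rightarrow>\<^sub>L 'c::real_normed_vector) \<Rightarrow> ('a::real_normed_vector \<Rightarrow>\<^sub>L 'b) \<Rightarrow> _"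
  by (rule bounded_bilinear_blinfun_compose)

lemma blinfun_compose_assoc: "(A o\<^sub>L B) o\<^sub>L C = A o\<^sub>L (B o\<^sub>L C)"
  by (rule blinfun_eqI) simp

lemma blinfun_compose_id [simp]: "A o\<^sub>L id_blinfun = A" "id_blinfun o\<^sub>L A = A"
  by (rule blinfun_eqI, simp)+

lemma clinear_scaleR: "clinear_op A \<Longrightarrow> clinear_op (r *\<^sub>R A)"
  by (simp add: clinear_op_def blinfun.scaleR_left scaleC_of_real[symmetric] scaleC_scaleC mult.commute)

lemma clinear_add: "clinear_op A \<Longrightarrow> clinear_op B \<Longrightarrow> clinear_op (A + B)"
  by (simp add: clinear_op_def blinfun.add_left scaleC_add_right)

lemma clinear_diff: "clinear_op A \<Longrightarrow> clinear_op B \<Longrightarrow> clinear_op (A - B)"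
  by (simp add: clinear_op_def blinfun.diff_left cvec.scale_right_diff_distrib)

lemma clinear_zero: "clinear_op 0"
  by (simp add: clinear_op_def)

text \<open>The iteration \<open>Y \<mapsto> (I - A + Y\<^sup>2) / 2\<close> started at \<open>0\<close> converges in norm to \<open>I - A\<^sup>1\<^sup>/\<^sup>2\<close>,
  since its increments are dominated by those of the scalar iteration \<open>y \<mapsto> (1 + y\<^sup>2) / 2\<close>.\<close>

lemma positive_sqrt_exists_contraction:
  fixes A :: "'a::chilbert_space \<Rightarrow>\<^sub>L 'a"
  assumes A: "positive_op A" and A1: "norm A \<le> 1"
  obtains B where "positive_op B" "B o\<^sub>L B = A" "\<And>C. C o\<^sub>L A = A o\<^sub>L C \<Longrightarrow> C o\<^sub>L B = B o\<^sub>L C"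
proof -
  define X where "X = id_blinfun - A"
  define Y where "Y m = ((\<lambda>Z. (1/2) *\<^sub>R (X + (Z o\<^sub>L Z))) ^^ m) 0" for m
  define y where "y m = ((\<lambda>z::real. (1/2) * (1 + z * z)) ^^ m) 0" for m
  have Y0: "Y 0 = 0" and YS: "Y (Suc m) = (1/2) *\<^sub>R (X + (Y m o\<^sub>L Y m))" for m
    by (simp_all add: Y_def)
  have y0: "y 0 = 0" and yS: "y (Suc m) = (1/2) * (1 + y m * y m)" for m
    by (simp_all add: y_def)
  \<comment> \<open>For a positive contraction |A x|^2 <= cinner (A x) x, so |x - A x|^2 <= |x|^2 -
    cinner (A x) x <= |x|^2.\<close>
  have nX: "norm X \<le> 1"
  proof (rule norm_blinfun_bound)
    fix x
    have "(norm (A x))\<^sup>2 \<le> norm A * Re (cinner (A x) x)"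
      by (rule positive_norm_sq_le[OF A])
    also have "\<dots> \<le> 1 * Re (cinner (A x) x)"
      using A1 positive_Re[OF A] by (rule mult_right_mono)
    finally have "(norm (X x))\<^sup>2 \<le> (norm x)\<^sup>2"
      using norm_diff_sq[of x "A x"] Re_cinner_commute[of x "A x"] positive_Re[OF A, of x]
      by (simp add: X_def blinfun.diff_left)
    then show "norm (X x) \<le> 1 * norm x" by simp
  qed simp
  have y_bounds: "0 \<le> y m \<and> y m \<le> 1" for m
  proof (induction m)
    case (Suc m)
    then have "y m * y m \<le> 1 * 1" by (intro mult_mono) auto
    then show ?case using Suc by (simp add: yS)
  qed (simp add: y0)
  have nY: "norm (Y m) \<le> y m" for m
  proof (induction m)
    case (Suc m)
    have "norm (X + (Y m o\<^sub>L Y m)) \<le> norm X + norm (Y m o\<^sub>L Y m)" by (rule norm_triangle_ineq)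
    also have "norm (Y m o\<^sub>L Y m) \<le> norm (Y m) * norm (Y m)" by (rule norm_blinfun_compose)
    also have "\<dots> \<le> y m * y m" using Suc y_bounds[of m] by (intro mult_mono) auto
    finally show ?case using nX by (simp add: YS yS)
  qed (simp add: Y0 y0)
  have commX: "C o\<^sub>L Y m = Y m o\<^sub>L C" if C: "C o\<^sub>L X = X o\<^sub>L C" for C m
  proof (induction m)
    case (Suc m)
    have "C o\<^sub>L (Y m o\<^sub>L Y m) = (Y m o\<^sub>L Y m) o\<^sub>L C"
      by (metis Suc blinfun_compose_assoc)
    then show ?case
      by (simp add: YS C blinfun_compose.add_left blinfun_compose.add_right
          blinfun_compose.scaleR_left blinfun_compose.scaleR_right)
  qed (simp add: Y0)
  \<comment> \<open>Each iterate commutes with \<open>X\<close>, and therefore with every other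
    iterate; the difference of two squares then factors as in \<open>sq\<close>.\<close>
  have commY: "Y i o\<^sub>L Y j = Y j o\<^sub>L Y i" for i j
    by (rule commX) (rule commX[symmetric], rule refl)
  have incr: "norm (Y (Suc m) - Y m) \<le> y (Suc m) - y m" for m
  proof (induction m)
    case 0
    then show ?case using nX by (simp add: YS Y0 yS y0)
  next
    case (Suc m)
    have sq: "(1/2) *\<^sub>R (X + (Z o\<^sub>L Z)) - (1/2) *\<^sub>R (X + (W o\<^sub>L W)) = (1/2) *\<^sub>R ((Z - W) o\<^sub>L (Z + W))"
      if "Z o\<^sub>L W = W o\<^sub>L Z" for Z W
      using that unfolding scaleR_right_diff_distrib[symmetric]
      by (simp add: blinfun_compose.add_right blinfun_compose.diff_left)
    have "Y (Suc (Suc m)) - Y (Suc m) = (1/2) *\<^sub>R ((Y (Suc m) - Y m) o\<^sub>L (Y (Suc m) + Y m))"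
      using sq[OF commY[of "Suc m" m]] YS[of "Suc m"] YS[of m] by simp
    then have "norm (Y (Suc (Suc m)) - Y (Suc m)) \<le>
        (1/2) * (norm (Y (Suc m) - Y m) * norm (Y (Suc m) + Y m))"
      by (simp add: norm_blinfun_compose)
    also have "\<dots> \<le> (1/2) * ((y (Suc m) - y m) * (y (Suc m) + y m))"
      using Suc y_bounds[of "Suc m"] y_bounds[of m]
        order_trans[OF norm_triangle_ineq add_mono[OF nY[of "Suc m"] nY[of m]]]
      by (intro mult_left_mono mult_mono order_trans[OF norm_ge_zero Suc]) auto
    also have "\<dots> = y (Suc (Suc m)) - y (Suc m)"
      using yS[of "Suc m"] yS[of m] by (simp add: algebra_simps)
    finally show ?case .
  qed
  have incr': "norm (Y (m + d) - Y m) \<le> y (m + d) - y m" for m d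
  proof (induction d)
    case (Suc d)
    have "norm (Y (m + Suc d) - Y m) \<le> norm (Y (Suc (m + d)) - Y (m + d)) + norm (Y (m + d) - Y m)"
      using norm_triangle_ineq[of "Y (Suc (m + d)) - Y (m + d)" "Y (m + d) - Y m"] by simp
    then show ?case using Suc incr[of "m + d"] by simp
  qed simp
  \<comment> \<open>The increments of \<open>y\<close> dominate norms, hence are nonnegative. Being
    bounded by 1, \<open>y\<close> converges, and its Cauchy property passes to
    \<open>Y\<close>.\<close>
  have "incseq y"
    by (rule incseq_SucI) (use incr norm_ge_zero order_trans in \<open>fastforce simp del: norm_ge_zero\<close>)
  then obtain l where "y \<longlonglongrightarrow> l" using incseq_convergent[of y 1] y_bounds by blast
  then have Cy: "Cauchy y" by (rule LIMSEQ_imp_Cauchy)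
  have "Cauchy Y"
  proof (rule CauchyI)
    fix e :: real assume "0 < e"
    then obtain M where M: "\<And>i j. i \<ge> M \<Longrightarrow> j \<ge> M \<Longrightarrow> norm (y i - y j) < e"
      using CauchyD[OF Cy] by blast
    have 1: "norm (Y j - Y i) < e" if "i \<ge> M" "j \<ge> i" for i j
      using incr'[of i "j - i"] M[of j i] that by auto
    have "norm (Y i - Y j) < e" if "i \<ge> M" "j \<ge> M" for i j
      using 1[of i j] 1[of j i] that by (cases "i \<le> j") (auto simp: norm_minus_commute)
    then show "\<exists>M. \<forall>m\<ge>M. \<forall>n\<ge>M. norm (Y m - Y n) < e" by blast
  qed
  then obtain L where L: "Y \<longlonglongrightarrow> L" using Cauchy_convergent convergentD by blast
  have "(\<lambda>m. Y (Suc m)) \<longlonglongrightarrow> (1/2) *\<^sub>R (X + (L o\<^sub>L L))"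
    unfolding YS by (intro tendsto_intros blinfun_compose.tendsto L)
  \<comment> \<open>With X = I - A this fixed point equation says precisely that (I - L)^2 =
    A.\<close>
  then have LL: "L = (1/2) *\<^sub>R (X + (L o\<^sub>L L))"
    using LIMSEQ_Suc[OF L] LIMSEQ_unique by blast
  have nL: "norm L \<le> 1"
    using tendsto_norm[OF L] nY y_bounds order_trans by (intro LIMSEQ_le_const2) blast+
  have LA: "(\<lambda>m. Y m x) \<longlonglongrightarrow> L x" for x
    by (intro blinfun.tendsto L tendsto_const)
  have cX: "clinear_op X"
    unfolding X_def by (intro clinear_diff clinear_id positive_clinear A)
  have cY: "clinear_op (Y m)" for m
    by (induction m) (auto simp: Y0 YS intro!: clinear_zero clinear_scaleR clinear_add cX)
  have cL: "clinear_op L"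
    unfolding clinear_op_def
  proof (intro allI)
    fix c x
    have "(\<lambda>m. Y m (c *\<^sub>C x)) \<longlonglongrightarrow> c *\<^sub>C L x"
      unfolding clinear_opD[OF cY] by (intro bounded_linear.tendsto[OF _ LA]
          bounded_linear_intro[where K = "cmod c"])
        (auto simp: scaleC_add_right norm_scaleC scaleC_of_real[symmetric] scaleC_scaleC mult.commute)
    then show "L (c *\<^sub>C x) = c *\<^sub>C L x" using LA LIMSEQ_unique by blast
  qed
  have hX: "cinner (X u) v = cinner u (X v)" for u v
    by (simp add: X_def blinfun.diff_left cinner.diff_left cinner.diff_right positive_selfadjoint[OF A])
  have hY: "cinner (Y m u) v = cinner u (Y m v)" for m u v
    by (induction m arbitrary: u v)
      (simp_all add: Y0 YS blinfun.add_left blinfun.scaleR_left cinner_add_left cinner_add_right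
        cinner.scaleR_left cinner.scaleR_right hX cinner.zero_left cinner.zero_right)
  have hL: "cinner (L u) v = cinner u (L v)" for u v
  proof (rule LIMSEQ_unique)
    show "(\<lambda>m. cinner (Y m u) v) \<longlonglongrightarrow> cinner (L u) v"
      by (intro cinner.tendsto LA tendsto_const)
    show "(\<lambda>m. cinner (Y m u) v) \<longlonglongrightarrow> cinner u (L v)"
      unfolding hY by (intro cinner.tendsto LA tendsto_const)
  qed
  show ?thesis
  proof (rule that[of "id_blinfun - L"])
    show "positive_op (id_blinfun - L)"
    proof (rule positiveI)
      show "clinear_op (id_blinfun - L)" by (intro clinear_diff clinear_id cL)
      show "cinner ((id_blinfun - L) u) v = cinner u ((id_blinfun - L) v)" for u v
        by (simp add: blinfun.diff_left cinner.diff_left cinner.diff_right hL)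
      fix u
      have "Re (cinner (L u) u) \<le> norm (L u) * norm u" by (rule Re_cinner_le)
      also have "\<dots> \<le> norm L * norm u * norm u" by (intro mult_right_mono norm_blinfun) auto
      also have "\<dots> \<le> 1 * norm u * norm u" by (intro mult_right_mono nL) auto
      finally show "0 \<le> Re (cinner ((id_blinfun - L) u) u)"
        by (simp add: blinfun.diff_left cinner.diff_left norm_sq_eq_cinner[symmetric] power2_eq_square)
    qed
    have "2 *\<^sub>R L = X + (L o\<^sub>L L)" using arg_cong[OF LL, of "\<lambda>Z. 2 *\<^sub>R Z"] by simp
    then have "L o\<^sub>L L = L + L - X" by (simp add: scaleR_2 algebra_simps)
    then show "(id_blinfun - L) o\<^sub>L (id_blinfun - L) = A"
      by (simp add: blinfun_compose.diff_left blinfun_compose.diff_right X_def)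
    fix C assume "C o\<^sub>L A = A o\<^sub>L C"
    then have "C o\<^sub>L X = X o\<^sub>L C"
      by (simp add: X_def blinfun_compose.diff_left blinfun_compose.diff_right)
    then have "C o\<^sub>L Y m = Y m o\<^sub>L C" for m by (rule commX)
    moreover have "(\<lambda>m. C o\<^sub>L Y m) \<longlonglongrightarrow> (C o\<^sub>L L)" "(\<lambda>m. Y m o\<^sub>L C) \<longlonglongrightarrow> (L o\<^sub>L C)"
      by (intro blinfun_compose.tendsto L tendsto_const)+
    ultimately have "C o\<^sub>L L = L o\<^sub>L C" using LIMSEQ_unique by auto
    then show "C o\<^sub>L (id_blinfun - L) = (id_blinfun - L) o\<^sub>L C"
      by (simp add: blinfun_compose.diff_left blinfun_compose.diff_right)
  qed
qed

lemma positive_scaleR: "positive_op A \<Longrightarrow> 0 \<le> r \<Longrightarrow> positive_op (r *\<^sub>R A)"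
  by (rule positiveI)
    (simp_all add: blinfun.scaleR_left cinner.scaleR_left cinner.scaleR_right clinear_scaleR
      positive_clinear positive_Re flip: positive_selfadjoint)

text \<open>Dividing by the norm reduces to contractions. The clause about commuting operators is
  carried along because the proof of uniqueness depends on it.\<close>

lemma positive_sqrt_exists:
  fixes A :: "'a::chilbert_space \<Rightarrow>\<^sub>L 'a"
  assumes A: "positive_op A"
  shows "\<exists>B. positive_op B \<and> B o\<^sub>L B = A \<and> (\<forall>C. C o\<^sub>L A = A o\<^sub>L C \<longrightarrow> C o\<^sub>L B = B o\<^sub>L C)"
proof (cases "A = 0")
  case True
  then show ?thesis using A by (intro exI[of _ 0]) simp
next
  case False
  define a where "a = norm A"
  have a: "0 < a" using False by (simp add: a_def)
  have A': "positive_op ((1 / a) *\<^sub>R A)" "norm ((1 / a) *\<^sub>R A) \<le> 1"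
    using a A by (auto intro!: positive_scaleR) (simp add: a_def)
  show ?thesis
  proof (rule positive_sqrt_exists_contraction[OF A'])
    fix B
    assume B: "positive_op B" "B o\<^sub>L B = (1 / a) *\<^sub>R A"
      "\<And>C. C o\<^sub>L ((1 / a) *\<^sub>R A) = ((1 / a) *\<^sub>R A) o\<^sub>L C \<Longrightarrow> C o\<^sub>L B = B o\<^sub>L C"
    have "positive_op (sqrt a *\<^sub>R B)" using B(1) a by (auto intro: positive_scaleR)
    moreover have "(sqrt a *\<^sub>R B) o\<^sub>L (sqrt a *\<^sub>R B) = A"
      using a by (simp add: blinfun_compose.scaleR_left blinfun_compose.scaleR_right B(2))
    moreover have "C o\<^sub>L (sqrt a *\<^sub>R B) = (sqrt a *\<^sub>R B) o\<^sub>L C" if C: "C o\<^sub>L A = A o\<^sub>L C" for C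
    proof -
      have "C o\<^sub>L ((1 / a) *\<^sub>R A) = ((1 / a) *\<^sub>R A) o\<^sub>L C"
        by (simp only: blinfun_compose.scaleR_left blinfun_compose.scaleR_right C)
      then have "C o\<^sub>L B = B o\<^sub>L C" by (rule B(3))
      then show ?thesis
        by (simp only: blinfun_compose.scaleR_left blinfun_compose.scaleR_right)
    qed
    ultimately show ?thesis by (intro exI[of _ "sqrt a *\<^sub>R B"] conjI allI impI)
  qed
qed

text \<open>Any root \<open>R\<close> commutes with \<open>A\<close>, hence with the constructed
  root \<open>S\<close>. For u = S x - R x this gives (S + R) u = S^2 x - R^2 x = 0; both positive
  forms vanish at \<open>u\<close>, so S u = R u = 0 and u is orthogonal to itself.\<close>

lemma positive_sqrt_unique:
  fixes A :: "'a::chilbert_space \<Rightarrow>\<^sub>L 'a"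
  assumes A: "positive_op A" and B: "positive_op B" "B o\<^sub>L B = A" and C: "positive_op C" "C o\<^sub>L C = A"
  shows "B = C"
proof -
  obtain S where S: "positive_op S" "S o\<^sub>L S = A" "\<forall>C. C o\<^sub>L A = A o\<^sub>L C \<longrightarrow> C o\<^sub>L S = S o\<^sub>L C"
    using positive_sqrt_exists[OF A] by (elim exE conjE)
  have eq: "R = S" if R: "positive_op R" "R o\<^sub>L R = A" for R
  proof (rule blinfun_eqI)
    fix x
    have "R o\<^sub>L S = S o\<^sub>L R"
      by (rule S(3)[rule_format]) (simp add: R(2)[symmetric] blinfun_compose_assoc)
    then have comm: "R (S x) = S (R x)" by (metis blinfun_apply_blinfun_compose)
    define u where "u = S x - R x"
    have "S (S x) = R (R x)" using S(2) R(2) by (metis blinfun_apply_blinfun_compose)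
    then have "S u + R u = 0" by (simp add: u_def blinfun.diff_right comm)
    then have "cinner (S u) u + cinner (R u) u = 0"
      by (simp add: cinner_add_left[symmetric] cinner.zero_left)
    then have "Re (cinner (S u) u) + Re (cinner (R u) u) = 0"
      by (metis plus_complex.sel(1) zero_complex.sel(1))
    then have "Re (cinner (S u) u) = 0" "Re (cinner (R u) u) = 0"
      using positive_Re[OF S(1), of u] positive_Re[OF R(1), of u] by linarith+
    then have z: "S u = 0" "R u = 0"
      using positive_form_zero S(1) R(1) by blast+
    have "cinner u u = cinner (S u) x - cinner (R u) x"
      by (subst (2) u_def)
        (simp add: cinner.diff_right positive_selfadjoint[OF S(1)] positive_selfadjoint[OF R(1)])
    then have "cinner u u = 0" by (simp add: z cinner.zero_left)
    then show "R x = S x" by (simp add: cinner_self u_def)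
  qed
  show ?thesis using eq[OF B] eq[OF C] by simp
qed

lemma sqrt_op_unique: "positive_op B \<Longrightarrow> B o\<^sub>L B = A \<Longrightarrow> positive_op A \<Longrightarrow> sqrt_op A = B"
  unfolding sqrt_op_def by (rule the_equality) (auto intro: positive_sqrt_unique)

lemma
  assumes "positive_op A"
  shows sqrt_op_positive: "positive_op (sqrt_op A)"
    and sqrt_op_square: "sqrt_op A o\<^sub>L sqrt_op A = A"
proof -
  obtain B where "positive_op B" "B o\<^sub>L B = A"
    using positive_sqrt_exists[OF assms] by (elim exE conjE)
  then show "positive_op (sqrt_op A)" "sqrt_op A o\<^sub>L sqrt_op A = A"
    using sqrt_op_unique[of B A] assms by simp_all
qed

lemma cinner_positive_sqrt:
  assumes "positive_op A"
  shows "cinner (blinfun_apply A x) x = of_real ((norm (sqrt_op A x))\<^sup>2)"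
proof -
  have "A x = sqrt_op A (sqrt_op A x)"
    using sqrt_op_square[OF assms] by (metis blinfun_apply_blinfun_compose)
  then show ?thesis
    by (simp add: positive_selfadjoint[OF sqrt_op_positive[OF assms]] cinner_self)
qed

text \<open>Lets the condition in \<open>trace_class\<close>, which is phrased with the absolute
  value, be read off the defect operator itself.\<close>

lemma abs_op_positive:
  assumes A: "positive_op A"
  shows "abs_op A = A"
  unfolding abs_op_def adj_positive[OF A]
proof (rule sqrt_op_unique[OF A refl positiveI])
  show "clinear_op (A o\<^sub>L A)" using positive_clinear[OF A] by (auto intro: clinear_compose)
  show "0 \<le> Re (cinner ((A o\<^sub>L A) x) x)" for x
    by (simp add: positive_selfadjoint[OF A, of "A x"] norm_sq_eq_cinner[symmetric])
qed (simp add: positive_selfadjoint[OF A])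

subsection \<open>Orthonormal bases and Hilbert-Schmidt sums\<close>

text \<open>The first half of \<open>is_onb\<close>, separated so that finite subsets of a basis
  qualify too.\<close>

definition orthonormal :: "'a::chilbert_space set \<Rightarrow> bool"
  where "orthonormal E \<longleftrightarrow> (\<forall>x\<in>E. \<forall>y\<in>E. cinner x y = (if x = y then 1 else 0))"

lemma orthonormalD: "orthonormal E \<Longrightarrow> x \<in> E \<Longrightarrow> y \<in> E \<Longrightarrow> cinner x y = (if x = y then 1 else 0)"
  by (simp add: orthonormal_def)

lemma orthonormal_subset: "orthonormal E \<Longrightarrow> F \<subseteq> E \<Longrightarrow> orthonormal F"
  unfolding orthonormal_def by blast

lemma is_onb_orthonormal: "is_onb E \<Longrightarrow> orthonormal E"
  by (simp add: is_onb_def orthonormal_def)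

text \<open>Completing the square in the coefficients. Fourier coefficients make the last sum vanish
  and give Bessel; arbitrary ones bound the distance to any vector of the span from below, as
  Parseval requires.\<close>

lemma norm_diff_orthonormal_sum:
  fixes F :: "'a::chilbert_space set"
  assumes F: "orthonormal F" "finite F"
  shows "(norm (x - (\<Sum>e\<in>F. c e *\<^sub>C e)))\<^sup>2 =
    (norm x)\<^sup>2 - (\<Sum>e\<in>F. (cmod (cinner x e))\<^sup>2) + (\<Sum>e\<in>F. (cmod (cinner x e - c e))\<^sup>2)"
proof -
  let ?s = "\<Sum>e\<in>F. c e *\<^sub>C e"
  have se: "cinner ?s e = c e" if "e \<in> F" for e
  proof -
    have "cinner ?s e = (\<Sum>f\<in>F. if f = e then c f else 0)"
      unfolding cinner.sum_left cinner_scaleC_left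
      by (intro sum.cong refl) (use that in \<open>simp add: orthonormalD[OF F(1)]\<close>)
    then show ?thesis using that F by simp
  qed
  have "cinner ?s ?s = (\<Sum>e\<in>F. cnj (c e) * c e)"
    unfolding cinner.sum_right[of ?s] cinner_scaleC_right by (intro sum.cong refl) (simp add: se)
  then have 1: "(norm ?s)\<^sup>2 = (\<Sum>e\<in>F. Re (cnj (c e) * c e))"
    by (simp add: norm_sq_eq_cinner)
  have 2: "Re (cinner x ?s) = (\<Sum>e\<in>F. Re (cnj (c e) * cinner x e))"
    by (simp add: cinner.sum_right cinner_scaleC_right)
  have 3: "(cmod (a - b))\<^sup>2 = (cmod a)\<^sup>2 + Re (cnj b * b) - 2 * Re (cnj b * a)" for a b
    unfolding cmod_power2 by (simp add: power2_eq_square algebra_simps)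
  show ?thesis
    unfolding norm_diff_sq[of x ?s] 1 2 3 sum.distrib sum_subtractf sum_distrib_left by linarith
qed

lemma bessel_inequality:
  assumes "orthonormal E" "finite F" "F \<subseteq> E"
  shows "(\<Sum>e\<in>F. (cmod (cinner x e))\<^sup>2) \<le> (norm x)\<^sup>2"
proof -
  have "0 \<le> (norm (x - (\<Sum>e\<in>F. cinner x e *\<^sub>C e)))\<^sup>2" by simp
  then show ?thesis
    unfolding norm_diff_orthonormal_sum[OF orthonormal_subset[OF assms(1,3)] assms(2)] by simp
qed

text \<open>One inequality is Bessel. For the other, a vector of the span within sqrt epsilon of
  \<open>x\<close> uses finitely many basis vectors, and already their coefficients account for
  |x|^2 up to epsilon.\<close>

theorem parseval:
  assumes E: "is_onb E"
  shows "((\<lambda>e. (cmod (cinner x e))\<^sup>2) has_sum (norm x)\<^sup>2) E"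
proof -
  note on = is_onb_orthonormal[OF E]
  have sm: "(\<lambda>e. (cmod (cinner x e))\<^sup>2) summable_on E"
    by (rule nonneg_bdd_above_summable_on)
      (auto intro!: bdd_aboveI[of _ "(norm x)\<^sup>2"] bessel_inequality[OF on])
  have "(\<Sum>\<^sub>\<infinity>e\<in>E. (cmod (cinner x e))\<^sup>2) \<le> (norm x)\<^sup>2"
    by (rule infsum_le_finite_sums[OF sm]) (rule bessel_inequality[OF on])
  moreover have "(norm x)\<^sup>2 \<le> (\<Sum>\<^sub>\<infinity>e\<in>E. (cmod (cinner x e))\<^sup>2) + \<epsilon>" if \<epsilon>: "0 < \<epsilon>" for \<epsilon>
  proof -
    have "x \<in> closure (cvec.span E)" using E by (simp add: is_onb_def)
    then obtain y where y: "y \<in> cvec.span E" "dist y x < sqrt \<epsilon>"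
      using \<epsilon> closure_approachable[of x "cvec.span E"] by (metis real_sqrt_gt_zero)
    obtain F c where F: "finite F" "F \<subseteq> E" "y = (\<Sum>e\<in>F. c e *\<^sub>C e)"
      using y(1) unfolding cvec.span_explicit by blast
    have "(norm x)\<^sup>2 - (\<Sum>e\<in>F. (cmod (cinner x e))\<^sup>2) \<le> (norm (x - y))\<^sup>2"
      unfolding F(3) norm_diff_orthonormal_sum[OF orthonormal_subset[OF on F(2)] F(1)]
      by (simp add: sum_nonneg)
    also have "\<dots> \<le> (sqrt \<epsilon>)\<^sup>2"
      using y(2) by (intro power_mono) (auto simp: dist_norm norm_minus_commute)
    also have "\<dots> = \<epsilon>" using \<epsilon> by simp
    finally show ?thesis
      using finite_sum_le_infsum[OF sm F(1,2)] by simp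
  qed
  then have "(norm x)\<^sup>2 \<le> (\<Sum>\<^sub>\<infinity>e\<in>E. (cmod (cinner x e))\<^sup>2)"
    by (rule field_le_epsilon)
  ultimately show ?thesis using has_sum_infsum[OF sm] by simp
qed

lemma has_sum_sum:
  fixes f :: "'i \<Rightarrow> 'e \<Rightarrow> 'b::topological_comm_monoid_add"
  assumes "\<And>i. i \<in> I \<Longrightarrow> (f i has_sum s i) E"
  shows "((\<lambda>e. \<Sum>i\<in>I. f i e) has_sum (\<Sum>i\<in>I. s i)) E"
  using assms by (induction I rule: infinite_finite_induct) (auto intro: has_sum_add)

section \<open>Squared Hilbert-Schmidt norms\<close>

definition hs_summable :: "'a::chilbert_space set \<Rightarrow> ('a \<Rightarrow>\<^sub>L 'b::chilbert_space) \<Rightarrow> bool"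
  where "hs_summable E B \<longleftrightarrow> (\<lambda>e. (norm (blinfun_apply B e))\<^sup>2) summable_on E"

definition hs_sum :: "'a::chilbert_space set \<Rightarrow> ('a \<Rightarrow>\<^sub>L 'b::chilbert_space) \<Rightarrow> real"
  where "hs_sum E B = (\<Sum>\<^sub>\<infinity>e\<in>E. (norm (blinfun_apply B e))\<^sup>2)"

lemma hs_sum_nonneg: "0 \<le> hs_sum E B"
  unfolding hs_sum_def by (rule infsum_nonneg) simp

lemma hs_has_sum: "hs_summable E B \<Longrightarrow> ((\<lambda>e. (norm (blinfun_apply B e))\<^sup>2) has_sum hs_sum E B) E"
  unfolding hs_sum_def hs_summable_def by (rule has_sum_infsum)

text \<open>Both sums are double sums of |cinner (B e) f|^2: for finitely many \<open>e\<close>,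
  Parseval in \<open>E'\<close> expands the left side, and Bessel in \<open>E\<close> bounds the
  result for each fixed \<open>f\<close>.\<close>

lemma hs_adj_le:
  assumes B: "clinear_op B" and E: "orthonormal E" and E': "is_onb E'" and s: "hs_summable E' (adj B)"
  shows "hs_summable E B \<and> hs_sum E B \<le> hs_sum E' (adj B)"
proof -
  have fin: "(\<Sum>e\<in>F. (norm (B e))\<^sup>2) \<le> hs_sum E' (adj B)" if F: "finite F" "F \<subseteq> E" for F
  proof -
    have "((\<lambda>f. \<Sum>e\<in>F. (cmod (cinner (B e) f))\<^sup>2) has_sum (\<Sum>e\<in>F. (norm (B e))\<^sup>2)) E'"
      by (intro has_sum_sum parseval E')
    then show ?thesis
    proof (rule has_sum_mono[OF _ hs_has_sum[OF s]])
      fix f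
      have "cmod (cinner (B e) f) = cmod (cinner (adj B f) e)" for e
        by (subst cinner_commute) (simp add: cinner_adj_left[OF B])
      then show "(\<Sum>e\<in>F. (cmod (cinner (B e) f))\<^sup>2) \<le> (norm (adj B f))\<^sup>2"
        using bessel_inequality[OF E F] by simp
    qed
  qed
  have "hs_summable E B"
    unfolding hs_summable_def by (rule nonneg_bdd_above_summable_on) (auto intro!: bdd_aboveI fin)
  then show ?thesis
    using fin infsum_le_finite_sums[of "\<lambda>e. (norm (B e))\<^sup>2" E "hs_sum E' (adj B)"]
    by (simp add: hs_summable_def hs_sum_def)
qed

text \<open>The inequality applied to \<open>B\<close> and to its adjoint. For selfadjoint
  \<open>B\<close> it also shows independence of the basis.\<close>

lemma hs_adj:
  assumes B: "clinear_op B" and E: "is_onb E" and E': "is_onb E'" and s: "hs_summable E' (adj B)"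
  shows "hs_summable E B" "hs_sum E B = hs_sum E' (adj B)"
  using hs_adj_le[OF B is_onb_orthonormal[OF E] E' s]
    hs_adj_le[OF clinear_adj[OF B] is_onb_orthonormal[OF E'] E] adj_adj[OF B] by auto

lemma hs_compose_left:
  assumes s: "hs_summable E B" and A: "norm A \<le> 1"
  shows "hs_summable E (A o\<^sub>L B) \<and> hs_sum E (A o\<^sub>L B) \<le> hs_sum E B"
proof -
  have le: "(norm ((A o\<^sub>L B) e))\<^sup>2 \<le> (norm (B e))\<^sup>2" for e
  proof -
    have "norm (A (B e)) \<le> norm A * norm (B e)" by (rule norm_blinfun)
    also have "\<dots> \<le> 1 * norm (B e)" by (intro mult_right_mono A) auto
    finally show ?thesis by simp
  qed
  have "hs_summable E (A o\<^sub>L B)"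
    unfolding hs_summable_def
    by (rule summable_on_comparison_test[OF s[unfolded hs_summable_def]]) (use le in auto)
  then show ?thesis
    using s le unfolding hs_summable_def hs_sum_def by (auto intro!: infsum_mono)
qed

text \<open>\<open>A\<close> moves the basis vectors, so no termwise comparison is available. Taking
  adjoints turns right composition into left composition, where the bound is pointwise.\<close>

lemma hs_compose_right:
  fixes A B :: "'a::chilbert_space \<Rightarrow>\<^sub>L 'a"
  assumes E: "is_onb E" and s: "hs_summable E B" and A: "norm A \<le> 1" and "clinear_op A" "clinear_op B"
  shows "hs_summable E (B o\<^sub>L A) \<and> hs_sum E (B o\<^sub>L A) \<le> hs_sum E B"
proof -
  have 1: "hs_summable E (adj B)" "hs_sum E (adj B) = hs_sum E B"
    using hs_adj[OF clinear_adj[OF assms(5)] E E] s by (simp_all add: adj_adj assms)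
  have "hs_summable E (adj (B o\<^sub>L A)) \<and> hs_sum E (adj (B o\<^sub>L A)) \<le> hs_sum E (adj B)"
    unfolding adj_compose[OF assms(5,4)]
    by (rule hs_compose_left[OF 1(1)]) (use norm_adj_le[OF assms(4)] A in simp)
  then show ?thesis
    using hs_adj[OF clinear_compose[OF assms(5,4)] E E] 1 by simp
qed

text \<open>Every trace in the statement is computed through this: \<open>I\<close> is a singleton
  for the defect, a set of word tuples for the numerator, and a set of coordinates for the
  denominator.\<close>

lemma op_trace_eq_hs_sum:
  assumes "\<And>x. cinner (blinfun_apply A x) x = (\<Sum>i\<in>I. of_real ((norm (blinfun_apply (B i) x))\<^sup>2))"
    and "\<And>i. i \<in> I \<Longrightarrow> hs_summable (SOME E. is_onb E) (B i)"
  shows "op_trace A = of_real (\<Sum>i\<in>I. hs_sum (SOME E. is_onb E) (B i))"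
proof -
  have "((\<lambda>e. \<Sum>i\<in>I. complex_of_real ((norm (B i e))\<^sup>2)) has_sum
      (\<Sum>i\<in>I. of_real (hs_sum (SOME E. is_onb E) (B i)))) (SOME E. is_onb E)"
    by (intro has_sum_sum has_sum_of_real hs_has_sum assms(2))
  then show ?thesis
    unfolding op_trace_def assms(1) by (simp add: infsumI)
qed

subsection \<open>Trace and rank\<close>

text \<open>\<open>trace_class\<close> yields summability only for some basis \<open>E0\<close>;
  since the root is selfadjoint, \<open>hs_adj\<close> carries it to \<open>E\<close>.\<close>

lemma hs_summable_sqrt_op:
  assumes D: "positive_op D" and E: "is_onb E" and tc: "trace_class D"
  shows "hs_summable E (sqrt_op D)"
proof -
  obtain E0 where E0: "is_onb E0" "(\<lambda>e. cinner (D e) e) summable_on E0"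
    using tc abs_op_positive[OF D] by (auto simp: trace_class_def)
  have "(\<lambda>e. Re (cinner (D e) e)) summable_on E0"
    by (rule summable_on_Re[OF E0(2)])
  then have "hs_summable E0 (sqrt_op D)"
    by (simp add: hs_summable_def cinner_positive_sqrt[OF D])
  then have "hs_summable E0 (adj (sqrt_op D))"
    by (simp add: adj_positive sqrt_op_positive D)
  then show ?thesis
    by (rule hs_adj(1)[OF positive_clinear[OF sqrt_op_positive[OF D]] E E0(1)])
qed

text \<open>Gram-Schmidt. A vector already in the span of its predecessors contributes nothing,
  whence only an inequality of cardinalities.\<close>

lemma orthonormal_spanning_exists:
  fixes B :: "'a::chilbert_space set"
  assumes "finite B"
  shows "\<exists>F. finite F \<and> card F \<le> card B \<and> orthonormal F \<and> B \<subseteq> cvec.span F"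
  using assms
proof (induction B rule: finite_induct)
  case empty
  then show ?case by (auto simp: orthonormal_def intro!: exI[of _ "{}"])
next
  case (insert b B)
  then obtain F where F: "finite F" "card F \<le> card B" "orthonormal F" "B \<subseteq> cvec.span F"
    by blast
  define p where "p = (\<Sum>e\<in>F. cinner b e *\<^sub>C e)"
  define c where "c = b - p"
  have p: "p \<in> cvec.span F"
    unfolding p_def by (intro cvec.span_sum cvec.span_scale cvec.span_base)
  show ?case
  proof (cases "c = 0")
    case True
    then have "insert b B \<subseteq> cvec.span F" using F p by (simp add: c_def)
    then show ?thesis using F insert by (intro exI[of _ F]) auto
  next
    case False
    define u where "u = (1 / norm c) *\<^sub>R c"
    have orth: "cinner u e = 0" if e: "e \<in> F" for e
    proof -
      have "cinner p e = (\<Sum>f\<in>F. if f = e then cinner b f else 0)"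
        unfolding p_def cinner.sum_left cinner_scaleC_left
        by (intro sum.cong refl) (use e in \<open>simp add: orthonormalD[OF F(3)]\<close>)
      then have "cinner p e = cinner b e" using e F by simp
      then show ?thesis by (simp add: u_def c_def cinner.scaleR_left cinner.diff_left)
    qed
    have orth': "cinner e u = 0" if "e \<in> F" for e
      by (subst cinner_commute) (simp add: orth[OF that])
    have "norm u = 1" using False by (simp add: u_def)
    then have uu: "cinner u u = 1" by (simp add: cinner_self)
    then have "u \<notin> F" using orth by fastforce
    then have "orthonormal (insert u F)"
      using orth orth' F(3) uu by (simp add: orthonormal_def) metis
    moreover have "insert b B \<subseteq> cvec.span (insert u F)"
    proof -
      have sub: "cvec.span F \<subseteq> cvec.span (insert u F)" by (intro cvec.span_mono) auto
      have "b = p + norm c *\<^sub>R u" using False by (simp add: u_def c_def)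
      also have "\<dots> = p + of_real (norm c) *\<^sub>C u" by (simp add: scaleC_of_real)
      also have "\<dots> \<in> cvec.span (insert u F)"
        using p sub by (intro cvec.span_add cvec.span_scale) (auto intro: cvec.span_base)
      finally show ?thesis using F(4) sub by blast
    qed
    moreover have "card (insert u F) \<le> card (insert b B)"
      using F(1,2) insert.hyps by (simp add: card_insert_if)
    ultimately show ?thesis using F(1) by (intro exI[of _ "insert u F"]) auto
  qed
qed

text \<open>Let \<open>p\<close> be the projection of \<open>e\<close> to the span of
  \<open>F\<close>. Since e - p is orthogonal to the range of the selfadjoint \<open>D\<close>, it
  is annihilated by \<open>D\<close>, and the form at \<open>e\<close> equals that at
  \<open>p\<close>, which is at most |p|^2. Exchanging the sums, Bessel over \<open>E\<close> bounds
  the share of each unit vector of \<open>F\<close> by 1.\<close>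

lemma hs_sum_sqrt_le_card:
  assumes D: "positive_op D" and D1: "\<And>x. Re (cinner (blinfun_apply D x) x) \<le> (norm x)\<^sup>2"
    and E: "orthonormal E" and s: "hs_summable E (sqrt_op D)"
    and F: "finite F" "orthonormal F" "range D \<subseteq> cvec.span F"
  shows "hs_sum E (sqrt_op D) \<le> card F"
proof -
  have le: "(norm (sqrt_op D e))\<^sup>2 \<le> (\<Sum>f\<in>F. (cmod (cinner f e))\<^sup>2)" for e
  proof -
    define p where "p = (\<Sum>f\<in>F. cinner e f *\<^sub>C f)"
    have perp: "cinner (e - p) f = 0" if f: "f \<in> F" for f
    proof -
      have "cinner p f = (\<Sum>g\<in>F. if g = f then cinner e g else 0)"
        unfolding p_def cinner.sum_left cinner_scaleC_left
        by (intro sum.cong refl) (use f in \<open>simp add: orthonormalD[OF F(2)]\<close>)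
      then show ?thesis using f F by (simp add: cinner.diff_left)
    qed
    have "cinner (e - p) y = 0" if "y \<in> cvec.span F" for y
      using that
      by (induction rule: cvec.span_induct_alt)
        (auto simp: cinner.zero_right cinner_add_right cinner_scaleC_right perp)
    then have "cinner (e - p) (D y) = 0" for y using F(3) by blast
    then have "cinner y (D (e - p)) = 0" for y
      by (subst cinner_commute) (simp add: positive_selfadjoint[OF D])
    then have "D (e - p) = 0"
      by - (rule cinner_right_ext, simp add: cinner.zero_right)
    then have De: "D e = D p" by (simp add: blinfun.diff_right)
    have "cinner (D e) e = cinner (D p) p"
      by (simp add: De positive_selfadjoint[OF D])
    then have "(norm (sqrt_op D e))\<^sup>2 = Re (cinner (D p) p)"
      by (metis Re_complex_of_real cinner_positive_sqrt[OF D])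
    also have "\<dots> \<le> (norm p)\<^sup>2" by (rule D1)
    also have "(norm p)\<^sup>2 = (\<Sum>f\<in>F. (cmod (cinner e f))\<^sup>2)"
      using norm_diff_orthonormal_sum[OF F(2,1), of 0 "\<lambda>f. cinner e f"]
      by (simp add: p_def cinner.zero_left)
    also have "\<dots> = (\<Sum>f\<in>F. (cmod (cinner f e))\<^sup>2)"
      by (subst cinner_commute) simp
    finally show ?thesis .
  qed
  show ?thesis
    unfolding hs_sum_def
  proof (rule infsum_le_finite_sums[OF s[unfolded hs_summable_def]])
    fix G assume G: "finite G" "G \<subseteq> E"
    have "(\<Sum>e\<in>G. (norm (sqrt_op D e))\<^sup>2) \<le> (\<Sum>e\<in>G. \<Sum>f\<in>F. (cmod (cinner f e))\<^sup>2)"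
      by (intro sum_mono le)
    also have "\<dots> = (\<Sum>f\<in>F. \<Sum>e\<in>G. (cmod (cinner f e))\<^sup>2)" by (rule sum.swap)
    also have "\<dots> \<le> (\<Sum>f\<in>F. (norm f)\<^sup>2)" by (intro sum_mono bessel_inequality[OF E G])
    also have "\<dots> = (\<Sum>f\<in>F. 1)"
      by (intro sum.cong refl) (simp add: norm_sq_eq_cinner orthonormalD[OF F(2)])
    finally show "(\<Sum>e\<in>G. (norm (sqrt_op D e))\<^sup>2) \<le> card F" by simp
  qed
qed

lemma hs_sum_sqrt_le_rank:
  assumes D: "positive_op D" and D1: "\<And>x. Re (cinner (blinfun_apply D x) x) \<le> (norm x)\<^sup>2"
    and E: "orthonormal E" and s: "hs_summable E (sqrt_op D)"
  shows "ereal (hs_sum E (sqrt_op D)) \<le> ereal_of_enat (op_rank D)"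
proof (cases "\<exists>F. finite F \<and> range D \<subseteq> cvec.span F")
  case True
  then obtain F where F: "finite F" "range D \<subseteq> cvec.span F" by blast
  obtain B where B: "B \<subseteq> range D" "cvec.independent B" "range D \<subseteq> cvec.span B"
      "card B = cvec.dim (range D)"
    using cvec.basis_exists by blast
  have "finite B"
    using cvec.independent_span_bound[OF F(1) B(2)] B(1) F(2) by blast
  then obtain G where G: "finite G" "card G \<le> card B" "orthonormal G" "B \<subseteq> cvec.span G"
    using orthonormal_spanning_exists by blast
  have "range D \<subseteq> cvec.span G"
    using B(3) cvec.span_minimal[OF G(4) cvec.subspace_span] by blast
  then have "hs_sum E (sqrt_op D) \<le> card G"
    by (intro hs_sum_sqrt_le_card D D1 E s G)
  then show ?thesis using True G(2) B(4) by (simp add: op_rank_def)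
next
  case False
  then have "op_rank D = \<infinity>" by (simp only: op_rank_def if_False)
  then show ?thesis by simp
qed

subsection \<open>Averages of coordinatewise decreasing functions\<close>

text \<open>Indexed by an arbitrary set \<open>A\<close> so that the points can be counted by
  induction on \<open>A\<close>; for A = {1..k} it is the index set in
  \<open>curv_mean\<close>.\<close>

definition simplex_points :: "'i set \<Rightarrow> nat \<Rightarrow> ('i \<Rightarrow> nat) set"
  where "simplex_points A m = {q \<in> A \<rightarrow>\<^sub>E UNIV. (\<Sum>i\<in>A. q i) \<le> m}"

lemma finite_simplex_points:
  assumes A: "finite A"
  shows "finite (simplex_points A m)"
proof (rule finite_subset)
  show "simplex_points A m \<subseteq> A \<rightarrow>\<^sub>E {..m}"
  proof
    fix q assume q: "q \<in> simplex_points A m"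
    have "q i \<le> m" if "i \<in> A" for i
    proof -
      have "q i \<le> (\<Sum>i\<in>A. q i)" using A that by (intro member_le_sum) auto
      then show ?thesis using q by (simp add: simplex_points_def)
    qed
    then show "q \<in> A \<rightarrow>\<^sub>E {..m}" using q by (auto simp: simplex_points_def PiE_iff)
  qed
qed (use A in \<open>auto intro: finite_PiE\<close>)

text \<open>The hockey-stick identity, which sums the sizes of the slices of a simplex.\<close>

lemma sum_choose_diagonal: "(\<Sum>t\<le>m. (t + c) choose c) = (Suc (m + c)) choose (Suc c)"
  by (induction m) auto

lemma card_simplex_points:
  assumes "finite A"
  shows "card (simplex_points A m) = (m + card A) choose (card A)"
  using assms
proof (induction A arbitrary: m rule: finite_induct)
  case empty
  then show ?case by (simp add: simplex_points_def)
next
  case (insert x A)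
  let ?f = "\<lambda>(t, q). q(x := t)"
  have bij: "bij_betw ?f (SIGMA t:{..m}. simplex_points A (m - t)) (simplex_points (insert x A) m)"
  \<comment> \<open>Fixing the coordinate at \<open>x\<close> to be \<open>t\<close> leaves a
    simplex of size m - t. The inverse resets that coordinate to \<open>undefined\<close>, the value
    extensionality prescribes outside \<open>A\<close>.\<close>
  proof (rule bij_betw_byWitness[where f' = "\<lambda>q. (q x, q(x := undefined))"])
    have ext: "q x = undefined" if "q \<in> simplex_points A j" for q j
      using that insert.hyps by (auto simp: simplex_points_def PiE_iff extensional_def)
    show "\<forall>p\<in>SIGMA t:{..m}. simplex_points A (m - t).
        ((?f p) x, (?f p)(x := undefined)) = p"
      using ext by (fastforce simp: fun_eq_iff)
    have sum: "(\<Sum>i\<in>A. (q(x := t)) i) = (\<Sum>i\<in>A. q i)" for q :: "'a \<Rightarrow> nat" and t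
      using insert.hyps by (intro sum.cong) auto
    show "?f ` (SIGMA t:{..m}. simplex_points A (m - t)) \<subseteq> simplex_points (insert x A) m"
      using insert.hyps sum by (auto simp: simplex_points_def PiE_iff extensional_def)
    show "(\<lambda>q. (q x, q(x := undefined))) ` simplex_points (insert x A) m
        \<subseteq> (SIGMA t:{..m}. simplex_points A (m - t))"
      using insert.hyps sum by (auto simp: simplex_points_def PiE_iff extensional_def)
  qed auto
  have "card (simplex_points (insert x A) m) = (\<Sum>t\<le>m. card (simplex_points A (m - t)))"
    using bij_betw_same_card[OF bij] insert.hyps by (simp add: card_SigmaI finite_simplex_points)
  also have "\<dots> = (\<Sum>t\<le>m. (m - t + card A) choose card A)"
    by (simp add: insert.IH)
  also have "\<dots> = (\<Sum>t\<le>m. (t + card A) choose card A)"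
    by (rule sum.reindex_bij_witness[of _ "\<lambda>t. m - t" "\<lambda>t. m - t"]) auto
  finally show ?case using insert.hyps by (simp add: sum_choose_diagonal)
qed

text \<open>A translate by a vector of total \<open>s\<close> has asymptotically full density in the
  larger simplex. Raising \<open>c\<close> by one multiplies the ratio by (m + c + 1) / (m + s + c +
  1), which tends to 1.\<close>

lemma binomial_ratio_tendsto_1:
  "(\<lambda>m. real ((m + c) choose c) / real ((m + s + c) choose c)) \<longlonglongrightarrow> 1"
proof (induction c)
  case (Suc c)
  have step: "real ((m + Suc c) choose Suc c) = real (m + Suc c) / Suc c * real ((m + c) choose c)" for m
  proof -
    have "real (Suc c) * real ((m + Suc c) choose Suc c) = real (m + Suc c) * real ((m + c) choose c)"
      using Suc_times_binomial[of c "m + c"] by (metis add_Suc_right of_nat_mult)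
    then show ?thesis
      by (metis nonzero_mult_div_cancel_left of_nat_neq_0 times_divide_eq_left)
  qed
  have "(\<lambda>m. real s / real (m + (s + Suc c))) \<longlonglongrightarrow> 0"
    by (rule LIMSEQ_ignore_initial_segment[OF lim_const_over_n])
  then have "(\<lambda>m. 1 - real s / real (m + (s + Suc c))) \<longlonglongrightarrow> 1 - 0"
    by (intro tendsto_intros)
  moreover have "1 - real s / real (m + (s + Suc c)) = real (m + Suc c) / real (m + s + Suc c)" for m
    by (simp add: field_simps)
  ultimately have "(\<lambda>m. real (m + Suc c) / real (m + s + Suc c)) \<longlonglongrightarrow> 1" by simp
  from tendsto_mult[OF Suc this]
  show ?case
    unfolding step by (simp add: field_simps del: of_nat_Suc of_nat_add)
qed simp

text \<open>Passes from single steps to the product order: \<open>q'\<close> is lowered by one in a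
  coordinate where it exceeds \<open>q\<close>, by induction on its total.\<close>

lemma PiE_decreasing:
  fixes a :: "('i \<Rightarrow> nat) \<Rightarrow> real"
  assumes "finite A"
    and dec: "\<And>q i. q \<in> A \<rightarrow>\<^sub>E UNIV \<Longrightarrow> i \<in> A \<Longrightarrow> a (q(i := Suc (q i))) \<le> a q"
    and q: "q \<in> A \<rightarrow>\<^sub>E UNIV" "q' \<in> A \<rightarrow>\<^sub>E UNIV" "\<And>i. i \<in> A \<Longrightarrow> q i \<le> q' i"
  shows "a q' \<le> a q"
  using q(2,3)
proof (induction "\<Sum>i\<in>A. q' i" arbitrary: q' rule: less_induct)
  case less
  show ?case
  proof (cases "q' = q")
    case False
    then obtain i where i: "i \<in> A" "q i < q' i"
      using less.prems q(1) by (metis PiE_ext order_le_less)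
    define p where "p = q'(i := q' i - 1)"
    have p: "p \<in> A \<rightarrow>\<^sub>E UNIV" "\<And>j. j \<in> A \<Longrightarrow> q j \<le> p j"
      using less.prems i by (auto simp: p_def PiE_iff extensional_def)
    have "(\<Sum>j\<in>A. p j) < (\<Sum>j\<in>A. q' j)"
      using assms(1) i by (intro sum_strict_mono_ex1) (auto simp: p_def)
    then have "a p \<le> a q" using less.hyps p by blast
    moreover have "q' = p(i := Suc (p i))" using i by (auto simp: p_def fun_eq_iff)
    ultimately show ?thesis using dec[OF p(1) i(1)] by simp
  qed simp
qed

theorem simplex_average_tendsto:
  fixes a :: "('i \<Rightarrow> nat) \<Rightarrow> real"
  assumes A: "finite A"
    and dec: "\<And>q i. q \<in> A \<rightarrow>\<^sub>E UNIV \<Longrightarrow> i \<in> A \<Longrightarrow> a (q(i := Suc (q i))) \<le> a q"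
    and nonneg: "\<And>q. q \<in> A \<rightarrow>\<^sub>E UNIV \<Longrightarrow> 0 \<le> a q"
  obtains l where "0 \<le> l" "l \<le> a (\<lambda>i\<in>A. 0)"
    "(\<lambda>m. (\<Sum>q\<in>simplex_points A m. a q) / real ((m + card A) choose card A)) \<longlonglongrightarrow> l"
proof -
  let ?Q = "A \<rightarrow>\<^sub>E (UNIV :: nat set)" and ?z = "\<lambda>i\<in>A. 0 :: nat"
  define N where "N m = real ((m + card A) choose card A)" for m
  define M where "M m = (\<Sum>q\<in>simplex_points A m. a q) / N m" for m
  define l where "l = (INF q\<in>?Q. a q)"
  have N0: "0 < N m" for m by (simp add: N_def)
  have zQ: "?z \<in> ?Q" by simp
  have bdd: "bdd_below (a ` ?Q)" by (rule bdd_belowI[of _ 0]) (use nonneg in auto)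
  have l_le: "l \<le> a q" if "q \<in> ?Q" for q
    unfolding l_def using bdd that by (rule cINF_lower)
  have l0: "0 \<le> l"
    unfolding l_def by (rule cINF_greatest) (use zQ nonneg in blast)+
  have simplex_Q: "simplex_points A m \<subseteq> ?Q" for m by (auto simp: simplex_points_def)
  have a_le: "a q \<le> a ?z" if "q \<in> ?Q" for q
    by (rule PiE_decreasing[OF A dec zQ that]) auto
  have lower: "l \<le> M m" for m
  proof -
    have "(\<Sum>q\<in>simplex_points A m. l) \<le> (\<Sum>q\<in>simplex_points A m. a q)"
      using simplex_Q by (intro sum_mono l_le) blast
    then show ?thesis
      using N0[of m] by (simp add: M_def N_def card_simplex_points[OF A] field_simps)
  qed
  \<comment> \<open>Choose \<open>p\<close> with a p < u. On the translate of the simplex by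
    \<open>p\<close> all values are at most a p; the rest, of proportion 1 - r m, is bounded by the
    value at the origin and disappears in the limit.\<close>
  have upper: "\<forall>\<^sub>F m in sequentially. M m < u" if u: "l < u" for u
  proof -
    obtain p where p: "p \<in> ?Q" "a p < u"
      using u cINF_less_iff[OF _ bdd, of u] zQ unfolding l_def by blast
    define s where "s = (\<Sum>i\<in>A. p i)"
    define r where "r m = N m / N (m + s)" for m
    have "(\<lambda>m. a p * r m + (1 - r m) * a ?z) \<longlonglongrightarrow> a p * 1 + (1 - 1) * a ?z"
      unfolding r_def N_def by (intro tendsto_intros binomial_ratio_tendsto_1)
    then have "\<forall>\<^sub>F m in sequentially. a p * r m + (1 - r m) * a ?z < u"
      using p(2) by (intro order_tendstoD) auto
    moreover have "M (m + s) \<le> a p * r m + (1 - r m) * a ?z" for m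
    proof -
      \<comment> \<open>Translation by \<open>p\<close>, restricted to \<open>A\<close> to stay
        extensional; it embeds the simplex of size \<open>m\<close> into that of size m + s.\<close>
      let ?f = "\<lambda>q. \<lambda>i\<in>A. q i + p i"
      let ?S = "?f ` simplex_points A m"
      have inj: "inj_on ?f (simplex_points A m)"
      proof (rule inj_onI)
        fix q q' assume q: "q \<in> simplex_points A m" "q' \<in> simplex_points A m" "?f q = ?f q'"
        then have qQ: "q \<in> ?Q" "q' \<in> ?Q" using simplex_Q by blast+
        show "q = q'"
        proof (rule PiE_ext[OF qQ])
          show "q i = q' i" if "i \<in> A" for i
            using fun_cong[OF q(3), of i] that by simp
        qed
      qed
      have sub: "?S \<subseteq> simplex_points A (m + s)"
        by (auto simp: simplex_points_def s_def sum.distrib)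
      have fin: "finite (simplex_points A (m + s))" by (rule finite_simplex_points[OF A])
      have cS: "real (card ?S) = N m"
        by (simp add: card_image[OF inj] card_simplex_points[OF A] N_def)
      have cT: "real (card (simplex_points A (m + s))) = N (m + s)"
        by (simp add: card_simplex_points[OF A] N_def)
      have cD: "real (card (simplex_points A (m + s) - ?S)) = N (m + s) - N m"
        using card_Diff_subset[OF finite_subset[OF sub fin] sub] card_mono[OF fin sub] cS cT by simp
      have "(\<Sum>q\<in>simplex_points A (m + s). a q)
          = (\<Sum>q\<in>simplex_points A (m + s) - ?S. a q) + (\<Sum>q\<in>?S. a q)"
        by (rule sum.subset_diff[OF sub fin])
      also have "\<dots> \<le> (\<Sum>q\<in>simplex_points A (m + s) - ?S. a ?z) + (\<Sum>q\<in>?S. a p)"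
      proof (intro add_mono sum_mono)
        show "a q \<le> a ?z" if "q \<in> simplex_points A (m + s) - ?S" for q
          using that simplex_Q by (intro a_le) blast
        show "a q \<le> a p" if "q \<in> ?S" for q
          using that sub simplex_Q[of "m + s"] by (intro PiE_decreasing[OF A dec p(1)]) auto
      qed
      also have "\<dots> = (N (m + s) - N m) * a ?z + N m * a p" by (simp add: cS cD)
      finally have "M (m + s) \<le> ((N (m + s) - N m) * a ?z + N m * a p) / N (m + s)"
        unfolding M_def using N0 by (intro divide_right_mono) (auto intro: less_imp_le)
      also have "\<dots> = a p * r m + (1 - r m) * a ?z"
        using N0[of "m + s"] by (simp add: r_def field_simps)
      finally show ?thesis .
    qed
    ultimately have "\<forall>\<^sub>F m in sequentially. M (m + s) < u"
      by (auto elim!: eventually_mono intro: le_less_trans)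
    then show ?thesis
      by (rule eventually_sequentially_seg[of "\<lambda>m. M m < u" s, THEN iffD1])
  qed
  have "M \<longlonglongrightarrow> l"
  proof (rule order_tendstoI)
    show "\<forall>\<^sub>F m in sequentially. u < M m" if "u < l" for u
      using lower that by (intro always_eventually) (auto intro: less_le_trans)
  qed (rule upper)
  then show ?thesis using that l0 l_le[OF zQ] unfolding M_def N_def by blast
qed

subsection \<open>Orthogonal projections\<close>

lemma closure_subspace:
  fixes M :: "'a::chilbert_space set"
  assumes M: "cvec.subspace M"
  shows "cvec.subspace (closure M)"
proof (rule cvec.subspaceI)
  show "0 \<in> closure M" using cvec.subspace_0[OF M] closure_subset by blast
next
  fix x y assume "x \<in> closure M" "y \<in> closure M"
  then obtain f g where "\<And>m. f m \<in> M" "f \<longlonglongrightarrow> x" "\<And>m. g m \<in> M" "g \<longlonglongrightarrow> y"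
    unfolding closure_sequential by blast
  then show "x + y \<in> closure M"
    unfolding closure_sequential
    by (intro exI[of _ "\<lambda>m. f m + g m"]) (auto intro!: tendsto_add cvec.subspace_add M)
next
  fix c and x assume "x \<in> closure M"
  then obtain f where f: "\<And>m. f m \<in> M" "f \<longlonglongrightarrow> x"
    unfolding closure_sequential by blast
  have "bounded_linear (\<lambda>x :: 'a. c *\<^sub>C x)"
    by (rule bounded_linear_intro[where K = "cmod c"])
      (auto simp: scaleC_add_right norm_scaleC scaleC_of_real[symmetric] scaleC_scaleC mult.commute)
  then have "(\<lambda>m. c *\<^sub>C f m) \<longlonglongrightarrow> c *\<^sub>C x" by (rule bounded_linear.tendsto) (rule f)
  then show "c *\<^sub>C x \<in> closure M"
    unfolding closure_sequential using f(1)
    by (intro exI[of _ "\<lambda>m. c *\<^sub>C f m"]) (auto intro!: cvec.subspace_scale M)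
qed

definition is_projection :: "'a::chilbert_space set \<Rightarrow> ('a \<Rightarrow>\<^sub>L 'a) \<Rightarrow> bool"
  where "is_projection M P \<longleftrightarrow> (\<forall>x. P x \<in> M \<and> (\<forall>y\<in>M. cinner (x - P x) y = 0))"

lemma projection_unique:
  fixes x :: "'a::chilbert_space"
  assumes M: "cvec.subspace M"
    and p: "p \<in> M" "\<And>y. y \<in> M \<Longrightarrow> cinner (x - p) y = 0"
    and q: "q \<in> M" "\<And>y. y \<in> M \<Longrightarrow> cinner (x - q) y = 0"
  shows "p = q"
proof -
  have pq: "p - q \<in> M" using M p q by (intro cvec.subspace_diff)
  have "cinner (p - q) (p - q) = cinner (x - q) (p - q) - cinner (x - p) (p - q)"
    by (simp add: cinner.diff_left)
  then have "cinner (p - q) (p - q) = 0" using p(2)[OF pq] q(2)[OF pq] by simp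
  then show ?thesis by (simp add: cinner_self)
qed

lemma proj_onto_eqI:
  assumes M: "cvec.subspace M" and P: "is_projection M P"
  shows "proj_onto M = P"
  unfolding proj_onto_def
proof (rule the_equality)
  show "\<forall>x. P x \<in> M \<and> (\<forall>y\<in>M. cinner (x - P x) y = 0)"
    using P by (simp add: is_projection_def)
  fix Q assume Q: "\<forall>x. blinfun_apply Q x \<in> M \<and> (\<forall>y\<in>M. cinner (x - Q x) y = 0)"
  show "Q = P"
  proof (rule blinfun_eqI)
    show "Q x = P x" for x
      using Q P by (intro projection_unique[OF M, of "Q x" x "P x"]) (auto simp: is_projection_def)
  qed
qed

lemma is_projection_id: "is_projection UNIV id_blinfun"
  by (simp add: is_projection_def cinner.zero_left)

text \<open>Uniqueness of the orthogonal decomposition makes the pointwise choice complex linear,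
  and Pythagoras bounds it by 1.\<close>

lemma projection_exists:
  fixes M :: "'a::chilbert_space set"
  assumes M: "cvec.subspace M" "closed M"
  obtains P where "is_projection M P" "clinear_op P"
proof -
  have "\<exists>p\<in>M. \<forall>y\<in>M. cinner (x - p) y = 0" for x
    by (rule orthogonal_projection_exists[OF M, of x]) blast
  then obtain g where g: "\<And>x. g x \<in> M" "\<And>x y. y \<in> M \<Longrightarrow> cinner (x - g x) y = 0"
    by metis
  have uniq: "g x = p" if "p \<in> M" "\<And>y. y \<in> M \<Longrightarrow> cinner (x - p) y = 0" for x p
    by (rule projection_unique[OF M(1) g that])
  have add: "g (x + y) = g x + g y" for x y
  proof (rule uniq)
    show "g x + g y \<in> M" by (intro cvec.subspace_add M g)
    have "x + y - (g x + g y) = (x - g x) + (y - g y)" by simp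
    then show "cinner (x + y - (g x + g y)) z = 0" if "z \<in> M" for z
      using g(2)[OF that, of x] g(2)[OF that, of y] by (simp only: cinner_add_left add_0)
  qed
  have scale: "g (c *\<^sub>C x) = c *\<^sub>C g x" for c x
  proof (rule uniq)
    show "c *\<^sub>C g x \<in> M" by (intro cvec.subspace_scale M g)
    have "c *\<^sub>C x - c *\<^sub>C g x = c *\<^sub>C (x - g x)" by (simp add: cvec.scale_right_diff_distrib)
    then show "cinner (c *\<^sub>C x - c *\<^sub>C g x) z = 0" if "z \<in> M" for z
      using g(2)[OF that, of x] by (simp only: cinner_scaleC_left mult_zero_right)
  qed
  have "bounded_linear g"
  proof (rule bounded_linear_intro[where K = 1])
    show "g (r *\<^sub>R x) = r *\<^sub>R g x" for r x
      using scale[of "of_real r" x] by (simp add: scaleC_of_real)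
    fix x
    have "(norm (g x + (x - g x)))\<^sup>2 = (norm (g x))\<^sup>2 + (norm (x - g x))\<^sup>2"
      using g(2)[OF g(1), of x x] Re_cinner_commute[of "g x" "x - g x"]
      by (subst norm_add_sq) simp
    then have "(norm (g x))\<^sup>2 \<le> (norm x)\<^sup>2" by simp
    then show "norm (g x) \<le> norm x * 1" by simp
  qed (rule add)
  then have "blinfun_apply (Blinfun g) = g" by (rule bounded_linear_Blinfun_apply)
  then show ?thesis
    using that[of "Blinfun g"] g scale by (simp add: is_projection_def clinear_op_def)
qed

lemma projection_fixes:
  assumes M: "cvec.subspace M" and P: "is_projection M P" and x: "x \<in> M"
  shows "blinfun_apply P x = x"
  using P x by (intro projection_unique[OF M, of "P x" x x]) (auto simp: is_projection_def cinner.zero_left)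

lemma projection_orthogonal:
  assumes P: "is_projection M P" and x: "\<And>y. y \<in> M \<Longrightarrow> cinner x y = 0"
  shows "blinfun_apply P x = 0"
proof -
  have Px: "P x \<in> M" using P by (simp add: is_projection_def)
  then have "cinner (x - P x) (P x) = 0" using P by (simp add: is_projection_def)
  then have "cinner (P x) (P x) = 0" using x[OF Px] by (simp add: cinner.diff_left)
  then show ?thesis by (simp add: cinner_self)
qed

subsection \<open>Square-summable families\<close>

text \<open>Stands for the elementary tensor of a basis vector with \<open>v\<close>, as
  \<open>elem_tensor_e_word\<close> confirms; for v = 1 it is \<open>e_word\<close>.\<close>

definition delta :: "'i \<Rightarrow> 'a \<Rightarrow> ('i, 'a::chilbert_space) ell2"
  where "delta i v = Abs_ell2 (\<lambda>j. if j = i then v else 0)"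

lemma coord_Abs_ell2_bounded:
  assumes "\<And>F. finite F \<Longrightarrow> (\<Sum>i\<in>F. (norm (f i))\<^sup>2) \<le> C"
  shows "coord (Abs_ell2 f) = f"
  by (rule Abs_ell2_inverse) (use ell2_summableI[OF assms] in simp)

lemma coord_delta: "coord (delta i v) j = (if j = i then v else 0)"
proof -
  have "(\<Sum>j\<in>F. (norm (if j = i then v else 0))\<^sup>2) \<le> (norm v)\<^sup>2" if "finite F" for F
  proof -
    have "(\<Sum>j\<in>F. (norm (if j = i then v else 0))\<^sup>2) = (\<Sum>j\<in>F. if j = i then (norm v)\<^sup>2 else 0)"
      by (intro sum.cong) auto
    then show ?thesis using that by simp
  qed
  then show ?thesis unfolding delta_def by (subst coord_Abs_ell2_bounded) auto
qed

lemma ell2_eqI: "(\<And>i. coord f i = coord g i) \<Longrightarrow> f = g"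
  by (simp add: coord_inject[symmetric] fun_eq_iff)

lemma delta_zero [simp]: "delta i 0 = 0"
  by (rule ell2_eqI) (simp add: coord_delta)

lemma e_word_eq_delta: "e_word \<alpha> = delta \<alpha> 1"
  by (simp add: e_word_def delta_def)

lemma cinner_ell2_finite:
  assumes "finite S" "\<And>i. i \<notin> S \<Longrightarrow> cinner (coord f i) (coord g i) = 0"
  shows "cinner f g = (\<Sum>i\<in>S. cinner (coord f i) (coord g i))"
proof -
  have "cinner f g = (\<Sum>\<^sub>\<infinity>i\<in>S. cinner (coord f i) (coord g i))"
    unfolding cinner_ell2_def by (rule infsum_cong_neutral) (use assms in auto)
  then show ?thesis using assms(1) by simp
qed

lemma cinner_delta_right: "cinner f (delta i v) = cinner (coord f i) v"
  by (subst cinner_ell2_finite[of "{i}"]) (auto simp: coord_delta cinner.zero_right)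

lemma cinner_delta_left: "cinner (delta i v) f = cinner v (coord f i)"
  by (subst cinner_ell2_finite[of "{i}"]) (auto simp: coord_delta cinner.zero_left)

lemma norm_delta: "norm (delta i v) = norm v"
proof (rule power2_eq_imp_eq)
  show "(norm (delta i v))\<^sup>2 = (norm v)\<^sup>2"
    unfolding norm_sq_eq_cinner by (simp add: cinner_delta_left coord_delta)
qed simp_all

text \<open>The squared distance from \<open>f\<close> to a finite partial sum is the remaining part
  of the series for |f|^2. This supplies the norm convergence behind the infinite sum in
  \<open>berezin_kernel\<close>.\<close>

lemma delta_has_sum:
  assumes S: "\<And>i. i \<notin> S \<Longrightarrow> coord f i = 0"
  shows "((\<lambda>i. delta i (coord f i)) has_sum f) S"
proof -
  have dist: "(norm ((\<Sum>i\<in>F. delta i (coord f i)) - f))\<^sup>2 = (norm f)\<^sup>2 - (\<Sum>i\<in>F. (norm (coord f i))\<^sup>2)"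
    if F: "finite F" for F
  proof -
    let ?s = "\<Sum>i\<in>F. delta i (coord f i)"
    have fs: "cinner f ?s = of_real (\<Sum>i\<in>F. (norm (coord f i))\<^sup>2)"
      by (simp add: cinner.sum_right cinner_delta_right cinner_self)
    have cs: "coord ?s i = (if i \<in> F then coord f i else 0)" for i
    proof -
      have "coord (\<Sum>j\<in>G. delta j (coord f j)) i = (\<Sum>j\<in>G. if i = j then coord f j else 0)"
        if "finite G" for G
        using that by (induction G) (auto simp: coord_delta)
      then show ?thesis using F by simp
    qed
    have "cinner ?s ?s = of_real (\<Sum>i\<in>F. (norm (coord f i))\<^sup>2)"
      by (subst cinner_ell2_finite[OF F]) (auto simp: cs cinner.zero_left cinner_self)
    then have "(norm ?s)\<^sup>2 = (\<Sum>i\<in>F. (norm (coord f i))\<^sup>2)"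
      by (simp add: norm_sq_eq_cinner)
    then show ?thesis
      unfolding norm_diff_sq using fs Re_cinner_commute[of ?s f] by simp
  qed
  have "((\<lambda>i. (norm (coord f i))\<^sup>2) has_sum (norm f)\<^sup>2) UNIV"
    unfolding norm_ell2_square by (rule has_sum_infsum) (rule coord_summable)
  then have "((\<lambda>F. (norm f)\<^sup>2 - (\<Sum>i\<in>F. (norm (coord f i))\<^sup>2)) \<longlongrightarrow> (norm f)\<^sup>2 - (norm f)\<^sup>2)
      (finite_subsets_at_top UNIV)"
    unfolding has_sum_def by (intro tendsto_intros)
  then have "((\<lambda>F. sqrt ((norm f)\<^sup>2 - (\<Sum>i\<in>F. (norm (coord f i))\<^sup>2))) \<longlongrightarrow> sqrt 0)
      (finite_subsets_at_top UNIV)"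
    by (intro tendsto_real_sqrt) simp
  moreover have "\<forall>\<^sub>F F in finite_subsets_at_top UNIV.
      sqrt ((norm f)\<^sup>2 - (\<Sum>i\<in>F. (norm (coord f i))\<^sup>2)) = dist (\<Sum>i\<in>F. delta i (coord f i)) f"
    using eventually_finite_subsets_at_top_weakI[of UNIV "\<lambda>F. finite F"]
    by (rule eventually_mono) (auto simp: dist[symmetric] dist_norm)
  ultimately have "((\<lambda>F. dist (\<Sum>i\<in>F. delta i (coord f i)) f) \<longlongrightarrow> 0) (finite_subsets_at_top UNIV)"
    by (simp add: tendsto_cong)
  then have "((\<lambda>i. delta i (coord f i)) has_sum f) UNIV"
    unfolding has_sum_def by (rule tendsto_dist_iff[THEN iffD2])
  then show ?thesis
    by (subst has_sum_cong_neutral[of UNIV S]) (auto simp: S)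
qed

text \<open>Common source of the Berezin kernel and of diagonal operators. Its value is the intended
  one under the uniform square bound of the next lemma, which keeps the families in the
  \<open>ell2\<close> type.\<close>

definition ell2_map :: "('i \<Rightarrow> 'a \<Rightarrow>\<^sub>L 'b) \<Rightarrow> ('a::chilbert_space \<Rightarrow>\<^sub>L ('i, 'b::chilbert_space) ell2)"
  where "ell2_map B = Blinfun (\<lambda>h. Abs_ell2 (\<lambda>i. B i h))"

lemma ell2_map:
  assumes "\<And>F h. finite F \<Longrightarrow> (\<Sum>i\<in>F. (norm (blinfun_apply (B i) h))\<^sup>2) \<le> (C * norm h)\<^sup>2" "0 \<le> C"
  shows coord_ell2_map: "coord (blinfun_apply (ell2_map B) h) i = B i h"
    and ell2_map_apply: "blinfun_apply (ell2_map B) = (\<lambda>h. Abs_ell2 (\<lambda>i. B i h))"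
proof -
  have co: "coord (Abs_ell2 (\<lambda>i. B i h)) = (\<lambda>i. B i h)" for h
    by (rule coord_Abs_ell2_bounded) (rule assms(1))
  have "bounded_linear (\<lambda>h. Abs_ell2 (\<lambda>i. B i h))"
  proof (rule bounded_linear_intro[where K = C])
    show "norm (Abs_ell2 (\<lambda>i. B i h)) \<le> norm h * C" for h
      by (rule norm_ell2_le) (use assms co in \<open>auto simp: mult.commute\<close>)
    show "Abs_ell2 (\<lambda>i. B i (x + y)) = Abs_ell2 (\<lambda>i. B i x) + Abs_ell2 (\<lambda>i. B i y)" for x y
      by (rule ell2_eqI, unfold coord_add co) (rule blinfun.add_right)
    show "Abs_ell2 (\<lambda>i. B i (r *\<^sub>R x)) = r *\<^sub>R Abs_ell2 (\<lambda>i. B i x)" for r x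
      by (rule ell2_eqI, unfold coord_scaleR co) (rule blinfun.scaleR_right)
  qed
  then show ap: "blinfun_apply (ell2_map B) = (\<lambda>h. Abs_ell2 (\<lambda>i. B i h))"
    unfolding ell2_map_def by (rule bounded_linear_Blinfun_apply)
  show "coord (blinfun_apply (ell2_map B) h) i = B i h" by (simp add: ap co)
qed

definition coord_op :: "'i \<Rightarrow> (('i, 'a) ell2 \<Rightarrow>\<^sub>L 'a::chilbert_space)"
  where "coord_op i = Blinfun (\<lambda>f. coord f i)"

lemma coord_op_apply [simp]:
  fixes f :: "('i, 'a::chilbert_space) ell2"
  shows "blinfun_apply (coord_op i) f = coord f i"
proof -
  have "bounded_linear (\<lambda>f :: ('i, 'a) ell2. coord f i)"
    by (rule bounded_linear_intro[where K = 1]) (auto intro: norm_coord_le)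
  then show ?thesis by (simp add: coord_op_def bounded_linear_Blinfun_apply)
qed

text \<open>Both the Fock projections and the tensor operators in the curvature turn out to be of
  this form.\<close>

definition diag_op :: "'i set \<Rightarrow> ('a \<Rightarrow>\<^sub>L 'a) \<Rightarrow> (('i, 'a) ell2 \<Rightarrow>\<^sub>L ('i, 'a::chilbert_space) ell2)"
  where "diag_op S P = ell2_map (\<lambda>i. if i \<in> S then P o\<^sub>L coord_op i else 0)"

lemma coord_diag_op:
  fixes f :: "('i, 'a::chilbert_space) ell2"
  shows "coord (blinfun_apply (diag_op S P) f) i = (if i \<in> S then P (coord f i) else 0)"
proof -
  have "(\<Sum>i\<in>F. (norm ((if i \<in> S then P o\<^sub>L coord_op i else 0) f))\<^sup>2) \<le> (norm P * norm f)\<^sup>2"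
    if F: "finite F" for F and f :: "('i, 'a) ell2"
  proof -
    have "(\<Sum>i\<in>F. (norm ((if i \<in> S then P o\<^sub>L coord_op i else 0) f))\<^sup>2)
        \<le> (\<Sum>i\<in>F. (norm P)\<^sup>2 * (norm (coord f i))\<^sup>2)"
      by (intro sum_mono) (auto simp: power_mult_distrib[symmetric] intro!: power_mono norm_blinfun)
    also have "\<dots> \<le> (norm P)\<^sup>2 * (norm f)\<^sup>2"
      unfolding sum_distrib_left[symmetric] norm_ell2_square
      by (intro mult_left_mono finite_sum_le_infsum coord_summable F) auto
    finally show ?thesis by (simp add: power_mult_distrib)
  qed
  then show ?thesis unfolding diag_op_def by (subst coord_ell2_map) auto
qed

lemma clinear_diag_op: "clinear_op P \<Longrightarrow> clinear_op (diag_op S P)"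
  unfolding clinear_op_def[of "diag_op S P"]
  by (auto intro!: ell2_eqI simp: coord_diag_op clinear_opD)

lemma cinner_diag_op:
  assumes "finite S"
  shows "cinner (blinfun_apply (diag_op S P) f) f = (\<Sum>i\<in>S. cinner (P (coord f i)) (coord f i))"
  by (subst cinner_ell2_finite[OF assms]) (auto simp: coord_diag_op cinner.zero_left)

text \<open>Justifies the choice of a basis inside \<open>op_trace\<close> for the denominator,
  where no trace class hypothesis provides one.\<close>

lemma is_onb_delta: "is_onb (range (\<lambda>i::'i. delta i (1 :: complex)))"
  unfolding is_onb_def
proof (intro conjI)
  show "\<forall>x\<in>range (\<lambda>i::'i. delta i (1 :: complex)). \<forall>y\<in>range (\<lambda>i::'i. delta i (1 :: complex)). cinner x y = (if x = y then 1 else 0)"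
  proof (intro ballI)
    fix x y :: "('i, complex) ell2" assume "x \<in> range (\<lambda>i::'i. delta i (1 :: complex))" "y \<in> range (\<lambda>i::'i. delta i (1 :: complex))"
    then obtain i j where x: "x = delta i 1" and y: "y = delta j 1" by blast
    have "(delta i (1 :: complex) = delta j 1) = (i = j)"
      using coord_delta[of i "1 :: complex" i] coord_delta[of j "1 :: complex" i] by (metis zero_neq_one)
    then show "cinner x y = (if x = y then 1 else 0)"
      by (simp add: x y cinner_delta_left coord_delta cinner_complex_def)
  qed
  let ?M = "cvec.span (range (\<lambda>i::'i. delta i (1 :: complex)))"
  have "f \<in> closure ?M" for f :: "('i, complex) ell2"
  proof (rule Lim_in_closed_set[of "closure ?M" "\<lambda>F. \<Sum>i\<in>F. delta i (coord f i)" "finite_subsets_at_top UNIV"])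
    have "delta i c = c *\<^sub>C delta i 1" for i :: 'i and c :: complex
      by (rule ell2_eqI) (simp add: coord_delta scaleC_complex_def)
    then have "(\<Sum>i\<in>F. delta i (coord f i)) \<in> ?M" for F
      by (metis (no_types, lifting) cvec.span_base cvec.span_scale cvec.span_sum rangeI)
    then show "\<forall>\<^sub>F F in finite_subsets_at_top UNIV. (\<Sum>i\<in>F. delta i (coord f i)) \<in> closure ?M"
      using closure_subset by (intro always_eventually) blast
    show "((\<lambda>F. \<Sum>i\<in>F. delta i (coord f i)) \<longlongrightarrow> f) (finite_subsets_at_top UNIV)"
      using delta_has_sum[of UNIV f] by (simp add: has_sum_def)
  qed auto
  then show "closure ?M = UNIV" by blast
qed

text \<open>By Parseval for the unit vector \<open>delta i 1\<close>, each coordinate functional has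
  Hilbert-Schmidt sum 1, whichever basis was chosen.\<close>

lemma op_trace_diag_op:
  assumes "finite S"
  shows "op_trace (diag_op S (id_blinfun :: complex \<Rightarrow>\<^sub>L complex)) = of_nat (card S)"
proof -
  let ?E = "SOME E :: ('a, complex) ell2 set. is_onb E"
  have E: "is_onb ?E" by (rule someI) (rule is_onb_delta)
  have hs: "((\<lambda>e. (norm (blinfun_apply (coord_op i :: ('a, complex) ell2 \<Rightarrow>\<^sub>L complex) e))\<^sup>2) has_sum 1) ?E" for i :: 'a
  proof -
    have "norm (delta i (1 :: complex)) = 1" by (simp add: norm_delta)
    moreover have "cmod (cinner (delta i 1) e) = cmod (coord e i)" for e :: "('a, complex) ell2"
      by (simp add: cinner_delta_left cinner_complex_def)
    ultimately show ?thesis using parseval[OF E, of "delta i 1"] by simp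
  qed
  have "op_trace (diag_op S (id_blinfun :: complex \<Rightarrow>\<^sub>L complex)) =
      of_real (\<Sum>i\<in>S. hs_sum ?E (coord_op i :: ('a, complex) ell2 \<Rightarrow>\<^sub>L complex))"
  proof (rule op_trace_eq_hs_sum)
    show "hs_summable ?E (coord_op i :: ('a, complex) ell2 \<Rightarrow>\<^sub>L complex)" for i
      unfolding hs_summable_def using hs summable_on_def by blast
  qed (simp add: cinner_diag_op assms cinner_self)
  also have "\<dots> = of_nat (card S)"
    unfolding hs_sum_def infsumI[OF hs] by simp
  finally show ?thesis .
qed

subsection \<open>Tensor products\<close>

text \<open>Square summability is the point. A finite set of tuples is enclosed in the box of its
  coordinate projections, over which the sum of products factors into a product of sums.\<close>

lemma coord_elem_tensor:
  "coord (elem_tensor k x v) \<beta> =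
    (if \<beta> \<in> extensional {1..k} then (\<Prod>i=1..k. coord (x i) (\<beta> i)) *\<^sub>C v else 0)"
proof -
  let ?f = "\<lambda>\<beta>. if \<beta> \<in> extensional {1..k} then (\<Prod>i=1..k. coord (x i) (\<beta> i)) *\<^sub>C v else 0"
  have "(\<Sum>\<beta>\<in>F. (norm (?f \<beta>))\<^sup>2) \<le> (\<Prod>i=1..k. (norm (x i))\<^sup>2) * (norm v)\<^sup>2" if F: "finite F" for F
  proof -
    let ?A = "\<lambda>i. (\<lambda>\<beta>. \<beta> i) ` F"
    let ?P = "PiE {1..k} ?A"
    have fP: "finite ?P" using F by (intro finite_PiE) auto
    have "(\<Sum>\<beta>\<in>F. (norm (?f \<beta>))\<^sup>2) = (\<Sum>\<beta>\<in>F \<inter> extensional {1..k}. (norm (?f \<beta>))\<^sup>2)"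
      using F by (intro sum.mono_neutral_right) auto
    also have "\<dots> = (\<Sum>\<beta>\<in>F \<inter> extensional {1..k}. (\<Prod>i=1..k. (cmod (coord (x i) (\<beta> i)))\<^sup>2) * (norm v)\<^sup>2)"
      by (intro sum.cong refl)
        (simp add: norm_scaleC power_mult_distrib prod_norm[symmetric] prod_power_distrib)
    also have "\<dots> \<le> (\<Sum>\<beta>\<in>?P. (\<Prod>i=1..k. (cmod (coord (x i) (\<beta> i)))\<^sup>2) * (norm v)\<^sup>2)"
      using fP by (intro sum_mono2) (auto simp: PiE_def intro!: mult_nonneg_nonneg prod_nonneg)
    also have "\<dots> = (\<Prod>i=1..k. \<Sum>\<alpha>\<in>?A i. (cmod (coord (x i) \<alpha>))\<^sup>2) * (norm v)\<^sup>2"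
      using F by (subst prod_sum_PiE) (auto simp: sum_distrib_right)
    also have "\<dots> \<le> (\<Prod>i=1..k. (norm (x i))\<^sup>2) * (norm v)\<^sup>2"
      unfolding norm_ell2_square using F
      by (intro mult_right_mono prod_mono conjI finite_sum_le_infsum coord_summable sum_nonneg) auto
    finally show ?thesis .
  qed
  then show ?thesis unfolding elem_tensor_def by (subst coord_Abs_ell2_bounded) auto
qed

lemma elem_tensor_e_word:
  assumes "\<beta> \<in> extensional {1..k}"
  shows "elem_tensor k (\<lambda>i. e_word (\<beta> i)) v = delta \<beta> v"
proof (rule ell2_eqI)
  fix \<gamma> :: "nat \<Rightarrow> nat list"
  have "(\<Prod>i=1..k. coord (e_word (\<beta> i)) (\<gamma> i)) = (if \<forall>i\<in>{1..k}. \<gamma> i = \<beta> i then 1 else 0)"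
    by (auto simp: e_word_eq_delta coord_delta)
  moreover have "\<gamma> \<in> extensional {1..k} \<and> (\<forall>i\<in>{1..k}. \<gamma> i = \<beta> i) \<longleftrightarrow> \<gamma> = \<beta>"
    using assms extensionalityI by blast
  ultimately show "coord (elem_tensor k (\<lambda>i. e_word (\<beta> i)) v) \<gamma> = coord (delta \<beta> v) \<gamma>"
    using assms by (auto simp: coord_elem_tensor coord_delta scaleC_one)
qed

lemma words_of_length: "{\<alpha> \<in> words m. length \<alpha> = q} = {\<alpha>. set \<alpha> \<subseteq> {1..m} \<and> length \<alpha> = q}"
  by (auto simp: words_def)

lemma finite_words_of_length: "finite {\<alpha> \<in> words m. length \<alpha> = q}"
  unfolding words_of_length by (rule finite_lists_length_eq) simp

lemma card_words_of_length: "card {\<alpha> \<in> words m. length \<alpha> = q} = m ^ q"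
  unfolding words_of_length by (subst card_lists_length_eq) auto

lemma fock_proj_eq: "fock_proj m q = diag_op {\<alpha> \<in> words m. length \<alpha> = q} id_blinfun"
  unfolding fock_proj_def
proof (rule proj_onto_eqI)
  let ?S = "{\<alpha> \<in> words m. length \<alpha> = q}"
  let ?M = "cvec.span (e_word ` ?S)"
  show "cvec.subspace ?M" by simp
  show "is_projection ?M (diag_op ?S id_blinfun)"
    unfolding is_projection_def
  proof (intro allI conjI ballI)
    fix x
    \<comment> \<open>There are finitely many words of length \<open>q\<close>, so the projection
      lands in the span itself, as \<open>fock_proj\<close> demands without a closure.\<close>
    have "diag_op ?S id_blinfun x = (\<Sum>\<alpha>\<in>?S. coord x \<alpha> *\<^sub>C e_word \<alpha>)"
    proof (rule ell2_eqI)
      fix \<beta>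
      have "coord (\<Sum>\<alpha>\<in>G. coord x \<alpha> *\<^sub>C e_word \<alpha>) \<beta> = (\<Sum>\<alpha>\<in>G. if \<beta> = \<alpha> then coord x \<alpha> else 0)"
        if "finite G" for G
        using that by (induction G) (auto simp: e_word_eq_delta coord_delta scaleC_complex_def)
      then show "coord (diag_op ?S id_blinfun x) \<beta> = coord (\<Sum>\<alpha>\<in>?S. coord x \<alpha> *\<^sub>C e_word \<alpha>) \<beta>"
        using finite_words_of_length[of m q] by (simp add: coord_diag_op)
    qed
    then show "diag_op ?S id_blinfun x \<in> ?M"
      by (simp only:) (intro cvec.span_sum cvec.span_scale cvec.span_base imageI)
    fix y assume "y \<in> ?M"
    then show "cinner (x - diag_op ?S id_blinfun x) y = 0"
    proof (induction rule: cvec.span_induct_alt)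
      case (step c z y)
      then obtain \<alpha> where \<alpha>: "\<alpha> \<in> ?S" "z = e_word \<alpha>" by blast
      have "cinner (x - diag_op ?S id_blinfun x) (e_word \<alpha>) = 0"
        unfolding e_word_eq_delta cinner_delta_right using \<alpha>(1) by (simp add: coord_diag_op cinner.zero_left)
      then show ?case using step \<alpha> by (simp add: cinner_add_right cinner_scaleC_right)
    qed (simp add: cinner.zero_right)
  qed
qed

text \<open>\<open>P\<close> takes the place of the identity because \<open>tensor_op\<close>
  vanishes on the complement of the tensor space and hence annihilates components orthogonal to
  \<open>D\<close>. Uniqueness: the conditions fix the operator on a dense part of the tensor space
  and on its complement.\<close>

lemma tensor_op_fock_proj:
  fixes n q :: "nat \<Rightarrow> nat" and D :: "'a::chilbert_space set"
  assumes D: "cvec.subspace D" and P: "is_projection D P" "clinear_op P"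
  shows "tensor_op k n D (\<lambda>i. fock_proj (n i) (q i)) id_blinfun =
    diag_op (\<Pi>\<^sub>E i\<in>{1..k}. {\<alpha> \<in> words (n i). length \<alpha> = q i}) P"
    (is "_ = diag_op ?S P")
  unfolding tensor_op_def
proof (rule the_equality)
  let ?T = "tensor_space k n D"
  have "diag_op ?S P (elem_tensor k x v) =
      elem_tensor k (\<lambda>i. fock_proj (n i) (q i) (x i)) (id_blinfun v)" if v: "v \<in> D" for x v
  proof (rule ell2_eqI)
    fix \<beta> :: "nat \<Rightarrow> nat list"
    have "(\<Prod>i=1..k. coord (fock_proj (n i) (q i) (x i)) (\<beta> i)) =
        (if \<forall>i\<in>{1..k}. \<beta> i \<in> {\<alpha> \<in> words (n i). length \<alpha> = q i} then \<Prod>i=1..k. coord (x i) (\<beta> i) else 0)"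
      by (auto simp: fock_proj_eq coord_diag_op intro!: prod.cong)
    then show "coord (diag_op ?S P (elem_tensor k x v)) \<beta> =
        coord (elem_tensor k (\<lambda>i. fock_proj (n i) (q i) (x i)) (id_blinfun v)) \<beta>"
      using projection_fixes[OF D P(1) v]
      by (auto simp: coord_diag_op coord_elem_tensor PiE_iff clinear_opD[OF P(2)])
  qed
  moreover have "diag_op ?S P y = 0" if y: "\<forall>z\<in>?T. cinner y z = 0" for y
  proof (rule ell2_eqI)
    fix \<beta>
    \<comment> \<open>Orthogonality of \<open>y\<close> to all tensors of one basis vector with
      vectors of \<open>D\<close> says that this coordinate is orthogonal to
      \<open>D\<close>.\<close>
    have "P (coord y \<beta>) = 0" if \<beta>: "\<beta> \<in> ?S"
    proof (rule projection_orthogonal[OF P(1)])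
      fix v assume v: "v \<in> D"
      have "e_word (\<beta> i) \<in> fock (n i)" if "i \<in> {1..k}" for i
      proof -
        have "e_word (\<beta> i) \<in> e_word ` words (n i)" using \<beta> that by (auto simp: PiE_iff)
        then show ?thesis
          unfolding fock_def by (intro subsetD[OF closure_subset] cvec.span_base)
      qed
      then have "elem_tensor k (\<lambda>i. e_word (\<beta> i)) v
          \<in> {elem_tensor k x v | x v. (\<forall>i\<in>{1..k}. x i \<in> fock (n i)) \<and> v \<in> D}"
        using v by (intro CollectI exI[of _ "\<lambda>i. e_word (\<beta> i)"] exI[of _ v]) simp
      then have "elem_tensor k (\<lambda>i. e_word (\<beta> i)) v \<in> ?T"
        unfolding tensor_space_def by (intro subsetD[OF closure_subset] cvec.span_base)
      moreover have "\<beta> \<in> extensional {1..k}" using \<beta> by (auto simp: PiE_iff)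
      ultimately show "cinner (coord y \<beta>) v = 0"
        using y by (auto simp: elem_tensor_e_word cinner_delta_right)
    qed
    then show "coord (diag_op ?S P y) \<beta> = coord 0 \<beta>" by (simp add: coord_diag_op)
  qed
  ultimately show ex: "clinear_op (diag_op ?S P) \<and>
    (\<forall>x v. (\<forall>i\<in>{1..k}. x i \<in> fock (n i)) \<and> v \<in> D \<longrightarrow> diag_op ?S P (elem_tensor k x v) =
        elem_tensor k (\<lambda>i. fock_proj (n i) (q i) (x i)) (id_blinfun v)) \<and>
    (\<forall>y. (\<forall>z\<in>?T. cinner y z = 0) \<longrightarrow> diag_op ?S P y = 0)"
    using clinear_diag_op[OF P(2)] by blast
  fix C assume C: "clinear_op C \<and>
    (\<forall>x v. (\<forall>i\<in>{1..k}. x i \<in> fock (n i)) \<and> v \<in> D \<longrightarrow> blinfun_apply C (elem_tensor k x v) =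
        elem_tensor k (\<lambda>i. fock_proj (n i) (q i) (x i)) (id_blinfun v)) \<and>
    (\<forall>y. (\<forall>z\<in>?T. cinner y z = 0) \<longrightarrow> C y = 0)"
  show "C = diag_op ?S P"
  proof (rule blinfun_eqI)
    fix y
    let ?G = "{elem_tensor k x v | x v. (\<forall>i\<in>{1..k}. x i \<in> fock (n i)) \<and> v \<in> D}"
    have sT: "cvec.subspace ?T" unfolding tensor_space_def by (intro closure_subspace) simp
    have "closed ?T" by (simp add: tensor_space_def)
    then obtain p where p: "p \<in> ?T" "\<And>z. z \<in> ?T \<Longrightarrow> cinner (y - p) z = 0"
      by (rule orthogonal_projection_exists[OF sT]) blast
    have "C (y - p) = 0" "diag_op ?S P (y - p) = 0" using C ex p(2) by blast+
    moreover have "C p = diag_op ?S P p"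
    proof -
      have "C z = diag_op ?S P z" if "z \<in> cvec.span ?G" for z
        using that
      proof (induction rule: cvec.span_induct_alt)
        case (step c g z)
        then have "C g = diag_op ?S P g" using C ex by fastforce
        then show ?case
          using step C ex by (simp add: blinfun.add_right clinear_opD)
      qed simp
      then have "cvec.span ?G \<subseteq> {z. C z = diag_op ?S P z}" by blast
      moreover have "closed {z. C z = diag_op ?S P z}"
        by (intro closed_Collect_eq continuous_intros)
      ultimately have "closure (cvec.span ?G) \<subseteq> {z. C z = diag_op ?S P z}"
        by (rule closure_minimal)
      then show ?thesis using p(1) unfolding tensor_space_def by blast
    qed
    ultimately show "C y = diag_op ?S P y" by (simp add: blinfun.diff_right)
  qed
qed

subsection \<open>Words in a row contraction\<close>

lemma word_op_Nil [simp]: "word_op X [] = id_blinfun"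
  by (simp add: word_op_def)

lemma word_op_Cons [simp]: "word_op X (j # \<alpha>) = X j o\<^sub>L word_op X \<alpha>"
  by (simp add: word_op_def)

lemma words_Cons_iff: "j # \<alpha> \<in> words m \<longleftrightarrow> j \<in> {1..m} \<and> \<alpha> \<in> words m"
  by (auto simp: words_def)

lemma Nil_in_words [simp]: "[] \<in> words m"
  by (simp add: words_def)

lemma clinear_word_op:
  "(\<And>j. j \<in> {1..m} \<Longrightarrow> clinear_op (X j)) \<Longrightarrow> \<alpha> \<in> words m \<Longrightarrow> clinear_op (word_op X \<alpha>)"
  by (induction \<alpha>) (auto simp: words_Cons_iff)

lemma norm_compose_le_1: "norm A \<le> 1 \<Longrightarrow> norm B \<le> 1 \<Longrightarrow> norm (A o\<^sub>L B) \<le> 1"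
  by (rule order_trans[OF norm_blinfun_compose]) (simp add: mult_le_one)

lemma norm_id_blinfun_le: "norm (id_blinfun :: 'a::real_normed_vector \<Rightarrow>\<^sub>L 'a) \<le> 1"
  by (rule norm_blinfun_bound) auto

lemma norm_word_op_le_1:
  "(\<And>j. j \<in> {1..m} \<Longrightarrow> norm (X j) \<le> 1) \<Longrightarrow> \<alpha> \<in> words m \<Longrightarrow> norm (word_op X \<alpha>) \<le> 1"
  by (induction \<alpha>) (auto simp: words_Cons_iff norm_id_blinfun_le intro: norm_compose_le_1)

lemma cinner_Phi:
  assumes "\<forall>j\<in>{1..m}. clinear_op (X j)"
  shows "cinner (blinfun_apply (Phi m X Y) v) v = (\<Sum>j=1..m. cinner (Y (adj (X j) v)) (adj (X j) v))"
proof -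
  have "cinner (blinfun_apply (Phi m X Y) v) v = (\<Sum>j=1..m. cinner (X j (Y (adj (X j) v))) v)"
    by (simp add: Phi_def blinfun.sum_left cinner.sum_left)
  also have "\<dots> = (\<Sum>j=1..m. cinner (Y (adj (X j) v)) (adj (X j) v))"
    by (intro sum.cong refl) (simp add: cinner_adj_right assms)
  finally show ?thesis .
qed

lemma words_upto_Suc:
  "{\<alpha> \<in> words m. length \<alpha> \<le> Suc q} =
    insert [] ((\<lambda>(j, \<alpha>). j # \<alpha>) ` ({1..m} \<times> {\<alpha> \<in> words m. length \<alpha> \<le> q}))"
proof -
  have "\<alpha> \<in> {\<alpha> \<in> words m. length \<alpha> \<le> Suc q} \<longleftrightarrow>
      \<alpha> \<in> insert [] ((\<lambda>(j, \<alpha>). j # \<alpha>) ` ({1..m} \<times> {\<alpha> \<in> words m. length \<alpha> \<le> q}))" for \<alpha>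
    by (cases \<alpha>) (auto simp: words_Cons_iff image_iff)
  then show ?thesis by blast
qed

lemma finite_words_upto: "finite {\<alpha> \<in> words m. length \<alpha> \<le> q}"
proof (rule finite_subset)
  show "{\<alpha> \<in> words m. length \<alpha> \<le> q} \<subseteq> {\<alpha>. set \<alpha> \<subseteq> {1..m} \<and> length \<alpha> \<le> q}"
    by (auto simp: words_def)
qed (rule finite_lists_length_le, simp)

text \<open>The operator sum on the left telescopes to Y minus the (q+1)-st iterate of
  \<open>Phi\<close> at Y, and that iterate is positive. The induction peels off the first letter,
  whose adjoint acts on \<open>v\<close> first.\<close>

lemma row_telescope:
  fixes X :: "nat \<Rightarrow> 'a::chilbert_space \<Rightarrow>\<^sub>L 'a"
  assumes X: "\<forall>j\<in>{1..m}. clinear_op (X j)" and Y: "positive_op Y"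
  shows "(\<Sum>\<alpha>\<in>{\<alpha> \<in> words m. length \<alpha> \<le> q}.
      Re (cinner ((Y - Phi m X Y) (adj (word_op X \<alpha>) v)) (adj (word_op X \<alpha>) v))) \<le> Re (cinner (Y v) v)"
proof (induction q arbitrary: v)
  case 0
  have "{\<alpha> \<in> words m. length \<alpha> \<le> 0} = {[]}" by auto
  then show ?case
    by (simp add: adj_id blinfun.diff_left cinner.diff_left cinner_Phi[OF X] sum_nonneg positive_Re[OF Y])
next
  case (Suc q)
  let ?Z = "Y - Phi m X Y" and ?W = "{\<alpha> \<in> words m. length \<alpha> \<le> q}"
  let ?f = "\<lambda>v \<alpha>. Re (cinner (?Z (adj (word_op X \<alpha>) v)) (adj (word_op X \<alpha>) v))"
  have inj: "inj_on (\<lambda>(j :: nat, \<alpha>). j # \<alpha>) ({1..m} \<times> ?W)" by (auto simp: inj_on_def)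
  have "(\<Sum>\<alpha>\<in>{\<alpha> \<in> words m. length \<alpha> \<le> Suc q}. ?f v \<alpha>) =
      ?f v [] + (\<Sum>\<alpha>\<in>(\<lambda>(j, \<alpha>). j # \<alpha>) ` ({1..m} \<times> ?W). ?f v \<alpha>)"
    unfolding words_upto_Suc using finite_words_upto[of m q] by (intro sum.insert) auto
  also have "(\<Sum>\<alpha>\<in>(\<lambda>(j, \<alpha>). j # \<alpha>) ` ({1..m} \<times> ?W). ?f v \<alpha>) =
      (\<Sum>(j, \<alpha>)\<in>{1..m} \<times> ?W. ?f v (j # \<alpha>))"
    by (subst sum.reindex[OF inj]) (simp add: case_prod_unfold)
  also have "(\<Sum>(j, \<alpha>)\<in>{1..m} \<times> ?W. ?f v (j # \<alpha>)) = (\<Sum>j=1..m. \<Sum>\<alpha>\<in>?W. ?f (adj (X j) v) \<alpha>)"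
    unfolding sum.cartesian_product[symmetric]
  proof (intro sum.cong refl)
    fix j \<alpha> assume "j \<in> {1..m}" "\<alpha> \<in> ?W"
    then have "adj (word_op X (j # \<alpha>)) = adj (word_op X \<alpha>) o\<^sub>L adj (X j)"
      using X by (subst word_op_Cons, intro adj_compose) (auto intro: clinear_word_op[of m])
    then show "?f v (j # \<alpha>) = ?f (adj (X j) v) \<alpha>" by simp
  qed
  also have "\<dots> \<le> (\<Sum>j=1..m. Re (cinner (Y (adj (X j) v)) (adj (X j) v)))"
    by (intro sum_mono Suc.IH)
  also have "?f v [] = Re (cinner (Y v) v) - (\<Sum>j=1..m. Re (cinner (Y (adj (X j) v)) (adj (X j) v)))"
    by (simp add: adj_id blinfun.diff_left cinner.diff_left cinner_Phi[OF X])
  finally show ?case by simp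
qed

subsection \<open>Partial defects\<close>

text \<open>The polyball conditions are indexed by exponent vectors in {0,1}; listing the indices
  with exponent 1 instead permits induction on the list.\<close>

definition partial_defect ::
    "(nat \<Rightarrow> nat) \<Rightarrow> (nat \<Rightarrow> nat \<Rightarrow> 'a::chilbert_space \<Rightarrow>\<^sub>L 'a) \<Rightarrow> nat list \<Rightarrow> ('a \<Rightarrow>\<^sub>L 'a)"
  where "partial_defect n T is = foldr (\<lambda>i Y. Y - Phi (n i) (T i) Y) is id_blinfun"

definition partial_word_adj ::
    "(nat \<Rightarrow> nat \<Rightarrow> 'a::chilbert_space \<Rightarrow>\<^sub>L 'a) \<Rightarrow> nat list \<Rightarrow> (nat \<Rightarrow> nat list) \<Rightarrow> ('a \<Rightarrow>\<^sub>L 'a)"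
  where "partial_word_adj T is \<beta> = foldr (\<lambda>i B. adj (word_op (T i) (\<beta> i)) o\<^sub>L B) is id_blinfun"

lemma partial_defect_simps [simp]:
  "partial_defect n T [] = id_blinfun"
  "partial_defect n T (i # is) = partial_defect n T is - Phi (n i) (T i) (partial_defect n T is)"
  by (simp_all add: partial_defect_def)

lemma partial_word_adj_simps [simp]:
  "partial_word_adj T [] \<beta> = id_blinfun"
  "partial_word_adj T (i # is) \<beta> = adj (word_op (T i) (\<beta> i)) o\<^sub>L partial_word_adj T is \<beta>"
  by (simp_all add: partial_word_adj_def)

lemma word_op_adj_eq: "word_op_adj k T = partial_word_adj T [1..<Suc k]"
  by (simp add: fun_eq_iff word_op_adj_def partial_word_adj_def)

lemma defect_map_eq_partial_defect:
  assumes "\<And>i. i \<in> {1..k} \<Longrightarrow> p i \<in> {0, 1}"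
  shows "defect_map k n p T id_blinfun = partial_defect n T (filter (\<lambda>i. p i = 1) [1..<Suc k])"
proof -
  have "foldr (\<lambda>i F. ((\<lambda>Y. Y - Phi (n i) (T i) Y) ^^ p i) \<circ> F) is id Y =
      foldr (\<lambda>i Y. Y - Phi (n i) (T i) Y) (filter (\<lambda>i. p i = 1) is) Y"
    if "set is \<subseteq> {1..k}" for "is" Y
    using that
  proof (induction "is")
    case (Cons i "is")
    then have "p i \<in> {0, 1}" using assms by auto
    then show ?case using Cons by auto
  qed simp
  from this[of "[1..<Suc k]" id_blinfun]
  show ?thesis unfolding defect_map_def partial_defect_def
    by (simp add: atLeastLessThanSuc_atLeastAtMost del: upt_Suc)
qed

lemma defect_op_eq: "defect_op k n T = partial_defect n T [1..<Suc k]"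
  unfolding defect_op_def by (subst defect_map_eq_partial_defect) auto

lemma positive_partial_defect:
  assumes T: "T \<in> polyball k n" and "is": "sorted is" "distinct is" "set is \<subseteq> {1..k}"
  shows "positive_op (partial_defect n T is)"
proof -
  \<comment> \<open>The indicator of the list is an admissible exponent vector; sortedness makes
    filtering [1..<Suc k] return the very list.\<close>
  define p where "p i = (if i \<in> set is then 1 else 0 :: nat)" for i
  have "filter (\<lambda>i. p i = 1) [1..<Suc k] = is"
    using "is" by (intro sorted_distinct_set_unique) (auto simp: p_def sorted_wrt_filter simp del: upt_Suc)
  moreover have p01: "p i \<in> {0, 1}" for i by (simp add: p_def)
  ultimately have "defect_map k n p T id_blinfun = partial_defect n T is"
    using defect_map_eq_partial_defect[of k p n T] by simp
  moreover have "positive_op (defect_map k n p T id_blinfun)"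
    using T p01 unfolding polyball_def by blast
  ultimately show ?thesis by simp
qed

lemma polyball_clinear:
  "T \<in> polyball k n \<Longrightarrow> i \<in> {1..k} \<Longrightarrow> j \<in> {1..n i} \<Longrightarrow> clinear_op (T i j)"
  by (auto simp: polyball_def)

lemma positive_defect_op: "T \<in> polyball k n \<Longrightarrow> positive_op (defect_op k n T)"
  unfolding defect_op_eq by (rule positive_partial_defect) (auto simp del: upt_Suc)

text \<open>The condition with a single exponent 1 says that the tuple with index \<open>i\<close>
  is a row contraction.\<close>

lemma polyball_contraction:
  assumes T: "T \<in> polyball k n" and i: "i \<in> {1..k}" and j: "j \<in> {1..n i}"
  shows "norm (T i j) \<le> 1"
proof -
  have cl: "\<forall>j\<in>{1..n i}. clinear_op (T i j)" using polyball_clinear[OF T i] by blast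
  then have clj: "clinear_op (T i j)" using j by blast
  have pos: "positive_op (id_blinfun - Phi (n i) (T i) id_blinfun)"
    using positive_partial_defect[OF T, of "[i]"] i by simp
  have "norm (adj (T i j)) \<le> 1"
  proof (rule norm_blinfun_bound)
    fix v
    have "(norm (adj (T i j) v))\<^sup>2 \<le> (\<Sum>j=1..n i. (norm (adj (T i j) v))\<^sup>2)"
      using j by (intro member_le_sum) auto
    also have "\<dots> = Re (cinner (Phi (n i) (T i) id_blinfun v) v)"
      by (simp add: cinner_Phi[OF cl] norm_sq_eq_cinner)
    also have "\<dots> \<le> (norm v)\<^sup>2"
      using positive_Re[OF pos, of v] by (simp add: blinfun.diff_left cinner.diff_left norm_sq_eq_cinner)
    finally show "norm (adj (T i j) v) \<le> 1 * norm v" by simp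
  qed simp
  then show ?thesis
    using norm_adj_le[OF clinear_adj[OF clj]] by (simp add: adj_adj[OF clj])
qed

text \<open>\<open>row_telescope\<close> with q = 0: prefixing a factor lowers the quadratic form,
  down from that of the identity.\<close>

lemma partial_defect_le:
  assumes T: "T \<in> polyball k n" and "is": "sorted is" "distinct is" "set is \<subseteq> {1..k}"
  shows "Re (cinner (partial_defect n T is v) v) \<le> (norm v)\<^sup>2"
  using "is"
proof (induction "is")
  case (Cons i "is")
  have cl: "\<forall>j\<in>{1..n i}. clinear_op (T i j)"
    using polyball_clinear[OF T] Cons.prems by simp
  have "{\<alpha> \<in> words (n i). length \<alpha> \<le> 0} = {[]}" by auto
  then have "Re (cinner (partial_defect n T (i # is) v) v) \<le> Re (cinner (partial_defect n T is v) v)"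
    using row_telescope[where q = 0 and v = v, OF cl positive_partial_defect[OF T, of "is"]] Cons.prems
    by (simp add: adj_id)
  also have "\<dots> \<le> (norm v)\<^sup>2" using Cons by simp
  finally show ?case .
qed (simp add: norm_sq_eq_cinner)

lemma partial_word_adj_cong:
  "(\<And>i. i \<in> set is \<Longrightarrow> \<beta> i = \<beta>' i) \<Longrightarrow> partial_word_adj T is \<beta> = partial_word_adj T is \<beta>'"
  by (induction "is") auto

text \<open>Summing out the components of \<open>\<beta>\<close> one after another removes the factors of the defect in
  the order in which they are composed, so no commutation is needed here.\<close>

lemma partial_berezin_bound:
  assumes T: "T \<in> polyball k n" and "is": "sorted is" "distinct is" "set is \<subseteq> {1..k}"
  shows "(\<Sum>\<beta>\<in>(\<Pi>\<^sub>E i\<in>set is. {\<alpha> \<in> words (n i). length \<alpha> \<le> q}).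
      Re (cinner (partial_defect n T is (partial_word_adj T is \<beta> h)) (partial_word_adj T is \<beta> h)))
    \<le> (norm h)\<^sup>2"
  using "is"
proof (induction "is")
  case (Cons i "is")
  let ?W = "\<lambda>i. {\<alpha> \<in> words (n i). length \<alpha> \<le> q}"
  let ?P = "PiE (set is) ?W"
  let ?f = "\<lambda>is \<beta>. Re (cinner (partial_defect n T is (partial_word_adj T is \<beta> h)) (partial_word_adj T is \<beta> h))"
  have i: "i \<notin> set is" using Cons.prems by simp
  have cl: "\<forall>j\<in>{1..n i}. clinear_op (T i j)"
    using polyball_clinear[OF T] Cons.prems by simp
  have "(\<Sum>\<beta>\<in>PiE (set (i # is)) ?W. ?f (i # is) \<beta>) = (\<Sum>(\<alpha>, \<beta>)\<in>?W i \<times> ?P. ?f (i # is) (\<beta>(i := \<alpha>)))"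
    unfolding list.set PiE_insert_eq
    by (subst sum.reindex[OF inj_combinator[OF i]]) (simp add: case_prod_unfold)
  also have "\<dots> = (\<Sum>\<beta>\<in>?P. \<Sum>\<alpha>\<in>?W i. ?f (i # is) (\<beta>(i := \<alpha>)))"
    unfolding sum.cartesian_product[symmetric] by (rule sum.swap)
  also have "\<dots> \<le> (\<Sum>\<beta>\<in>?P. ?f is \<beta>)"
  proof (rule sum_mono)
    fix \<beta>
    \<comment> \<open>Since \<open>i\<close> is absent from the tail, the inner sum only varies the
      leading word, and \<open>row_telescope\<close> applies to the vector produced by the
      tail.\<close>
    have "partial_word_adj T is (\<beta>(i := \<alpha>)) = partial_word_adj T is \<beta>" for \<alpha>
      using i by (intro partial_word_adj_cong) auto
    then show "(\<Sum>\<alpha>\<in>?W i. ?f (i # is) (\<beta>(i := \<alpha>))) \<le> ?f is \<beta>"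
      using row_telescope[where q = q and v = "partial_word_adj T is \<beta> h",
          OF cl positive_partial_defect[OF T, of "is"]]
        Cons.prems by simp
  qed
  also have "\<dots> \<le> (norm h)\<^sup>2" using Cons by simp
  finally show ?case .
qed (simp add: norm_sq_eq_cinner)

lemma clinear_partial_word_adj:
  assumes T: "T \<in> polyball k n" and "set is \<subseteq> {1..k}" "\<And>i. i \<in> set is \<Longrightarrow> \<beta> i \<in> words (n i)"
  shows "clinear_op (partial_word_adj T is \<beta>)"
  using assms(2,3)
  by (induction "is") (auto intro!: clinear_compose clinear_adj clinear_word_op polyball_clinear[OF T])

lemma norm_partial_word_adj_le_1:
  assumes T: "T \<in> polyball k n" and "set is \<subseteq> {1..k}" "\<And>i. i \<in> set is \<Longrightarrow> \<beta> i \<in> words (n i)"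
  shows "norm (partial_word_adj T is \<beta>) \<le> 1"
  using assms(2,3)
proof (induction "is")
  case (Cons i "is")
  have "norm (word_op (T i) (\<beta> i)) \<le> 1"
    using Cons.prems by (intro norm_word_op_le_1[of "n i"] polyball_contraction[OF T]) auto
  moreover have "clinear_op (word_op (T i) (\<beta> i))"
    using Cons.prems by (intro clinear_word_op[of "n i"] polyball_clinear[OF T]) auto
  ultimately have "norm (adj (word_op (T i) (\<beta> i))) \<le> 1"
    using norm_adj_le order_trans by blast
  then show ?case using Cons by (simp add: norm_compose_le_1)
qed (simp add: norm_id_blinfun_le)

text \<open>Only letters of different tuples commute, so \<open>i\<close> must be absent from the
  list. The commutation is proved for words and transferred by taking adjoints.\<close>

lemma partial_word_adj_commute:
  assumes T: "T \<in> polyball k n" and i: "i \<in> {1..k}" "j \<in> {1..n i}"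
    and "set is \<subseteq> {1..k}" "\<And>l. l \<in> set is \<Longrightarrow> \<beta> l \<in> words (n l)" "i \<notin> set is"
  shows "adj (T i j) o\<^sub>L partial_word_adj T is \<beta> = partial_word_adj T is \<beta> o\<^sub>L adj (T i j)"
  using assms(4-)
proof (induction "is")
  case (Cons l "is")
  have l: "l \<in> {1..k}" "l \<noteq> i" "\<beta> l \<in> words (n l)" using Cons.prems by auto
  have "T i j o\<^sub>L word_op (T l) \<alpha> = word_op (T l) \<alpha> o\<^sub>L T i j" if "\<alpha> \<in> words (n l)" for \<alpha>
    using that
  proof (induction \<alpha>)
    case (Cons a \<alpha>)
    have "T i j o\<^sub>L T l a = T l a o\<^sub>L T i j"
      using T i l Cons.prems by (auto simp: polyball_def words_Cons_iff)
    moreover have "T i j o\<^sub>L word_op (T l) \<alpha> = word_op (T l) \<alpha> o\<^sub>L T i j"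
      using Cons by (simp add: words_Cons_iff)
    ultimately show ?case
      by (metis word_op_Cons blinfun_compose_assoc)
  qed simp
  then have "adj (T i j o\<^sub>L word_op (T l) (\<beta> l)) = adj (word_op (T l) (\<beta> l) o\<^sub>L T i j)"
    using l(3) by simp
  then have "adj (T i j) o\<^sub>L adj (word_op (T l) (\<beta> l)) = adj (word_op (T l) (\<beta> l)) o\<^sub>L adj (T i j)"
    using polyball_clinear[OF T i] clinear_word_op[OF polyball_clinear[OF T l(1)] l(3)]
    by (simp add: adj_compose)
  then have "adj (T i j) o\<^sub>L partial_word_adj T (l # is) \<beta> =
      adj (word_op (T l) (\<beta> l)) o\<^sub>L (adj (T i j) o\<^sub>L partial_word_adj T is \<beta>)"
    by (simp add: blinfun_compose_assoc[symmetric])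
  also have "adj (T i j) o\<^sub>L partial_word_adj T is \<beta> = partial_word_adj T is \<beta> o\<^sub>L adj (T i j)"
    using Cons by simp
  finally show ?case by (simp add: blinfun_compose_assoc)
qed simp

text \<open>Taking adjoints reverses the word, so a new first letter ends up at the right of its
  block; the remaining blocks have other indices, and it moves through them to the far
  right.\<close>

lemma partial_word_adj_Cons_letter:
  assumes T: "T \<in> polyball k n" and i: "i \<in> {1..k}" "j \<in> {1..n i}"
    and "set is \<subseteq> {1..k}" "\<And>l. l \<in> set is \<Longrightarrow> \<beta> l \<in> words (n l)" "i \<in> set is" "distinct is"
  shows "partial_word_adj T is (\<beta>(i := j # \<beta> i)) = partial_word_adj T is \<beta> o\<^sub>L adj (T i j)"
  using assms(4-)
proof (induction "is")
  case (Cons l "is")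
  define \<beta>' where "\<beta>' = \<beta>(i := j # \<beta> i)"
  have \<beta>': "\<beta>' i = j # \<beta> i" "\<And>l. l \<noteq> i \<Longrightarrow> \<beta>' l = \<beta> l" by (simp_all add: \<beta>'_def)
  show ?case
    unfolding \<beta>'_def[symmetric]
  proof (cases "l = i")
    case True
    have "partial_word_adj T is \<beta>' = partial_word_adj T is \<beta>"
      using Cons.prems True by (intro partial_word_adj_cong \<beta>'(2)) auto
    moreover have "adj (T i j o\<^sub>L word_op (T i) (\<beta> i)) = adj (word_op (T i) (\<beta> i)) o\<^sub>L adj (T i j)"
      using Cons.prems True i
      by (intro adj_compose polyball_clinear[OF T] clinear_word_op[of "n i"]) auto
    moreover have "adj (T i j) o\<^sub>L partial_word_adj T is \<beta> = partial_word_adj T is \<beta> o\<^sub>L adj (T i j)"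
      using Cons.prems True by (intro partial_word_adj_commute[OF T i]) auto
    ultimately show "partial_word_adj T (l # is) \<beta>' = partial_word_adj T (l # is) \<beta> o\<^sub>L adj (T i j)"
      using True by (simp add: blinfun_compose_assoc \<beta>')
  next
    case False
    then show "partial_word_adj T (l # is) \<beta>' = partial_word_adj T (l # is) \<beta> o\<^sub>L adj (T i j)"
      using Cons \<beta>' by (simp add: blinfun_compose_assoc \<beta>'_def[symmetric])
  qed
qed simp

subsection \<open>The Berezin kernel\<close>

lemma clinear_defect_sqrt: "T \<in> polyball k n \<Longrightarrow> clinear_op (sqrt_op (defect_op k n T))"
  by (intro positive_clinear sqrt_op_positive positive_defect_op)

lemma clinear_word_op_adj:
  assumes "T \<in> polyball k n" "\<beta> \<in> (\<Pi>\<^sub>E i\<in>{1..k}. words (n i))"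
  shows "clinear_op (word_op_adj k T \<beta>)"
  unfolding word_op_adj_eq
  by (rule clinear_partial_word_adj[OF assms(1)]) (use assms(2) in \<open>auto simp: PiE_iff simp del: upt_Suc\<close>)

lemma norm_word_op_adj_le_1:
  assumes "T \<in> polyball k n" "\<beta> \<in> (\<Pi>\<^sub>E i\<in>{1..k}. words (n i))"
  shows "norm (word_op_adj k T \<beta>) \<le> 1"
  unfolding word_op_adj_eq
  by (rule norm_partial_word_adj_le_1[OF assms(1)]) (use assms(2) in \<open>auto simp: PiE_iff simp del: upt_Suc\<close>)

text \<open>Finitely many tuples fit into a box of words of bounded length, to which the telescoped
  estimate applies.\<close>

lemma berezin_bound:
  assumes T: "T \<in> polyball k n" and F: "finite F" "F \<subseteq> (\<Pi>\<^sub>E i\<in>{1..k}. words (n i))"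
  shows "(\<Sum>\<beta>\<in>F. (norm (sqrt_op (defect_op k n T) (word_op_adj k T \<beta> h)))\<^sup>2) \<le> (norm h)\<^sup>2"
proof -
  \<comment> \<open>A crude common length bound: the total length of all words in
    \<open>F\<close>.\<close>
  define q where "q = (\<Sum>\<beta>\<in>F. \<Sum>i=1..k. length (\<beta> i))"
  let ?Q = "\<Pi>\<^sub>E i\<in>{1..k}. {\<alpha> \<in> words (n i). length \<alpha> \<le> q}"
  let ?D = "defect_op k n T"
  let ?f = "\<lambda>\<beta>. (norm (sqrt_op ?D (word_op_adj k T \<beta> h)))\<^sup>2"
  have len: "length (\<beta> i) \<le> q" if "\<beta> \<in> F" "i \<in> {1..k}" for \<beta> i
  proof -
    have "length (\<beta> i) \<le> (\<Sum>i=1..k. length (\<beta> i))"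
      using that(2) by (intro member_le_sum) auto
    also have "\<dots> \<le> q"
      unfolding q_def by (rule member_le_sum[OF that(1)]) (use F in auto)
    finally show ?thesis .
  qed
  have sub: "F \<subseteq> ?Q"
  proof
    fix \<beta> assume \<beta>: "\<beta> \<in> F"
    then have "\<beta> \<in> (\<Pi>\<^sub>E i\<in>{1..k}. words (n i))" using F(2) by blast
    then show "\<beta> \<in> ?Q" using len[OF \<beta>] by (simp add: PiE_iff)
  qed
  have "finite ?Q" by (intro finite_PiE finite_words_upto) simp
  then have "(\<Sum>\<beta>\<in>F. ?f \<beta>) \<le> (\<Sum>\<beta>\<in>?Q. ?f \<beta>)"
    using sub by (intro sum_mono2) auto
  also have "\<dots> = (\<Sum>\<beta>\<in>?Q. Re (cinner (?D (word_op_adj k T \<beta> h)) (word_op_adj k T \<beta> h)))"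
    by (simp add: cinner_positive_sqrt[OF positive_defect_op[OF T]])
  also have "\<dots> \<le> (norm h)\<^sup>2"
    using partial_berezin_bound[where q = q and h = h, OF T, of "[1..<Suc k]"]
    by (simp add: defect_op_eq word_op_adj_eq atLeastLessThanSuc_atLeastAtMost del: upt_Suc)
  finally show ?thesis .
qed

text \<open>The coordinate of the Berezin kernel at a tuple; it is 0 off the admissible tuples
  because the ambient space is indexed by all functions into words.\<close>

definition berezin_component ::
    "nat \<Rightarrow> (nat \<Rightarrow> nat) \<Rightarrow> (nat \<Rightarrow> nat \<Rightarrow> 'a::chilbert_space \<Rightarrow>\<^sub>L 'a) \<Rightarrow> (nat \<Rightarrow> nat list) \<Rightarrow> ('a \<Rightarrow>\<^sub>L 'a)"
  where "berezin_component k n T \<beta> = (if \<beta> \<in> (\<Pi>\<^sub>E i\<in>{1..k}. words (n i))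
    then sqrt_op (defect_op k n T) o\<^sub>L word_op_adj k T \<beta> else 0)"

lemma berezin_component_bound:
  assumes T: "T \<in> polyball k n" and F: "finite F"
  shows "(\<Sum>\<beta>\<in>F. (norm (berezin_component k n T \<beta> h))\<^sup>2) \<le> (1 * norm h)\<^sup>2"
proof -
  let ?W = "\<Pi>\<^sub>E i\<in>{1..k}. words (n i)"
  have "(\<Sum>\<beta>\<in>F. (norm (berezin_component k n T \<beta> h))\<^sup>2)
      = (\<Sum>\<beta>\<in>F \<inter> ?W. (norm (berezin_component k n T \<beta> h))\<^sup>2)"
    using F by (intro sum.mono_neutral_right) (auto simp: berezin_component_def)
  also have "\<dots> = (\<Sum>\<beta>\<in>F \<inter> ?W. (norm (sqrt_op (defect_op k n T) (word_op_adj k T \<beta> h)))\<^sup>2)"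
    by (intro sum.cong) (auto simp: berezin_component_def)
  also have "\<dots> \<le> (norm h)\<^sup>2" using F by (intro berezin_bound T) auto
  finally show ?thesis by simp
qed

text \<open>The defining series is the expansion of the assembled family into \<open>delta\<close>
  vectors, so the function under \<open>Blinfun\<close> really is a bounded operator.\<close>

lemma berezin_kernel_eq:
  assumes T: "T \<in> polyball k n"
  shows "berezin_kernel k n T = ell2_map (berezin_component k n T)"
proof -
  let ?W = "\<Pi>\<^sub>E i\<in>{1..k}. words (n i)"
  let ?K = "ell2_map (berezin_component k n T)"
  have co: "coord (?K h) \<beta> = berezin_component k n T \<beta> h" for h \<beta>
    by (rule coord_ell2_map[OF berezin_component_bound[OF T]]) auto
  have "(\<Sum>\<^sub>\<infinity>\<beta>\<in>?W. elem_tensor k (\<lambda>i. e_word (\<beta> i)) (sqrt_op (defect_op k n T) (word_op_adj k T \<beta> h)))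
      = ?K h" for h
  proof -
    have "(\<Sum>\<^sub>\<infinity>\<beta>\<in>?W. elem_tensor k (\<lambda>i. e_word (\<beta> i)) (sqrt_op (defect_op k n T) (word_op_adj k T \<beta> h)))
        = (\<Sum>\<^sub>\<infinity>\<beta>\<in>?W. delta \<beta> (coord (?K h) \<beta>))"
    proof (rule infsum_cong)
      fix \<beta> assume \<beta>: "\<beta> \<in> ?W"
      then have "\<beta> \<in> extensional {1..k}" by (simp add: PiE_iff)
      then show "elem_tensor k (\<lambda>i. e_word (\<beta> i)) (sqrt_op (defect_op k n T) (word_op_adj k T \<beta> h))
          = delta \<beta> (coord (?K h) \<beta>)"
        using \<beta> by (simp add: elem_tensor_e_word co berezin_component_def)
    qed
    also have "\<dots> = ?K h"
      by (intro infsumI delta_has_sum) (simp add: co berezin_component_def)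
    finally show ?thesis .
  qed
  then show ?thesis unfolding berezin_kernel_def by (simp add: blinfun_apply_inverse)
qed

lemma coord_berezin_kernel:
  assumes T: "T \<in> polyball k n"
  shows "coord (berezin_kernel k n T h) \<beta> = berezin_component k n T \<beta> h"
  unfolding berezin_kernel_eq[OF T]
  by (rule coord_ell2_map[OF berezin_component_bound[OF T]]) auto

lemma clinear_berezin_component:
  "T \<in> polyball k n \<Longrightarrow> clinear_op (berezin_component k n T \<beta>)"
  by (simp add: berezin_component_def clinear_zero clinear_compose clinear_word_op_adj clinear_defect_sqrt)

lemma clinear_berezin_kernel:
  assumes T: "T \<in> polyball k n"
  shows "clinear_op (berezin_kernel k n T)"
  unfolding clinear_op_def
  by (intro allI ell2_eqI)
    (simp add: coord_berezin_kernel[OF T] clinear_opD[OF clinear_berezin_component[OF T]])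

text \<open>The part of a vector orthogonal to the range of \<open>D\<close> is annihilated by
  \<open>D\<close>, hence by its root, and is therefore orthogonal to the range of the root. Thus
  the projection to the defect space fixes all Berezin components.\<close>

lemma projection_range_sqrt:
  assumes D: "positive_op D" and P: "is_projection (closure (range D)) P"
  shows "blinfun_apply P (sqrt_op D x) = sqrt_op D x"
proof -
  define y where "y = sqrt_op D x"
  have Py: "P y \<in> closure (range D)" and perp: "\<And>z. z \<in> closure (range D) \<Longrightarrow> cinner (y - P y) z = 0"
    using P by (auto simp: is_projection_def)
  have "cinner (D (y - P y)) (y - P y) = cinner (y - P y) (D (y - P y))"
    by (rule positive_selfadjoint[OF D])
  also have "\<dots> = 0" by (rule perp) (rule subsetD[OF closure_subset rangeI])
  finally have "sqrt_op D (y - P y) = 0" by (simp add: cinner_positive_sqrt[OF D])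
  then have "cinner (y - P y) y = 0"
    by (subst (3) y_def)
      (simp add: cinner.zero_left flip: positive_selfadjoint[OF sqrt_op_positive[OF D]])
  then have "cinner (y - P y) (y - P y) = 0"
    using perp[OF Py] by (simp add: cinner.diff_right)
  then show ?thesis by (simp add: cinner_self y_def)
qed

subsection \<open>The curvature\<close>

definition word_tuples :: "nat \<Rightarrow> (nat \<Rightarrow> nat) \<Rightarrow> (nat \<Rightarrow> nat) \<Rightarrow> (nat \<Rightarrow> nat list) set"
  where "word_tuples k n q = (\<Pi>\<^sub>E i\<in>{1..k}. {\<alpha> \<in> words (n i). length \<alpha> = q i})"

lemma finite_word_tuples: "finite (word_tuples k n q)"
  unfolding word_tuples_def by (intro finite_PiE finite_words_of_length) simp

lemma card_word_tuples: "card (word_tuples k n q) = (\<Prod>i=1..k. n i ^ q i)"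
  unfolding word_tuples_def by (subst card_PiE) (simp_all add: card_words_of_length)

lemma word_tuples_subset: "word_tuples k n q \<subseteq> (\<Pi>\<^sub>E i\<in>{1..k}. words (n i))"
  unfolding word_tuples_def by (rule PiE_mono) auto

text \<open>Source of the factor \<open>n i\<close> that appears in both the numerator estimate and
  the denominator.\<close>

lemma bij_betw_word_tuples_Suc:
  assumes i: "i \<in> {1..k}"
  shows "bij_betw (\<lambda>(j, \<beta>). \<beta>(i := j # \<beta> i)) ({1..n i} \<times> word_tuples k n q)
    (word_tuples k n (q(i := Suc (q i))))"
proof (rule bij_betw_byWitness[where f' = "\<lambda>\<beta>. (hd (\<beta> i), \<beta>(i := tl (\<beta> i)))"])
  show "(\<lambda>(j, \<beta>). \<beta>(i := j # \<beta> i)) ` ({1..n i} \<times> word_tuples k n q)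
      \<subseteq> word_tuples k n (q(i := Suc (q i)))"
    using i by (auto simp: word_tuples_def PiE_iff extensional_def words_Cons_iff)
  have split: "\<exists>j \<alpha>. \<beta> i = j # \<alpha> \<and> j \<in> {1..n i} \<and> \<alpha> \<in> words (n i) \<and> length \<alpha> = q i"
    if "\<beta> \<in> word_tuples k n (q(i := Suc (q i)))" for \<beta>
  proof -
    have "\<beta> i \<in> words (n i)" "length (\<beta> i) = Suc (q i)"
      using that i by (auto simp: word_tuples_def PiE_iff)
    then show ?thesis by (cases "\<beta> i") (auto simp: words_Cons_iff)
  qed
  show "\<forall>\<beta>\<in>word_tuples k n (q(i := Suc (q i))).
      (\<lambda>(j, \<beta>). \<beta>(i := j # \<beta> i)) (hd (\<beta> i), \<beta>(i := tl (\<beta> i))) = \<beta>"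
    using split by (fastforce simp: fun_eq_iff)
  show "(\<lambda>\<beta>. (hd (\<beta> i), \<beta>(i := tl (\<beta> i)))) ` word_tuples k n (q(i := Suc (q i)))
      \<subseteq> {1..n i} \<times> word_tuples k n q"
  proof (rule image_subsetI)
    fix \<beta> assume \<beta>: "\<beta> \<in> word_tuples k n (q(i := Suc (q i)))"
    then obtain j \<alpha> where "\<beta> i = j # \<alpha>" "j \<in> {1..n i}" "\<alpha> \<in> words (n i)" "length \<alpha> = q i"
      using split by blast
    then show "(hd (\<beta> i), \<beta>(i := tl (\<beta> i))) \<in> {1..n i} \<times> word_tuples k n q"
      using \<beta> i by (auto simp: word_tuples_def PiE_iff extensional_def split: if_splits)
  qed
qed auto

text \<open>The function a(q) with both traces already evaluated, as a real number so that the
  averaging theorem applies.\<close>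

definition normalized_trace ::
    "nat \<Rightarrow> (nat \<Rightarrow> nat) \<Rightarrow> (nat \<Rightarrow> nat \<Rightarrow> 'a::chilbert_space \<Rightarrow>\<^sub>L 'a) \<Rightarrow> (nat \<Rightarrow> nat) \<Rightarrow> real"
  where "normalized_trace k n T q =
    (\<Sum>\<beta>\<in>word_tuples k n q. hs_sum (SOME E. is_onb E) (berezin_component k n T \<beta>)) / (\<Prod>i=1..k. n i ^ q i)"

text \<open>That the space has an orthonormal basis at all is read off the trace class hypothesis,
  whose definition exhibits one.\<close>

lemma
  assumes T: "T \<in> polyball k n" and tc: "trace_class_defect k n T"
  shows onb_some: "is_onb (SOME E :: 'a::chilbert_space set. is_onb E)"
    and hs_summable_defect_sqrt: "hs_summable (SOME E :: 'a set. is_onb E) (sqrt_op (defect_op k n T))"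
proof -
  have "\<exists>E :: 'a set. is_onb E" using tc by (auto simp: trace_class_defect_def trace_class_def)
  then show E: "is_onb (SOME E :: 'a set. is_onb E)" by (rule someI_ex)
  show "hs_summable (SOME E :: 'a set. is_onb E) (sqrt_op (defect_op k n T))"
    by (rule hs_summable_sqrt_op[OF positive_defect_op[OF T] E])
      (use tc in \<open>simp add: trace_class_defect_def\<close>)
qed

lemma hs_summable_berezin_component:
  fixes T :: "nat \<Rightarrow> nat \<Rightarrow> 'a::chilbert_space \<Rightarrow>\<^sub>L 'a"
  assumes T: "T \<in> polyball k n" and tc: "trace_class_defect k n T"
    and \<beta>: "\<beta> \<in> (\<Pi>\<^sub>E i\<in>{1..k}. words (n i))"
  shows "hs_summable (SOME E :: 'a set. is_onb E) (berezin_component k n T \<beta>)"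
  using hs_compose_right[OF onb_some[OF T tc] hs_summable_defect_sqrt[OF T tc] norm_word_op_adj_le_1[OF T \<beta>]
      clinear_word_op_adj[OF T \<beta>] clinear_defect_sqrt[OF T]] \<beta>
  by (simp add: berezin_component_def)

lemma op_trace_defect:
  assumes T: "T \<in> polyball k n" and tc: "trace_class_defect k n T"
  shows "op_trace (defect_op k n T) = of_real (hs_sum (SOME E. is_onb E) (sqrt_op (defect_op k n T)))"
  using op_trace_eq_hs_sum[of "defect_op k n T" "\<lambda>_ :: unit. sqrt_op (defect_op k n T)" "{()}"]
    hs_summable_defect_sqrt[OF T tc]
  by (simp add: cinner_positive_sqrt[OF positive_defect_op[OF T]])

text \<open>Moving the adjoint across turns the quadratic form into that of a diagonal operator at
  the kernel vector; it splits over the tuples, and \<open>P\<close> disappears because it fixes the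
  components.\<close>

lemma op_trace_berezin:
  fixes T :: "nat \<Rightarrow> nat \<Rightarrow> 'a::chilbert_space \<Rightarrow>\<^sub>L 'a"
  assumes T: "T \<in> polyball k n" and tc: "trace_class_defect k n T"
  shows "op_trace (adj (berezin_kernel k n T)
      o\<^sub>L tensor_op k n (defect_space k n T) (\<lambda>i. fock_proj (n i) (q i)) id_blinfun
      o\<^sub>L berezin_kernel k n T) =
    of_real (\<Sum>\<beta>\<in>word_tuples k n q. hs_sum (SOME E. is_onb E) (berezin_component k n T \<beta>))"
proof -
  let ?D = "defect_op k n T"
  have D: "positive_op ?D" by (rule positive_defect_op[OF T])
  have sub: "cvec.subspace (range ?D)"
  proof (rule cvec.subspaceI)
    show "0 \<in> range ?D" by (rule range_eqI[of _ _ 0]) simp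
    fix x y assume "x \<in> range ?D" "y \<in> range ?D"
    then obtain u v where "x = ?D u" "y = ?D v" by blast
    then show "x + y \<in> range ?D" by (intro range_eqI[of _ _ "u + v"]) (simp add: blinfun.add_right)
  next
    fix c x assume "x \<in> range ?D"
    then obtain u where "x = ?D u" by blast
    then show "c *\<^sub>C x \<in> range ?D"
      by (intro range_eqI[of _ _ "c *\<^sub>C u"]) (simp add: clinear_opD[OF positive_clinear[OF D]])
  qed
  then have sub': "cvec.subspace (defect_space k n T)"
    unfolding defect_space_def by (rule closure_subspace)
  obtain P where P: "is_projection (defect_space k n T) P" "clinear_op P"
    by (rule projection_exists[OF sub']) (auto simp: defect_space_def)
  have PB: "P (berezin_component k n T \<beta> x) = berezin_component k n T \<beta> x" for \<beta> x
    using projection_range_sqrt[OF D P(1)[unfolded defect_space_def]]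
    by (simp add: berezin_component_def)
  show ?thesis
  proof (rule op_trace_eq_hs_sum)
    fix x
    let ?C = "tensor_op k n (defect_space k n T) (\<lambda>i. fock_proj (n i) (q i)) id_blinfun"
    let ?K = "berezin_kernel k n T"
    have "cinner ((adj ?K o\<^sub>L ?C o\<^sub>L ?K) x) x = cinner (?C (?K x)) (?K x)"
      by (simp add: cinner_adj_left[OF clinear_berezin_kernel[OF T]])
    also have "\<dots> = (\<Sum>\<beta>\<in>word_tuples k n q. of_real ((norm (berezin_component k n T \<beta> x))\<^sup>2))"
      unfolding tensor_op_fock_proj[OF sub' P] word_tuples_def[symmetric]
        cinner_diag_op[OF finite_word_tuples] coord_berezin_kernel[OF T] PB cinner_self ..
    finally show "cinner ((adj ?K o\<^sub>L ?C o\<^sub>L ?K) x) x =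
      (\<Sum>\<beta>\<in>word_tuples k n q. of_real ((norm (berezin_component k n T \<beta> x))\<^sup>2))" .
  next
    fix \<beta> assume "\<beta> \<in> word_tuples k n q"
    then show "hs_summable (SOME E :: 'a set. is_onb E) (berezin_component k n T \<beta>)"
      using word_tuples_subset by (intro hs_summable_berezin_component T tc) blast
  qed
qed

lemma op_trace_fock_proj:
  "op_trace (tensor_op k n (UNIV :: complex set) (\<lambda>i. fock_proj (n i) (q i)) id_blinfun) =
    of_nat (\<Prod>i=1..k. n i ^ q i)"
  unfolding tensor_op_fock_proj[OF cvec.subspace_UNIV is_projection_id clinear_id]
    word_tuples_def[symmetric] op_trace_diag_op[OF finite_word_tuples] card_word_tuples ..

lemma curv_mean_eq:
  assumes T: "T \<in> polyball k n" and tc: "trace_class_defect k n T"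
  shows "curv_mean k n T m = of_real
    ((\<Sum>q\<in>simplex_points {1..k} m. normalized_trace k n T q) / real ((m + card {1..k}) choose card {1..k}))"
  unfolding curv_mean_def op_trace_berezin[OF T tc] op_trace_fock_proj simplex_points_def[symmetric]
  by (simp add: normalized_trace_def)

lemma normalized_trace_nonneg: "0 \<le> normalized_trace k n T q"
  unfolding normalized_trace_def by (intro divide_nonneg_nonneg sum_nonneg hs_sum_nonneg) (simp add: prod_nonneg)

lemma normalized_trace_0:
  assumes T: "T \<in> polyball k n" and tc: "trace_class_defect k n T"
  shows "normalized_trace k n T (\<lambda>i\<in>{1..k}. 0) = hs_sum (SOME E. is_onb E) (sqrt_op (defect_op k n T))"
proof -
  let ?e = "\<lambda>i\<in>{1..k}. [] :: nat list"
  have "word_tuples k n (\<lambda>i\<in>{1..k}. 0) = (\<Pi>\<^sub>E i\<in>{1..k}. {[]})"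
    unfolding word_tuples_def by (rule PiE_cong) auto
  then have w: "word_tuples k n (\<lambda>i\<in>{1..k}. 0) = {?e}" by (simp add: PiE_singleton[symmetric])
  have "partial_word_adj T is ?e = id_blinfun" if "set is \<subseteq> {1..k}" for "is"
    using that by (induction "is") (auto simp: adj_id)
  then have "word_op_adj k T ?e = id_blinfun" unfolding word_op_adj_eq
    by (metis atLeastLessThanSuc_atLeastAtMost set_upt subset_refl)
  then have "berezin_component k n T ?e = sqrt_op (defect_op k n T)"
    by (simp add: berezin_component_def)
  moreover have "(\<Prod>i=1..k. real (n i) ^ (\<lambda>i\<in>{1..k}. 0) i) = 1" by (rule prod.neutral) simp
  ultimately show ?thesis unfolding normalized_trace_def w by simp
qed

lemma normalized_trace_decreasing:
  fixes T :: "nat \<Rightarrow> nat \<Rightarrow> 'a::chilbert_space \<Rightarrow>\<^sub>L 'a"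
  assumes T: "T \<in> polyball k n" and tc: "trace_class_defect k n T"
    and n: "\<forall>i\<in>{1..k}. 1 \<le> n i" and i: "i \<in> {1..k}"
  shows "normalized_trace k n T (q(i := Suc (q i))) \<le> normalized_trace k n T q"
proof -
  let ?h = "\<lambda>\<beta>. hs_sum (SOME E :: 'a set. is_onb E) (berezin_component k n T \<beta>)"
  let ?N = "\<lambda>q. real (\<Prod>i=1..k. n i ^ q i)"
  have le: "?h (\<beta>(i := j # \<beta> i)) \<le> ?h \<beta>" if j: "j \<in> {1..n i}" and \<beta>: "\<beta> \<in> word_tuples k n q" for j \<beta>
  proof -
    have \<beta>W: "\<beta> \<in> (\<Pi>\<^sub>E i\<in>{1..k}. words (n i))" using \<beta> word_tuples_subset by blast
    then have \<beta>W': "\<beta>(i := j # \<beta> i) \<in> (\<Pi>\<^sub>E i\<in>{1..k}. words (n i))"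
      using i j by (auto simp: PiE_iff extensional_def words_Cons_iff)
    have "word_op_adj k T (\<beta>(i := j # \<beta> i)) = word_op_adj k T \<beta> o\<^sub>L adj (T i j)"
      unfolding word_op_adj_eq using \<beta>W i
      by (intro partial_word_adj_Cons_letter[OF T i j]) (auto simp: PiE_iff simp del: upt_Suc)
    then have eq: "berezin_component k n T (\<beta>(i := j # \<beta> i)) = berezin_component k n T \<beta> o\<^sub>L adj (T i j)"
      unfolding berezin_component_def if_P[OF \<beta>W] if_P[OF \<beta>W'] by (simp only: blinfun_compose_assoc)
    have "clinear_op (T i j)" "norm (T i j) \<le> 1"
      using polyball_clinear[OF T i j] polyball_contraction[OF T i j] .
    then show ?thesis
      unfolding eq
      using hs_compose_right[OF onb_some[OF T tc] hs_summable_berezin_component[OF T tc \<beta>W], of "adj (T i j)"]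
        norm_adj_le[of "T i j"] clinear_berezin_component[OF T] by auto
  qed
  have "(\<Sum>\<beta>\<in>word_tuples k n (q(i := Suc (q i))). ?h \<beta>) =
      (\<Sum>(j, \<beta>)\<in>{1..n i} \<times> word_tuples k n q. ?h (\<beta>(i := j # \<beta> i)))"
    by (subst sum.reindex_bij_betw[OF bij_betw_word_tuples_Suc[OF i], symmetric])
      (simp add: case_prod_unfold)
  also have "\<dots> \<le> (\<Sum>(j, \<beta>)\<in>{1..n i} \<times> word_tuples k n q. ?h \<beta>)"
    using le by (intro sum_mono) auto
  also have "\<dots> = real (n i) * (\<Sum>\<beta>\<in>word_tuples k n q. ?h \<beta>)"
    unfolding sum.cartesian_product[symmetric] by simp
  finally have 1: "(\<Sum>\<beta>\<in>word_tuples k n (q(i := Suc (q i))). ?h \<beta>)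
      \<le> real (n i) * (\<Sum>\<beta>\<in>word_tuples k n q. ?h \<beta>)" .
  have rest: "(\<Prod>l\<in>{1..k} - {i}. n l ^ (q(i := Suc (q i))) l) = (\<Prod>l\<in>{1..k} - {i}. n l ^ q l)"
    by (intro prod.cong) auto
  have 2: "?N (q(i := Suc (q i))) = real (n i) * ?N q"
    using prod.remove[OF _ i, of "\<lambda>l. n l ^ (q(i := Suc (q i))) l"] prod.remove[OF _ i, of "\<lambda>l. n l ^ q l"]
    unfolding rest by simp
  have ni: "0 < real (n i)" using n i by force
  have N: "0 < ?N q" using n by (force intro!: prod_pos simp flip: of_nat_prod)
  have "normalized_trace k n T (q(i := Suc (q i))) \<le>
      (real (n i) * (\<Sum>\<beta>\<in>word_tuples k n q. ?h \<beta>)) / (real (n i) * ?N q)"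
    unfolding normalized_trace_def 2 using ni N by (intro divide_right_mono 1) simp
  also have "\<dots> = normalized_trace k n T q"
    using ni by (simp add: normalized_trace_def)
  finally show ?thesis .
qed

theorem corollary1p6:
  fixes k :: nat and n :: "nat \<Rightarrow> nat"
    and T :: "nat \<Rightarrow> nat \<Rightarrow> 'a::chilbert_space \<Rightarrow>\<^sub>L 'a"
  assumes "1 \<le> k" and "\<forall>i\<in>{1..k}. 1 \<le> n i"
    and "T \<in> polyball k n" and "trace_class_defect k n T"
  shows "0 \<le> curv k n T \<and> curv k n T \<le> op_trace (defect_op k n T) \<and>
    ereal (Re (op_trace (defect_op k n T))) \<le> ereal_of_enat (op_rank (defect_op k n T))"
proof -
  note T = assms(3,4)
  let ?a = "normalized_trace k n T"
  obtain l where l: "0 \<le> l" "l \<le> ?a (\<lambda>i\<in>{1..k}. 0)"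
    "(\<lambda>m. (\<Sum>q\<in>simplex_points {1..k} m. ?a q) / real ((m + card {1..k}) choose card {1..k})) \<longlonglongrightarrow> l"
    by (rule simplex_average_tendsto[of "{1..k}" ?a])
      (auto intro: normalized_trace_nonneg normalized_trace_decreasing[OF T assms(2)])
  have "curv_mean k n T \<longlonglongrightarrow> of_real l"
    unfolding curv_mean_eq[OF T] by (rule tendsto_of_real[OF l(3)])
  \<comment> \<open>\<open>lim\<close> is determined by the convergence just shown; as the limit is
    real, the complex order reduces to that of the reals.\<close>
  then have "curv k n T = of_real l"
    unfolding curv_def by (rule limI)
  moreover have "ereal (hs_sum (SOME E. is_onb E) (sqrt_op (defect_op k n T)))
      \<le> ereal_of_enat (op_rank (defect_op k n T))"
  proof (rule hs_sum_sqrt_le_rank[OF positive_defect_op[OF T(1)] _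
        is_onb_orthonormal[OF onb_some[OF T]] hs_summable_defect_sqrt[OF T]])
    show "Re (cinner (defect_op k n T x) x) \<le> (norm x)\<^sup>2" for x
      unfolding defect_op_eq by (rule partial_defect_le[OF T(1)]) (auto simp del: upt_Suc)
  qed
  ultimately show ?thesis
    using l(1) l(2)[unfolded normalized_trace_0[OF T]]
    by (simp add: op_trace_defect[OF T] less_eq_complex_def)
qed

end
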